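(* For any prime number $p$, every $pE$-group of order at most $p^6$ is abelian.
   Context: A group $G$ is called an $E$-group if every element of $G$ commutes with each of its endomorphic images, i.e. $x\,x^{\alpha}=x^{\alpha}x$ for every $x\in G$ and every endomorphism $\alpha$ of $G$. For a prime $p$, a $pE$-group is an $E$-group which is also a $p$-group. *)

theory Defs
  imports "HOL-Algebra.Algebra" "HOL-Computational_Algebra.Primes"
begin

(* An endomorphism of G is an element of hom G G; the values of such a map outside
   carrier G are irrelevant. *)
locale E_group = group G for G (structure) +
  assumes commutes_with_endo_image:
    "\<lbrakk>\<alpha> \<in> hom G G; x \<in> carrier G\<rbrakk> \<Longrightarrow> x \<otimes> \<alpha> x = \<alpha> x \<otimes> x"

(* The order of every element is a power of p. As ord x = 0 for an element x of infinite
   order, such elements are excluded; G itself is not required to be finite. *)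
locale p_group = group G for G (structure) +
  fixes p :: nat (* Factorial_Ring.prime: plain prime is shadowed by the HOL-Algebra notion *)
  assumes p_prime: "Factorial_Ring.prime p"
    and ord_prime_power: "x \<in> carrier G \<Longrightarrow> \<exists>k. ord x = p ^ k"

locale pE_group = E_group G + p_group G p for G (structure) and p

end

theory Submission
  imports Defs "HOL-Analysis.Determinants"
begin

text \<open>
  An element commutes with its conjugates, and if \<open>[[a, b], c] \<noteq> 1\<close> for some \<open>a, b, c\<close> then successive
  centralizers of \<open>[b, c]\<close>, \<open>[a, c]\<close>, \<open>[a, b]\<close>, \<open>c\<close>, \<open>b\<close>, \<open>a\<close> strictly decrease, which forces \<open>p\<^sup>7\<close>
  elements; so \<open>G\<close> has class 2. Let \<open>D\<close> be the derived subgroup, \<open>Z\<close> the centre and \<open>n\<close> the exponent of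
  \<open>G / D\<close>. Endomorphisms with cyclic image show that every \<open>x\<close> with \<open>x\<^sup>n = 1\<close> is central. If \<open>x \<mapsto> x\<^sup>n\<close> is a
  homomorphism, then \<open>|G / Z| \<le> |D|\<close>, and a nonabelian \<open>G\<close> has order \<open>p\<^sup>6\<close> with \<open>D = Z\<close> and \<open>G / Z\<close> both
  of order \<open>p\<^sup>3\<close> and exponent \<open>p\<close>. Such a group is described by a \<open>3 \<times> 3\<close> matrix \<open>N\<close> modulo \<open>p\<close> (powers of the
  generators in terms of their commutators), its endomorphisms are the matrices \<open>T\<close> with
  \<open>cof(T) N = N T\<close>, and the \<open>E\<close>-property would make all of these scalar; but there is always a nonscalar
  one. Otherwise \<open>p = 2\<close>, and the remaining groups of order at most 64 are excluded by
  further counting and by explicit automorphisms.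
\<close>

section \<open>Centralizers and nilpotency class\<close>

text \<open>Three generators are decisive because the exterior square of a three-dimensional space
  is its dual: in coordinates \<open>com\<close> becomes the cross product, and a map acting on
  \<open>G / Z\<close> by \<open>T\<close> acts on commutators by the cofactor matrix of
  \<open>T\<close>. For invertible \<open>T\<close> that matrix is det(T) times the inverse
  transpose, so cof(T) N = N T says that \<open>T\<close> preserves the bilinear form
  \<open>N\<close> up to the factor det(T). The \<open>E\<close>-property makes \<open>v\<close> and
  \<open>T v\<close> parallel for every \<open>v\<close>, which only scalars satisfy. As elements of
  order \<open>p\<close> are central, \<open>N\<close> is nonsingular, and for odd \<open>p\<close>
  a nondegenerate form in dimension three has a nonscalar isometry of determinant 1.

  The obstacle is \<open>p = 2\<close>. Collecting \<open>(x \<otimes> y) [^] n\<close> produces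
  commutators to the power n(n - 1)/2, a multiple of n only for odd n. So the power map may fail to
  be a homomorphism, and the comparison of |G / Z| with |D| is lost.\<close>

lemma hom_of_transport:
  assumes onto: "\<And>g. g \<in> carrier G \<Longrightarrow> \<exists>i\<in>I. \<Phi> i = g"
    and closed: "\<And>i. i \<in> I \<Longrightarrow> \<Psi> i \<in> carrier H"
    and wd: "\<And>i j. \<lbrakk>i \<in> I; j \<in> I; \<Phi> i = \<Phi> j\<rbrakk> \<Longrightarrow> \<Psi> i = \<Psi> j"
    and mult: "\<And>i j. \<lbrakk>i \<in> I; j \<in> I\<rbrakk> \<Longrightarrow>
      \<exists>k\<in>I. \<Phi> k = \<Phi> i \<otimes>\<^bsub>G\<^esub> \<Phi> j \<and> \<Psi> k = \<Psi> i \<otimes>\<^bsub>H\<^esub> \<Psi> j"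
  shows "\<exists>\<alpha>\<in>hom G H. \<forall>i\<in>I. \<Phi> i \<in> carrier G \<longrightarrow> \<alpha> (\<Phi> i) = \<Psi> i"
proof -
  \<comment> \<open>\<open>\<Phi>\<close> lists the elements of \<open>G\<close>, possibly with
    repetitions, and \<open>\<Psi>\<close> the intended images. An arbitrary choice \<open>r\<close>
    of parameters suffices, since \<open>wd\<close> makes the image independent of it.\<close>
  define r where "r g = (SOME i. i \<in> I \<and> \<Phi> i = g)" for g
  have r: "r g \<in> I" "\<Phi> (r g) = g" if "g \<in> carrier G" for g
    using someI_ex[of "\<lambda>i. i \<in> I \<and> \<Phi> i = g"] onto[OF that] unfolding r_def by auto
  have val: "\<Psi> (r (\<Phi> i)) = \<Psi> i" if "i \<in> I" "\<Phi> i \<in> carrier G" for i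
    using wd[of "r (\<Phi> i)" i] r[of "\<Phi> i"] that by simp
  have "(\<lambda>g. \<Psi> (r g)) \<in> hom G H"
  proof (rule homI)
    fix x y assume xy: "x \<in> carrier G" "y \<in> carrier G"
    then obtain k where k: "k \<in> I" "\<Phi> k = x \<otimes>\<^bsub>G\<^esub> y" "\<Psi> k = \<Psi> (r x) \<otimes>\<^bsub>H\<^esub> \<Psi> (r y)"
      using mult[of "r x" "r y"] r by auto
    show "\<Psi> (r (x \<otimes>\<^bsub>G\<^esub> y)) = \<Psi> (r x) \<otimes>\<^bsub>H\<^esub> \<Psi> (r y)"
    proof (cases "x \<otimes>\<^bsub>G\<^esub> y \<in> carrier G")
      case True
      then show ?thesis using val[of k] k by simp
    next
      \<comment> \<open>\<open>G\<close> is a bare structure here, so the product may leave its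
        carrier; \<open>k\<close> still witnesses the choice in \<open>r\<close>.\<close>
      case False
      have "r (x \<otimes>\<^bsub>G\<^esub> y) \<in> I \<and> \<Phi> (r (x \<otimes>\<^bsub>G\<^esub> y)) = x \<otimes>\<^bsub>G\<^esub> y"
        unfolding r_def by (rule someI[of _ k]) (use k in auto)
      then show ?thesis using wd[of "r (x \<otimes>\<^bsub>G\<^esub> y)" k] k by simp
    qed
  qed (use r closed in auto)
  then show ?thesis using val by (intro bexI[of _ "\<lambda>g. \<Psi> (r g)"]) auto
qed

section \<open>Commutators, centralizers and extensions of a subgroup by one element\<close>

context group
begin

definition com :: "'a \<Rightarrow> 'a \<Rightarrow> 'a"
  where "com x y = x \<otimes> y \<otimes> inv x \<otimes> inv y"

definition cent :: "'a \<Rightarrow> 'a set"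
  where "cent x = {y \<in> carrier G. x \<otimes> y = y \<otimes> x}"

definition centre :: "'a set"
  where "centre = {z \<in> carrier G. \<forall>x\<in>carrier G. x \<otimes> z = z \<otimes> x}"

text \<open>The product set of \<open>H\<close> and the cyclic group of \<open>t\<close>. It is the
  subgroup generated by both as soon as \<open>H\<close> contains all commutators and hence is
  normal; the explicit form supplies the normal forms on which homomorphisms are defined.\<close>

definition adjoin :: "'a set \<Rightarrow> 'a \<Rightarrow> 'a set"
  where "adjoin H t = {h \<otimes> t [^] (i::int) | h i. h \<in> H}"

lemma com_closed [intro, simp]: "\<lbrakk>x \<in> carrier G; y \<in> carrier G\<rbrakk> \<Longrightarrow> com x y \<in> carrier G"
  by (simp add: com_def)

lemma inv_mult_cancel [simp]:
  assumes "x \<in> carrier G" "y \<in> carrier G"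
  shows "inv x \<otimes> (x \<otimes> y) = y" "x \<otimes> (inv x \<otimes> y) = y"
  using assms by (simp_all add: m_assoc[symmetric])

lemma com_mult_swap: "\<lbrakk>x \<in> carrier G; y \<in> carrier G\<rbrakk> \<Longrightarrow> x \<otimes> y = com x y \<otimes> (y \<otimes> x)"
  by (simp add: com_def m_assoc)

lemma com_eqI:
  assumes "x \<in> carrier G" "y \<in> carrier G" "d \<in> carrier G" "x \<otimes> y = d \<otimes> (y \<otimes> x)"
  shows "com x y = d"
  using assms com_mult_swap[of x y] by (metis com_closed m_closed r_cancel)

lemma com_eq_one_iff:
  "\<lbrakk>x \<in> carrier G; y \<in> carrier G\<rbrakk> \<Longrightarrow> com x y = \<one> \<longleftrightarrow> x \<otimes> y = y \<otimes> x"
  using com_mult_swap[of x y] com_eqI[of x y \<one>] by auto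

lemma com_self [simp]: "x \<in> carrier G \<Longrightarrow> com x x = \<one>"
  by (simp add: com_eq_one_iff)

lemma com_swap: "\<lbrakk>x \<in> carrier G; y \<in> carrier G\<rbrakk> \<Longrightarrow> com y x = inv (com x y)"
  by (simp add: com_def inv_mult_group m_assoc)

lemma subgroup_cent: "x \<in> carrier G \<Longrightarrow> subgroup (cent x) G"
proof
  fix y assume x: "x \<in> carrier G" and y: "y \<in> cent x"
  have yc: "y \<in> carrier G" using y by (simp add: cent_def)
  then have "x \<otimes> inv y = inv y \<otimes> (y \<otimes> x) \<otimes> inv y" using x by simp
  also have "\<dots> = inv y \<otimes> (x \<otimes> y) \<otimes> inv y" using y by (simp add: cent_def)
  also have "\<dots> = inv y \<otimes> x" using x yc by (simp add: m_assoc)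
  finally show "inv y \<in> cent x"
    using x y by (simp add: cent_def)
next
  fix y z assume "x \<in> carrier G" "y \<in> cent x" "z \<in> cent x"
  then show "y \<otimes> z \<in> cent x" by (simp add: cent_def) (metis m_assoc)
qed (auto simp: cent_def)

lemma cent_eq: "x \<in> carrier G \<Longrightarrow> cent x = {y \<in> carrier G. com x y = \<one>}"
  using com_eq_one_iff[of x] unfolding cent_def by blast

lemma subgroup_mult_left_iff:
  assumes "subgroup H G" "h \<in> H" "x \<in> carrier G"
  shows "h \<otimes> x \<in> H \<longleftrightarrow> x \<in> H"
proof
  have h: "h \<in> carrier G" using assms subgroup.mem_carrier by metis
  assume "h \<otimes> x \<in> H"
  then have "inv h \<otimes> (h \<otimes> x) \<in> H"
    by (rule subgroup.m_closed[OF assms(1) subgroup.m_inv_closed[OF assms(1,2)]])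
  then show "x \<in> H" using h assms(3) by simp
qed (rule subgroup.m_closed[OF assms(1,2)])

lemma subgroup_mult_right_iff:
  assumes "subgroup H G" "h \<in> H" "x \<in> carrier G"
  shows "x \<otimes> h \<in> H \<longleftrightarrow> x \<in> H"
proof
  have h: "h \<in> carrier G" using assms subgroup.mem_carrier by metis
  assume "x \<otimes> h \<in> H"
  then have "x \<otimes> h \<otimes> inv h \<in> H"
    by (rule subgroup.m_closed[OF assms(1) _ subgroup.m_inv_closed[OF assms(1,2)]])
  then show "x \<in> H" using h assms(3) by (simp add: m_assoc)
qed (rule subgroup.m_closed[OF assms(1) _ assms(2)])

lemma subgroup_nat_pow_mem: "\<lbrakk>subgroup H G; x \<in> H\<rbrakk> \<Longrightarrow> x [^] (n::nat) \<in> H"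
  by (induction n) (simp_all add: subgroup.one_closed subgroup.m_closed)

lemma cent_sym: "\<lbrakk>x \<in> carrier G; y \<in> cent x\<rbrakk> \<Longrightarrow> x \<in> cent y"
  by (simp add: cent_def)

lemma cent_self: "x \<in> carrier G \<Longrightarrow> x \<in> cent x"
  by (simp add: cent_def)

lemma cent_carrier: "y \<in> cent x \<Longrightarrow> y \<in> carrier G"
  by (simp add: cent_def)

lemma centre_carrier: "z \<in> centre \<Longrightarrow> z \<in> carrier G"
  by (simp add: centre_def)

lemma centre_cent: "\<lbrakk>z \<in> centre; x \<in> carrier G\<rbrakk> \<Longrightarrow> z \<in> cent x"
  by (simp add: centre_def cent_def)

lemma centre_comm: "\<lbrakk>z \<in> centre; x \<in> carrier G\<rbrakk> \<Longrightarrow> z \<otimes> x = x \<otimes> z"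
  by (simp add: centre_def)

lemma subgroup_centre: "subgroup centre G"
proof -
  have "centre = (\<Inter> (cent ` carrier G))"
    using one_closed by (auto simp: centre_def cent_def)
  then show ?thesis using subgroup_cent subgroups_Inter[of "cent ` carrier G"] by auto
qed

lemma centre_comI: "\<lbrakk>x \<in> carrier G; \<And>y. y \<in> carrier G \<Longrightarrow> com x y = \<one>\<rbrakk> \<Longrightarrow> x \<in> centre"
  by (auto simp: centre_def com_eq_one_iff)

lemma centre_com: "\<lbrakk>x \<in> centre; y \<in> carrier G\<rbrakk> \<Longrightarrow> com x y = \<one> \<and> com y x = \<one>"
  by (auto simp: centre_def com_eq_one_iff)

lemma commutators_normal:
  assumes "subgroup H G" "\<And>x y. \<lbrakk>x \<in> carrier G; y \<in> carrier G\<rbrakk> \<Longrightarrow> com x y \<in> H"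
    and "h \<in> H" "x \<in> carrier G"
  shows "x \<otimes> h \<otimes> inv x \<in> H"
proof -
  have h: "h \<in> carrier G" using assms subgroup.mem_carrier by metis
  then have "com x h \<otimes> h = x \<otimes> h \<otimes> inv x"
    using assms(4) by (simp add: com_def m_assoc)
  then show ?thesis using assms subgroup.m_closed h by metis
qed

lemma adjoin_properties:
  assumes H: "subgroup H G" and coms: "\<And>x y. \<lbrakk>x \<in> carrier G; y \<in> carrier G\<rbrakk> \<Longrightarrow> com x y \<in> H"
    and t: "t \<in> carrier G"
  shows subgroup_adjoin: "subgroup (adjoin H t) G"
    and adjoin_incl: "H \<subseteq> adjoin H t"
    and adjoin_mem: "t \<in> adjoin H t"
proof -
  have Hc: "h \<in> carrier G" if "h \<in> H" for h using that H subgroup.mem_carrier by metis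
  show "subgroup (adjoin H t) G"
  proof (rule subgroupI)
    show "adjoin H t \<subseteq> carrier G" using Hc t by (auto simp: adjoin_def)
    show "adjoin H t \<noteq> {}" using subgroup.one_closed[OF H] by (auto simp: adjoin_def)
  next
    fix a assume "a \<in> adjoin H t"
    then obtain h i where a: "h \<in> H" "a = h \<otimes> t [^] (i::int)" by (auto simp: adjoin_def)
    have "t [^] (-i) \<otimes> inv h \<otimes> inv (t [^] (-i)) \<in> H"
      using commutators_normal[OF H coms, of "inv h" "t [^] (-i)"] a H t
      by (simp add: subgroup.m_inv_closed)
    moreover have "inv a = t [^] (-i) \<otimes> inv h \<otimes> inv (t [^] (-i)) \<otimes> t [^] (-i)"
      using a t Hc by (simp add: inv_mult_group int_pow_neg m_assoc)
    ultimately show "inv a \<in> adjoin H t" unfolding adjoin_def by blast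
  next
    fix a b assume "a \<in> adjoin H t" "b \<in> adjoin H t"
    then obtain h i k j where a: "h \<in> H" "a = h \<otimes> t [^] (i::int)"
      and b: "k \<in> H" "b = k \<otimes> t [^] (j::int)" by (auto simp: adjoin_def)
    have "h \<otimes> (t [^] i \<otimes> k \<otimes> inv (t [^] i)) \<in> H"
      using commutators_normal[OF H coms, of k "t [^] i"] a b H t by (simp add: subgroup.m_closed)
    moreover have "a \<otimes> b = h \<otimes> (t [^] i \<otimes> k \<otimes> inv (t [^] i)) \<otimes> t [^] (i + j)"
      using a b t Hc by (simp add: int_pow_mult m_assoc inv_solve_left)
    ultimately show "a \<otimes> b \<in> adjoin H t" unfolding adjoin_def by blast
  qed
  show "H \<subseteq> adjoin H t"
  proof
    fix h assume "h \<in> H"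
    then have "h = h \<otimes> t [^] (0::int)" using Hc by simp
    then show "h \<in> adjoin H t" using \<open>h \<in> H\<close> unfolding adjoin_def by blast
  qed
  have "t = \<one> \<otimes> t [^] (1::int)" using t by simp
  then show "t \<in> adjoin H t" using subgroup.one_closed[OF H] unfolding adjoin_def by blast
qed

lemma adjoin_least:
  assumes "subgroup K G" "H \<subseteq> K" "t \<in> K"
  shows "adjoin H t \<subseteq> K"
  using assms by (auto simp: adjoin_def intro!: subgroup.m_closed subgroup_int_pow_closed)

lemma card_subgroup_dvd:
  assumes "subgroup H G" "subgroup K G" "H \<subseteq> K"
  shows "card H dvd card K"
proof -
  interpret K: group "G\<lparr>carrier := K\<rparr>" using assms(2) by (rule subgroup_imp_group)
  have "subgroup H (G\<lparr>carrier := K\<rparr>)" using assms by (simp add: subgroup_incl)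
  from K.lagrange[OF this] have "card (rcosets\<^bsub>G\<lparr>carrier := K\<rparr>\<^esub> H) * card H = card K"
    by (simp add: order_def)
  then show ?thesis by (metis dvd_triv_right)
qed

text \<open>The first isomorphism theorem as a count. Power maps, \<open>com a\<close> and twisted
  squarings on abelian subgroups all enter through it.\<close>

lemma card_hom_image:
  assumes H: "subgroup H G" and hom: "\<And>x y. \<lbrakk>x \<in> H; y \<in> H\<rbrakk> \<Longrightarrow> f (x \<otimes> y) = f x \<otimes> f y"
    and closed: "\<And>x. x \<in> H \<Longrightarrow> f x \<in> carrier G"
  shows "card H = card (f ` H) * card {x \<in> H. f x = \<one>}"
proof -
  interpret H: group "G\<lparr>carrier := H\<rparr>" using H by (rule subgroup_imp_group)
  interpret f: group_hom "G\<lparr>carrier := H\<rparr>" G f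
    by unfold_locales (use hom closed in \<open>auto simp: hom_def\<close>)
  have img: "subgroup (f ` H) G" using f.img_is_subgroup by simp
  interpret g: group_hom "G\<lparr>carrier := H\<rparr>" "G\<lparr>carrier := f ` H\<rparr>" f
    using subgroup_imp_group[OF img] H.group_axioms hom
    by (auto simp: group_hom_def group_hom_axioms_def hom_def)
  have ker: "kernel (G\<lparr>carrier := H\<rparr>) (G\<lparr>carrier := f ` H\<rparr>) f = {x \<in> H. f x = \<one>}"
    by (simp add: kernel_def)
  have "card (rcosets\<^bsub>G\<lparr>carrier := H\<rparr>\<^esub> {x \<in> H. f x = \<one>}) = card (f ` H)"
    using g.FactGroup_iso_set iso_same_card[of "G\<lparr>carrier := H\<rparr> Mod {x \<in> H. f x = \<one>}"
      "G\<lparr>carrier := f ` H\<rparr>"] unfolding ker by (auto simp: is_iso_def FactGroup_def)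
  then show ?thesis using H.lagrange[OF g.subgroup_kernel] ker by (simp add: order_def)
qed

end

section \<open>Orders of subgroups of finite \<open>p\<close>-groups\<close>

locale finite_p_group = p_group +
  assumes finite_carrier: "finite (carrier G)"
begin

lemma finite_subgroup: "subgroup H G \<Longrightarrow> finite H"
  using finite_carrier subgroup.subset finite_subset by metis

text \<open>\<open>p_group\<close> restricts element orders only. A prime \<open>q\<close> dividing
  the cofactor \<open>m\<close> yields, by Sylow with exponent 1, a subgroup of order
  \<open>q\<close>; a nontrivial element of it has an order that divides \<open>q\<close> and is a
  power of \<open>p\<close>.\<close>

lemma order_prime_power: "\<exists>k. card (carrier G) = p ^ k"
proof -
  have "card (carrier G) \<noteq> 0" using finite_carrier one_closed by auto
  moreover have "\<not> is_unit p" using p_prime by (auto dest: not_prime_unit)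
  ultimately obtain k m where m: "card (carrier G) = p ^ k * m" "\<not> p dvd m"
    by (rule multiplicity_decompose')
  have "m = 1"
  proof (rule ccontr)
    assume "m \<noteq> 1"
    then obtain q where q: "Factorial_Ring.prime q" "q dvd m" using prime_factor_nat by blast
    then have "q dvd order G" using m(1) unfolding order_def by simp
    then obtain l where l: "order G = q ^ 1 * l" by (auto simp: dvd_def)
    obtain H where H: "subgroup H G" "card H = q"
      using sylow_thm[OF q(1) group_axioms l finite_carrier] by auto
    then obtain x where x: "x \<in> H" "x \<noteq> \<one>"
    proof -
      have "H \<noteq> {\<one>}" using H(2) prime_gt_1_nat[OF q(1)] by auto
      then show thesis using that subgroup.one_closed[OF H(1)] by blast
    qed
    then have xc: "x \<in> carrier G" using H subgroup.mem_carrier by metis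
    interpret H: group "G\<lparr>carrier := H\<rparr>" using H(1) by (rule subgroup_imp_group)
    have "x [^]\<^bsub>G\<lparr>carrier := H\<rparr>\<^esub> order (G\<lparr>carrier := H\<rparr>) = \<one>"
      using H.pow_order_eq_1[of x] x by simp
    then have "x [^] q = \<one>" using H by (simp add: order_def nat_pow_consistent[of x q H])
    then have "ord x dvd q" using xc pow_eq_id by blast
    moreover have "ord x \<noteq> 1" using xc x ord_eq_1 by blast
    moreover obtain k where "ord x = p ^ k" using ord_prime_power xc by blast
    ultimately have "p dvd q" by (cases k) (auto dest: dvd_mult_left)
    then have "p = q" using p_prime q(1) primes_dvd_imp_eq by blast
    then show False using m(2) q(2) by simp
  qed
  then show ?thesis using m(1) by auto
qed

text \<open>The index is a power of \<open>p\<close> by Lagrange and is not 1. Most order estimates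
  below count strict inclusions, each worth a factor \<open>p\<close>.\<close>

lemma psubgroup_card:
  assumes H: "subgroup H G" and K: "subgroup K G" and "H \<subset> K"
  shows "p * card H \<le> card K"
proof -
  obtain k where k: "card (carrier G) = p ^ k" using order_prime_power by blast
  obtain l where l: "card K = card H * l" using card_subgroup_dvd[OF H K] assms by (auto simp: dvd_def)
  have "card H < card K" using assms finite_subgroup psubset_card_mono by blast
  then have "l \<noteq> 1" "l \<noteq> 0" using l by auto
  moreover have "l dvd p ^ k"
  proof -
    have "card H * l dvd p ^ k"
      using card_subgroup_dvd[OF K subgroup_self subgroup.subset[OF K]] k l by simp
    then show ?thesis by (rule dvd_mult_right)
  qed
  then obtain j where "l = p ^ j" using divides_primepow_nat[OF p_prime] by blast
  ultimately have "p dvd l" by (cases j) auto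
  then have "p * card H \<le> l * card H" using \<open>l \<noteq> 0\<close> by (intro mult_le_mono1 dvd_imp_le) auto
  then show ?thesis using l by (simp only: mult.commute)
qed

end

section \<open>Conjugates and triple commutators in \<open>E\<close>-groups\<close>

context E_group
begin

text \<open>The centralizer of the normal closure of \<open>a\<close>. Conjugations are
  endomorphisms, so in an \<open>E\<close>-group \<open>a\<close> itself belongs to it, and normal
  closures of single elements are abelian.\<close>

definition ncent :: "'a \<Rightarrow> 'a set"
  where "ncent a = (\<Inter>g\<in>carrier G. cent (g \<otimes> a \<otimes> inv g))"

lemma conj_hom: "g \<in> carrier G \<Longrightarrow> (\<lambda>x. g \<otimes> x \<otimes> inv g) \<in> hom G G"
  by (auto simp: hom_def m_assoc)

lemma conj_cent: "\<lbrakk>x \<in> carrier G; g \<in> carrier G\<rbrakk> \<Longrightarrow> g \<otimes> x \<otimes> inv g \<in> cent x"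
  using commutes_with_endo_image[OF conj_hom, of g x] by (simp add: cent_def)

lemma subgroup_ncent: "a \<in> carrier G \<Longrightarrow> subgroup (ncent a) G"
  unfolding ncent_def
proof (rule subgroups_Inter)
  show "(\<lambda>g. cent (g \<otimes> a \<otimes> inv g)) ` carrier G \<noteq> {}" using one_closed by blast
  fix H assume "a \<in> carrier G" "H \<in> (\<lambda>g. cent (g \<otimes> a \<otimes> inv g)) ` carrier G"
  then obtain g where "g \<in> carrier G" "H = cent (g \<otimes> a \<otimes> inv g)" by blast
  then show "subgroup H G" using subgroup_cent \<open>a \<in> carrier G\<close> by simp
qed

lemma ncentD: "\<lbrakk>x \<in> ncent a; g \<in> carrier G\<rbrakk> \<Longrightarrow> x \<in> cent (g \<otimes> a \<otimes> inv g)"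
  by (simp add: ncent_def)

lemma ncent_cent:
  assumes "a \<in> carrier G" "x \<in> ncent a"
  shows "x \<in> cent a"
proof -
  show ?thesis using ncentD[OF assms(2) one_closed] assms(1) by simp
qed

lemma ncent_self: "a \<in> carrier G \<Longrightarrow> a \<in> ncent a"
  unfolding ncent_def using cent_sym[OF _ conj_cent] by simp

lemma ncent_carrier: "\<lbrakk>a \<in> carrier G; x \<in> ncent a\<rbrakk> \<Longrightarrow> x \<in> carrier G"
  using ncent_cent cent_carrier by blast

lemma cent_conj:
  assumes "x \<in> carrier G" "y \<in> carrier G" "h \<in> carrier G" "x \<in> cent y"
  shows "h \<otimes> x \<otimes> inv h \<in> cent (h \<otimes> y \<otimes> inv h)"
proof -
  have "h \<otimes> (y \<otimes> x) \<otimes> inv h = h \<otimes> (x \<otimes> y) \<otimes> inv h" using assms by (simp add: cent_def)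
  then show ?thesis using assms by (simp add: cent_def m_assoc)
qed

lemma ncent_conj:
  assumes "a \<in> carrier G" "h \<in> carrier G" "x \<in> ncent a"
  shows "h \<otimes> x \<otimes> inv h \<in> ncent a"
  unfolding ncent_def
proof
  fix g assume g: "g \<in> carrier G"
  have x: "x \<in> carrier G" using assms ncent_carrier by blast
  have "x \<in> cent ((inv h \<otimes> g) \<otimes> a \<otimes> inv (inv h \<otimes> g))"
    using ncentD[OF assms(3), of "inv h \<otimes> g"] assms g by simp
  from cent_conj[OF x _ assms(2) this]
  show "h \<otimes> x \<otimes> inv h \<in> cent (g \<otimes> a \<otimes> inv g)"
    using assms g by (simp add: m_assoc inv_mult_group)
qed

lemma ncent_com_left:
  assumes "a \<in> carrier G" "x \<in> ncent a" "c \<in> carrier G"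
  shows "com x c \<in> ncent a"
proof -
  have xc: "x \<in> carrier G" using assms ncent_carrier by blast
  have "com x c = x \<otimes> inv (c \<otimes> x \<otimes> inv c)"
    using assms xc by (simp add: com_def m_assoc inv_mult_group)
  then show ?thesis using ncent_conj[OF assms(1,3,2)] subgroup_ncent[OF assms(1)] assms(2)
    by (simp add: subgroup.m_closed subgroup.m_inv_closed)
qed

lemma ncent_com_right:
  assumes "a \<in> carrier G" "x \<in> ncent a" "c \<in> carrier G"
  shows "com c x \<in> ncent a"
  unfolding com_swap[OF ncent_carrier[OF assms(1,2)] assms(3)]
  by (rule subgroup.m_inv_closed[OF subgroup_ncent[OF assms(1)] ncent_com_left[OF assms]])

text \<open>\<open>com a c\<close> is \<open>a\<close> times the inverse of a conjugate of
  \<open>a\<close>, and \<open>x\<close> commutes with both.\<close>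

lemma ncent_cent_com:
  assumes a: "a \<in> carrier G" and "x \<in> ncent a" and c: "c \<in> carrier G"
  shows "com a c \<in> cent x" "com c a \<in> cent x"
proof -
  have x: "x \<in> carrier G" using assms ncent_carrier by blast
  have "a \<in> cent x" using cent_sym[OF a ncent_cent] assms by simp
  moreover have "c \<otimes> a \<otimes> inv c \<in> cent x"
    using cent_sym[OF _ ncentD] assms by simp
  moreover have "com a c = a \<otimes> inv (c \<otimes> a \<otimes> inv c)"
    using a c by (simp add: com_def m_assoc inv_mult_group)
  ultimately show *: "com a c \<in> cent x"
    using subgroup_cent[OF x] by (simp add: subgroup.m_closed subgroup.m_inv_closed)
  then show "com c a \<in> cent x"
    using com_swap[OF a c] subgroup.m_inv_closed[OF subgroup_cent[OF x]] by simp
qed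

text \<open>A commutator lies in the abelian normal closure of each of its entries; this is the
  2-Engel law.\<close>

lemma com_cent:
  assumes "a \<in> carrier G" "b \<in> carrier G"
  shows "com a b \<in> cent a" "com a b \<in> cent b" "a \<in> cent (com a b)" "b \<in> cent (com a b)"
proof -
  show 1: "com a b \<in> cent a" and 2: "com a b \<in> cent b"
    using ncent_cent_com[OF assms(1) ncent_self] ncent_cent_com[OF assms(2) ncent_self] assms by auto
  show "a \<in> cent (com a b)" "b \<in> cent (com a b)"
    using cent_sym[OF _ 1] cent_sym[OF _ 2] assms by auto
qed

lemma cent_com_swap:
  assumes "a \<in> carrier G" "b \<in> carrier G" "c \<in> carrier G" "c \<in> cent (com a b)"
  shows "c \<in> cent (com b a)"
proof -
  have "com a b \<in> cent c" by (rule cent_sym) (use assms in auto)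
  then have "com b a \<in> cent c" using subgroup.m_inv_closed[OF subgroup_cent] assms com_swap[OF assms(1,2)] by simp
  show ?thesis by (rule cent_sym[OF assms(3) \<open>com b a \<in> cent c\<close>])
qed

lemma cent_com_rotate: \<comment> \<open>because \<open>com a (b \<otimes> c)\<close> commutes with \<open>b \<otimes> c\<close>\<close>
  assumes a: "a \<in> carrier G" and b: "b \<in> carrier G" and c: "c \<in> carrier G"
    and "c \<in> cent (com a b)"
  shows "b \<in> cent (com a c)"
proof -
  let ?y = "b \<otimes> com a c \<otimes> inv b"
  have "com a b \<in> cent (b \<otimes> c)"
    using a b c by (intro cent_sym[of "com a b"] subgroup.m_closed[OF subgroup_cent] com_cent assms) auto
  moreover have "com a (b \<otimes> c) \<in> cent (b \<otimes> c)" using com_cent a b c by simp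
  moreover have "?y = inv (com a b) \<otimes> com a (b \<otimes> c)"
    using a b c by (simp add: com_def m_assoc inv_mult_group)
  ultimately have "?y \<in> cent (b \<otimes> c)"
    using subgroup_cent[of "b \<otimes> c"] b c by (simp add: subgroup.m_closed subgroup.m_inv_closed)
  \<comment> \<open>Conjugating back by \<open>b\<close> turns \<open>b \<otimes> c\<close> into
    \<open>c \<otimes> b\<close>.\<close>
  from cent_conj[OF _ _ _ this, of "inv b"]
  have "com a c \<in> cent (c \<otimes> b)" using a b c by (simp add: m_assoc)
  then have cb: "c \<otimes> b \<in> cent (com a c)" using cent_sym b c by simp
  have "inv c \<in> cent (com a c)"
    using com_cent[OF a c] subgroup.m_inv_closed[OF subgroup_cent] a c by simp
  then have "inv c \<otimes> (c \<otimes> b) \<in> cent (com a c)"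
    using cb subgroup.m_closed[OF subgroup_cent] a c by simp
  then show ?thesis using b c by simp
qed

end

locale finite_pE_group = pE_group +
  assumes finite_carrier': "finite (carrier G)"

sublocale finite_pE_group \<subseteq> finite_p_group
  using finite_carrier' by unfold_locales

context finite_pE_group
begin

lemma com_central_if_small:
  assumes small: "card (carrier G) \<le> p ^ 6"
    and a: "a \<in> carrier G" and b: "b \<in> carrier G" and c: "c \<in> carrier G"
  shows "c \<in> cent (com a b)"
proof (rule ccontr)
  define u v w where "u = com b c" and "v = com a c" and "w = com a b"
  note defs = u_def v_def w_def
  have uvw: "u \<in> carrier G" "v \<in> carrier G" "w \<in> carrier G" using a b c by (auto simp: defs)
  assume "c \<notin> cent (com a b)"
  then have cw: "c \<notin> cent w" by (simp add: defs)
  \<comment> \<open>By rotation one failure gives three: each of \<open>a\<close>, \<open>b\<close>,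
    \<open>c\<close> fails to commute with the commutator of the other two.\<close>
  have bv: "b \<notin> cent v" using cent_com_rotate[OF a c b] cw by (auto simp: defs)
  have au: "a \<notin> cent u" 
    using cent_com_rotate[OF b c a] cent_com_swap[OF b a c] cw by (auto simp: defs)
  have nw: "w \<in> ncent a" "w \<in> ncent b" and nv: "v \<in> ncent a" "v \<in> ncent c"
    and nu: "u \<in> ncent b" "u \<in> ncent c"
    using a b c ncent_self ncent_com_left ncent_com_right by (auto simp: defs)
  have uv: "v \<in> cent u" "u \<in> cent v" "w \<in> cent u" "w \<in> cent v" "u \<in> cent w" "v \<in> cent w"
  proof -
    show 1: "v \<in> cent u" and 2: "w \<in> cent u" and 3: "w \<in> cent v"
      using ncent_cent_com[OF c nu(2) a] ncent_cent_com[OF b nu(1) a] ncent_cent_com[OF a nv(1) b]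
      by (auto simp: defs)
    show "u \<in> cent v" "u \<in> cent w" "v \<in> cent w"
      using cent_sym[OF uvw(1) 1] cent_sym[OF uvw(1) 2] cent_sym[OF uvw(2) 3] .
  qed
  \<comment> \<open>\<open>e\<close> commutes with all six elements whose centralizers are
    intersected; being nontrivial, it keeps the last intersection above \<open>{\<one>}\<close>,
    which is the seventh factor \<open>p\<close>.\<close>
  define e where "e = com w c"
  have e1: "e \<noteq> \<one>" using cw uvw c by (simp add: e_def com_eq_one_iff cent_def)
  have e: "e \<in> carrier G" using uvw c by (simp add: e_def)
  have ne: "e \<in> ncent a" "e \<in> ncent b" using ncent_com_left a b c nw by (auto simp: e_def)
  have ec: "e \<in> cent a" "e \<in> cent b" "e \<in> cent c"
    using ne ncent_cent a b c uvw com_cent[of w c] by (auto simp: e_def)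
  have eu: "e \<in> cent u" "e \<in> cent v" "e \<in> cent w"
    using ncent_cent_com[OF b ne(2) c] ncent_cent_com[OF a ne(1) c] ncent_cent_com[OF a ne(1) b] e
    by (simp_all add: defs cent_sym)
  define K1 where "K1 = cent u"
  define K2 where "K2 = K1 \<inter> cent v"
  define K3 where "K3 = K2 \<inter> cent w"
  define K4 where "K4 = K3 \<inter> cent c"
  define K5 where "K5 = K4 \<inter> cent b"
  define K6 where "K6 = K5 \<inter> cent a"
  note Ks = K1_def K2_def K3_def K4_def K5_def K6_def
  have sub: "subgroup K1 G" "subgroup K2 G" "subgroup K3 G" "subgroup K4 G" "subgroup K5 G"
    "subgroup K6 G" unfolding Ks
    using subgroup_cent a b c uvw by (auto intro!: subgroups_Inter_pair)
  have cents: "b \<in> cent u" "c \<in> cent u" "c \<in> cent v" "a \<in> cent v" "v \<in> cent c" "u \<in> cent b" "u \<in> cent c"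
    using com_cent a b c by (auto simp: defs)
  have selfs: "u \<in> cent u" "v \<in> cent v" "w \<in> cent w" using uvw cent_self by auto
  have nots: "w \<notin> cent c" "v \<notin> cent b" "u \<notin> cent a" using cw bv au cent_sym a b c by blast+
  \<comment> \<open>The seven strict inclusions are witnessed by \<open>a\<close>, \<open>b\<close>,
    \<open>c\<close>, \<open>w\<close>, \<open>v\<close>, \<open>u\<close>, \<open>e\<close> in this
    order.\<close>
  have "K1 \<subset> carrier G" using au a cent_carrier by (auto simp: Ks)
  moreover have "K2 \<subset> K1" using bv cents by (auto simp: Ks)
  moreover have "K3 \<subset> K2" using cw cents by (auto simp: Ks)
  moreover have "K4 \<subset> K3" using nots uv selfs by (auto simp: Ks)
  moreover have "K5 \<subset> K4" using nots uv selfs cents by (auto simp: Ks)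
  moreover have "K6 \<subset> K5" using nots uv selfs cents by (auto simp: Ks)
  moreover have "{\<one>} \<subset> K6" using e1 ec eu subgroup.one_closed[OF sub(6)] by (auto simp: Ks)
  ultimately have c: "p * card K1 \<le> card (carrier G)" "p * card K2 \<le> card K1" "p * card K3 \<le> card K2"
     "p * card K4 \<le> card K3" "p * card K5 \<le> card K4" "p * card K6 \<le> card K5" "p * card {\<one>} \<le> card K6"
    by (simp_all only: psubgroup_card sub subgroup_self triv_subgroup)
  have "p * (p * (p * (p * (p * (p * (p * 1)))))) \<le> card (carrier G)"
  proof -
    have "p * 1 \<le> card K6" using c(7) by simp
    then have "p * (p * 1) \<le> card K5" using c(6) by (meson mult_le_mono2 order_trans)
    then have "p * (p * (p * 1)) \<le> card K4" using c(5) by (meson mult_le_mono2 order_trans)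
    then have "p * (p * (p * (p * 1))) \<le> card K3" using c(4) by (meson mult_le_mono2 order_trans)
    then have "p * (p * (p * (p * (p * 1)))) \<le> card K2" using c(3) by (meson mult_le_mono2 order_trans)
    then have "p * (p * (p * (p * (p * (p * 1))))) \<le> card K1" using c(2) by (meson mult_le_mono2 order_trans)
    then show ?thesis using c(1) by (meson mult_le_mono2 order_trans)
  qed
  also have "\<dots> \<le> p ^ 6" by (rule small)
  also have "\<dots> < p ^ 7" using prime_gt_1_nat[OF p_prime] by simp
  finally show False by (simp add: eval_nat_numeral)
qed

end

section \<open>Groups of class 2\<close>

locale class2_group = group +
  assumes com_centre: "\<lbrakk>x \<in> carrier G; y \<in> carrier G\<rbrakk> \<Longrightarrow> com x y \<in> centre"
begin

abbreviation D :: "'a set" where "D \<equiv> derived G (carrier G)"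

lemma com_comm:
  "\<lbrakk>x \<in> carrier G; y \<in> carrier G; z \<in> carrier G\<rbrakk> \<Longrightarrow> z \<otimes> com x y = com x y \<otimes> z"
  using centre_comm com_centre by metis

lemma com_left_comm:
  assumes "x \<in> carrier G" "y \<in> carrier G" "z \<in> carrier G" "w \<in> carrier G"
  shows "z \<otimes> (com x y \<otimes> w) = com x y \<otimes> (z \<otimes> w)"
  using assms com_comm[of x y z] by (simp add: m_assoc[symmetric])

lemma com_mult_left:
  assumes "x \<in> carrier G" "y \<in> carrier G" "z \<in> carrier G"
  shows "com (x \<otimes> y) z = com x z \<otimes> com y z"
proof (rule com_eqI)
  have "x \<otimes> y \<otimes> z = x \<otimes> (com y z \<otimes> (z \<otimes> y))"
    using assms com_mult_swap[of y z] by (simp add: m_assoc)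
  also have "\<dots> = com y z \<otimes> (x \<otimes> z \<otimes> y)" using assms com_left_comm[of y z x] by (simp add: m_assoc)
  also have "x \<otimes> z = com x z \<otimes> (z \<otimes> x)" using assms by (intro com_mult_swap)
  also have "com y z \<otimes> (com x z \<otimes> (z \<otimes> x) \<otimes> y) = com x z \<otimes> com y z \<otimes> (z \<otimes> (x \<otimes> y))"
    using assms com_left_comm[of x z "com y z"] by (simp add: m_assoc)
  finally show "x \<otimes> y \<otimes> z = com x z \<otimes> com y z \<otimes> (z \<otimes> (x \<otimes> y))" .
qed (use assms in auto)

lemma com_mult_right:
  assumes "x \<in> carrier G" "y \<in> carrier G" "z \<in> carrier G"
  shows "com z (x \<otimes> y) = com z x \<otimes> com z y"
  using assms com_mult_left[of x y z] com_comm[of y z "com x z"]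
  by (simp add: com_swap[of _ z] inv_mult_group)

lemma com_hom_left: "z \<in> carrier G \<Longrightarrow> group_hom G G (\<lambda>x. com x z)"
  by unfold_locales (auto simp: hom_def com_mult_left)

lemma com_hom_right: "z \<in> carrier G \<Longrightarrow> group_hom G G (com z)"
  by unfold_locales (auto simp: hom_def com_mult_right)

lemma com_int_pow_left:
  "\<lbrakk>x \<in> carrier G; z \<in> carrier G\<rbrakk> \<Longrightarrow> com (x [^] (i::int)) z = com x z [^] i"
  using group_hom.hom_int_pow[OF com_hom_left] by metis

lemma com_int_pow_right:
  "\<lbrakk>x \<in> carrier G; z \<in> carrier G\<rbrakk> \<Longrightarrow> com z (x [^] (i::int)) = com z x [^] i"
  using group_hom.hom_int_pow[OF com_hom_right] by metis

lemma com_nat_pow_left: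
  "\<lbrakk>x \<in> carrier G; z \<in> carrier G\<rbrakk> \<Longrightarrow> com (x [^] (i::nat)) z = com x z [^] i"
  using com_int_pow_left[of x z "int i"] by (simp add: int_pow_int)

lemma com_nat_pow_right:
  "\<lbrakk>x \<in> carrier G; z \<in> carrier G\<rbrakk> \<Longrightarrow> com z (x [^] (i::nat)) = com z x [^] i"
  using com_int_pow_right[of x z "int i"] by (simp add: int_pow_int)

lemma com_one [simp]: "z \<in> carrier G \<Longrightarrow> com z \<one> = \<one>" "z \<in> carrier G \<Longrightarrow> com \<one> z = \<one>"
  by (simp_all add: com_eq_one_iff)

lemma com_inv_left: "\<lbrakk>x \<in> carrier G; z \<in> carrier G\<rbrakk> \<Longrightarrow> com (inv x) z = inv (com x z)"
  using group_hom.hom_inv[OF com_hom_left] by metis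

lemma com_inv_right: "\<lbrakk>x \<in> carrier G; z \<in> carrier G\<rbrakk> \<Longrightarrow> com z (inv x) = inv (com z x)"
  using group_hom.hom_inv[OF com_hom_right] by metis

text \<open>Moving every \<open>x\<close> to the left of the \<open>y\<close> before it takes n(n -
  1)/2 exchanges, each leaving a central factor \<open>com y x\<close>. For odd \<open>n\<close>
  this exponent is a multiple of \<open>n\<close>; for even \<open>n\<close> it is not.\<close>

lemma nat_pow_mult_class2:
  assumes x: "x \<in> carrier G" and y: "y \<in> carrier G"
  shows "(x \<otimes> y) [^] (n::nat) = x [^] n \<otimes> y [^] n \<otimes> com y x [^] (n * (n - 1) div 2)"
proof (induction n)
  case (Suc n)
  let ?d = "com y x"
  have tri: "Suc n * (Suc n - 1) div 2 = n * (n - 1) div 2 + n"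
    by (cases n) (simp_all add: algebra_simps)
  have d: "?d [^] k \<otimes> z = z \<otimes> ?d [^] k" if "z \<in> carrier G" for z and k :: nat
    using that x y centre_comm[OF com_centre, of y x]
    by (intro group_commutes_pow) auto
  have "(x \<otimes> y) [^] Suc n = x [^] n \<otimes> y [^] n \<otimes> ?d [^] (n * (n - 1) div 2) \<otimes> (x \<otimes> y)"
    using Suc by simp
  also have "\<dots> = x [^] n \<otimes> (y [^] n \<otimes> x) \<otimes> y \<otimes> ?d [^] (n * (n - 1) div 2)"
    using x y d[of "x \<otimes> y"] by (simp add: m_assoc)
  also have "y [^] n \<otimes> x = ?d [^] n \<otimes> (x \<otimes> y [^] n)"
    using com_mult_swap[of "y [^] n" x] x y unfolding com_nat_pow_left[OF y x] by simp
  also have "x [^] n \<otimes> (?d [^] n \<otimes> (x \<otimes> y [^] n)) \<otimes> y \<otimes> ?d [^] (n * (n - 1) div 2)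
    = x [^] n \<otimes> (x \<otimes> y [^] n \<otimes> ?d [^] n) \<otimes> y \<otimes> ?d [^] (n * (n - 1) div 2)"
    using d[of "x \<otimes> y [^] n"] x y by simp
  also have "\<dots> = x [^] Suc n \<otimes> y [^] Suc n \<otimes> (?d [^] n \<otimes> ?d [^] (n * (n - 1) div 2))"
    using d[of y] x y by (simp add: m_assoc)
  also have "?d [^] n \<otimes> ?d [^] (n * (n - 1) div 2) = ?d [^] (Suc n * (Suc n - 1) div 2)"
    unfolding tri using x y by (simp add: nat_pow_mult add.commute)
  finally show ?case .
qed (use x y in simp)

lemma int_pow_swap:
  assumes "x \<in> carrier G" "y \<in> carrier G"
  shows "x [^] (i::int) \<otimes> y [^] (j::int) = com x y [^] (i * j) \<otimes> (y [^] j \<otimes> x [^] i)"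
  using assms com_mult_swap[of "x [^] i" "y [^] j"]
  by (simp add: com_int_pow_left com_int_pow_right int_pow_pow mult.commute)

lemma com_derived: "\<lbrakk>x \<in> carrier G; y \<in> carrier G\<rbrakk> \<Longrightarrow> com x y \<in> D"
  unfolding derived_def by (rule generate.incl) (auto simp: com_def)

lemma derived_least:
  assumes "subgroup H G" "\<And>x y. \<lbrakk>x \<in> carrier G; y \<in> carrier G\<rbrakk> \<Longrightarrow> com x y \<in> H"
  shows "D \<subseteq> H"
  unfolding derived_def using assms by (intro generate_subgroup_incl) (auto simp: com_def)

lemma subgroup_derived: "subgroup D G"
  by (simp add: derived_is_subgroup)

lemma derived_centre: "D \<subseteq> centre"
  using derived_least[OF subgroup_centre] com_centre by blast

text \<open>In class 2 \<open>com a\<close> is an endomorphism with kernel \<open>cent a\<close>;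
  its image is in bijection with the conjugacy class of \<open>a\<close> and is a subgroup of
  \<open>D\<close>.\<close>

lemma com_range: 
  assumes "a \<in> carrier G"
  shows subgroup_com_range: "subgroup (com a ` carrier G) G"
    and card_com_range: "card (carrier G) = card (com a ` carrier G) * card (cent a)"
    and com_range_derived: "com a ` carrier G \<subseteq> D"
proof -
  show "subgroup (com a ` carrier G) G"
    using group_hom.img_is_subgroup[OF com_hom_right[OF assms]] .
  show "card (carrier G) = card (com a ` carrier G) * card (cent a)"
  proof -
    show ?thesis using cent_eq[OF assms] card_hom_image[OF subgroup_self, of "com a"] assms
      by (simp add: com_mult_right)
  qed
  show "com a ` carrier G \<subseteq> D" using assms com_derived by auto
qed

lemma centre_subset_cent: "a \<in> carrier G \<Longrightarrow> centre \<subseteq> cent a"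
  using centre_cent by blast

lemma adjoin_centre:
  assumes "subgroup H G" "centre \<subseteq> H" "t \<in> carrier G"
  shows "subgroup (adjoin H t) G" "H \<subseteq> adjoin H t" "t \<in> adjoin H t"
proof -
  have "com x y \<in> H" if "x \<in> carrier G" "y \<in> carrier G" for x y
    using com_centre[OF that] assms(2) by blast
  from adjoin_properties[OF assms(1) this assms(3)]
  show "subgroup (adjoin H t) G" "H \<subseteq> adjoin H t" "t \<in> adjoin H t" by blast+
qed

end

section \<open>Elements of small order are central; generation modulo the centre\<close>

locale class2_pE_group = finite_pE_group + class2_group
begin

lemma coprime_pow_subgroup:
  assumes H: "subgroup H G" and x: "x \<in> carrier G" and i: "x [^] (i::int) \<in> H" "x [^] (j::int) \<in> H"
  shows "x [^] gcd i j \<in> H"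
proof -
  obtain u v where "u * i + v * j = gcd i j" using bezout_int by blast
  then have "x [^] gcd i j = (x [^] i) [^] u \<otimes> (x [^] j) [^] v"
    using x by (simp add: int_pow_pow int_pow_mult mult.commute flip: \<open>u * i + v * j = gcd i j\<close>)
  then show ?thesis using i H by (simp add: subgroup.m_closed subgroup_int_pow_closed)
qed

lemma pow_mem_if_not_dvd:
  assumes H: "subgroup H G" and x: "x \<in> carrier G" and j: "x [^] (j::int) \<in> H" "\<not> int p dvd j"
  shows "x \<in> H"
proof -
  obtain k where "ord x = p ^ k" using ord_prime_power x by blast
  then have "x [^] int (p ^ k) = \<one>" using pow_ord_eq_1[OF x] unfolding int_pow_int by simp
  then have k: "x [^] int (p ^ k) \<in> H" using subgroup.one_closed[OF H] by simp
  have "prime_elem (int p)" using p_prime by simp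
  then have "coprime (int p) j" using j(2) by (rule prime_elem_imp_coprime)
  then have "coprime (int (p ^ k)) j" by simp
  then have "gcd (int (p ^ k)) j = 1" by (rule coprime_imp_gcd_eq_1)
  then show ?thesis using coprime_pow_subgroup[OF H x k j(1)] x by simp
qed

text \<open>\<open>p ^ Suc e\<close> is the exponent of \<open>G / D\<close>, attained by
  \<open>g\<close>. It is not 1 because \<open>D\<close> is central and \<open>G\<close> is not,
  which allows the successor form.\<close>

lemma derived_exponent:
  assumes "\<not> carrier G \<subseteq> centre"
  obtains e g where "g \<in> carrier G" "\<And>x. x \<in> carrier G \<Longrightarrow> x [^] (p ^ Suc e) \<in> D" "g [^] (p ^ e) \<notin> D"
proof -
  let ?P = "\<lambda>e. \<forall>x\<in>carrier G. x [^] (p ^ e) \<in> D"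
  obtain k where k: "card (carrier G) = p ^ k" using order_prime_power by blast
  define L where "L = (LEAST e. ?P e)"
  have "?P k" using pow_order_eq_1 subgroup.one_closed[OF subgroup_derived] k by (simp add: order_def)
  then have P: "?P L" unfolding L_def by (rule LeastI)
  have "L \<noteq> 0"
  proof
    assume "L = 0"
    then have "\<forall>x\<in>carrier G. x \<in> D" using P by simp
    then show False using assms derived_centre by blast
  qed
  then obtain e where e: "L = Suc e" using not0_implies_Suc by blast
  have "\<not> ?P e"
  proof
    assume "?P e"
    then have "L \<le> e" unfolding L_def by (rule Least_le)
    then show False using e by simp
  qed
  then obtain g where "g \<in> carrier G" "g [^] (p ^ e) \<notin> D" by blast
  then show thesis using that P unfolding e by blast
qed

text \<open>\<open>G\<close> maps onto a cyclic group of order \<open>p ^ Suc e\<close> and hence onto the subgroup generated by \<open>x\<close>,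
  the preimages of \<open>x\<close> generating \<open>G\<close>. The kernel is a maximal \<open>M\<close> meeting the powers of \<open>g\<close> in \<open>D\<close>.\<close>

lemma central_if_small_exponent:
  assumes g: "g \<in> carrier G" and e: "\<And>x. x \<in> carrier G \<Longrightarrow> x [^] (p ^ Suc e) \<in> D"
    and ge: "g [^] (p ^ e) \<notin> D"
    and x: "x \<in> carrier G" "x [^] (p ^ Suc e) = \<one>"
  shows "x \<in> centre"
proof -
  define n where "n = p ^ Suc e"
  \<comment> \<open>A member of \<open>S\<close> contains \<open>D\<close>, so it is normal, and
    \<open>g\<close> keeps order \<open>n\<close> modulo it. A maximal one gives a complement to the
    cyclic group of \<open>g\<close> in \<open>G / D\<close>, as in the proof that a cyclic subgroup
    of maximal order is a direct factor of a finite abelian group.\<close>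
  define S where "S = {M. subgroup M G \<and> D \<subseteq> M \<and> (\<forall>i::int. g [^] i \<in> M \<longrightarrow> int n dvd i)}"
  have p1: "p > 1" using p_prime prime_gt_1_nat by blast
  have "D \<in> S"
  proof -
    have gn: "g [^] int n \<in> D" using e[OF g] unfolding n_def int_pow_int .
    have "int n dvd i" if i: "g [^] (i::int) \<in> D" for i
    proof (rule ccontr)
      assume ni: "\<not> int n dvd i"
      have "g [^] gcd (int n) i \<in> D"
        by (rule coprime_pow_subgroup[OF subgroup_derived g gn i])
      moreover obtain j where j: "gcd (int n) i = int (p ^ j)" "j \<le> Suc e"
      proof -
        have "int (nat (gcd (int n) i)) dvd int n" by simp
        then have "nat (gcd (int n) i) dvd p ^ Suc e" unfolding n_def int_dvd_int_iff .
        then obtain j where "j \<le> Suc e" "nat (gcd (int n) i) = p ^ j"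
          using divides_primepow_nat[OF p_prime] by blast
        then show thesis using that[of j] by (metis gcd_ge_0_int nat_0_le)
      qed
      moreover have "j \<noteq> Suc e"
      proof
        assume "j = Suc e"
        then have "gcd (int n) i = int n" using j(1) by (simp only: n_def)
        then show False using ni by (metis gcd_dvd2)
      qed
      ultimately have "g [^] (p ^ j) \<in> D" "j \<le> e"
        unfolding j int_pow_int by auto
      then have "(g [^] (p ^ j)) [^] (p ^ (e - j)) \<in> D"
        using subgroup_nat_pow_mem[OF subgroup_derived] by blast
      then show False using ge g \<open>j \<le> e\<close> by (simp add: nat_pow_pow flip: power_add)
    qed
    then show ?thesis using subgroup_derived by (auto simp: S_def)
  qed
  moreover have "finite S"
    using finite_carrier subgroup.subset by (intro finite_subset[of S "Pow (carrier G)"]) (auto simp: S_def)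
  ultimately obtain M where "M \<in> S" and max: "\<And>N. \<lbrakk>N \<in> S; M \<subseteq> N\<rbrakk> \<Longrightarrow> M = N"
    using finite_has_maximal[of S] by blast
  then have M: "subgroup M G" and DM: "D \<subseteq> M" and gM: "\<And>i::int. g [^] i \<in> M \<Longrightarrow> int n dvd i"
    by (auto simp: S_def)
  have comM: "com a b \<in> M" if "a \<in> carrier G" "b \<in> carrier G" for a b
    using that com_derived DM by blast
  have Mc: "m \<in> carrier G" if "m \<in> M" for m using that M subgroup.mem_carrier by metis
  define B where "B = adjoin M g"
  have B: "subgroup B G" "M \<subseteq> B" "g \<in> B" using adjoin_properties[OF M comM g] by (auto simp: B_def)
  have BG: "B = carrier G"
  proof (rule ccontr)
    assume "B \<noteq> carrier G"
    then obtain x0 where x0: "x0 \<in> carrier G" "x0 \<notin> B" using subgroup.subset[OF B(1)] by blast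
    \<comment> \<open>Among the iterated \<open>p\<close>-th powers of \<open>x0\<close>, the last
      one outside \<open>B\<close> has its own \<open>p\<close>-th power in
      \<open>B\<close>.\<close>
    define j where "j = (LEAST j. x0 [^] (p ^ j) \<in> B)"
    have "x0 [^] (p ^ Suc e) \<in> B" using e[OF x0(1)] DM B(2) by blast
    then have j: "x0 [^] (p ^ j) \<in> B" unfolding j_def by (rule LeastI)
    have "j \<noteq> 0"
    proof
      assume "j = 0"
      then show False using j x0 by simp
    qed
    then obtain j' where j': "j = Suc j'" using not0_implies_Suc by blast
    define x where "x = x0 [^] (p ^ j')"
    have "j' < j" using j' by simp
    then have x: "x \<in> carrier G" "x \<notin> B" using x0 not_less_Least unfolding x_def j_def by auto
    have "x [^] p \<in> B" using j x0 by (simp add: x_def j' nat_pow_pow mult.commute)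
    then obtain m i where mi: "m \<in> M" "x [^] p = m \<otimes> g [^] (i::int)" by (auto simp: B_def adjoin_def)
    have "(x [^] p) [^] (p ^ e) \<in> M" using e[OF x(1)] DM unfolding nat_pow_pow[OF x(1)] by auto
    then have "m [^] (p ^ e) \<otimes> (g [^] i) [^] (p ^ e) \<otimes> com (g [^] i) m [^] (p ^ e * (p ^ e - 1) div 2) \<in> M"
      using mi g Mc by (simp add: nat_pow_mult_class2)
    then have "(g [^] i) [^] (p ^ e) \<in> M"
      using subgroup_mult_left_iff[OF M] subgroup_mult_right_iff[OF M] mi(1) g Mc[OF mi(1)]
        subgroup_nat_pow_mem[OF M comM] subgroup_nat_pow_mem[OF M] by simp
    then have "(g [^] i) [^] int (p ^ e) \<in> M" unfolding int_pow_int .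
    then have "g [^] (i * int (p ^ e)) \<in> M" unfolding int_pow_pow[OF g] .
    \<comment> \<open>The exponent \<open>n\<close> of \<open>G / D\<close> forces \<open>p\<close>
      to divide \<open>i\<close>; so a power of \<open>g\<close> can be divided out of
      \<open>x\<close> to move its \<open>p\<close>-th power from \<open>B\<close> into
      \<open>M\<close>.\<close>
    from gM[OF this] have "int p dvd i" using p1 by (simp add: n_def)
    then obtain i' where i': "i = int p * i'" by (auto simp: dvd_def)
    define y where "y = x \<otimes> g [^] (- i')"
    have y: "y \<in> carrier G" using x g by (simp add: y_def)
    have gB: "g [^] k \<in> B" for k :: int using subgroup_int_pow_closed[OF B(1,3)] .
    have yB: "y \<notin> B" using x gB subgroup_mult_right_iff[OF B(1)] by (simp add: y_def)
    have yp: "y [^] p \<in> M"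
    proof -
      have "(g [^] (- i')) [^] int p = g [^] (- i)" unfolding int_pow_pow[OF g] by (simp add: i' mult.commute)
      then have "x [^] p \<otimes> (g [^] (- i')) [^] p = m"
        using g Mc[OF mi(1)] unfolding int_pow_int mi(2) by (simp add: m_assoc int_pow_neg)
      then show ?thesis unfolding y_def
        using g x(1) mi(1) comM by (simp add: nat_pow_mult_class2 subgroup.m_closed[OF M]
          subgroup_nat_pow_mem[OF M])
    qed
    note N = adjoin_properties[OF M comM y]
    \<comment> \<open>Powers of \<open>y\<close> that fall into \<open>B\<close> already lie in
      \<open>M\<close>, so adjoining \<open>y\<close> keeps the condition on powers of
      \<open>g\<close> and contradicts maximality.\<close>
    have "int n dvd t" if t: "g [^] (t::int) \<in> adjoin M y" for t
    proof -
      obtain m' j where m': "m' \<in> M" "g [^] t = m' \<otimes> y [^] (j::int)" using t by (auto simp: adjoin_def)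
      have "y [^] j \<in> B" using gB[of t] m' B(2) subgroup_mult_left_iff[OF B(1), of m' "y [^] j"] y by auto
      then have "int p dvd j" using pow_mem_if_not_dvd[OF B(1) y, of j] yB by blast
      then obtain k where "j = int p * k" by (auto simp: dvd_def)
      then have "y [^] j = (y [^] p) [^] k" using int_pow_pow[OF y, of "int p" k] by (simp add: int_pow_int)
      then have "y [^] j \<in> M" using subgroup_int_pow_closed[OF M yp] by simp
      then have "g [^] t \<in> M" using m' subgroup.m_closed[OF M] by simp
      then show ?thesis by (rule gM)
    qed
    then have "adjoin M y \<in> S" using N DM by (auto simp: S_def)
    then have "y \<in> M" using max N by auto
    then show False using yB B(2) by blast
  qed
  have onto: "\<exists>i\<in>M \<times> UNIV. (case i of (m, i) \<Rightarrow> m \<otimes> g [^] (i::int)) = z" if "z \<in> carrier G" for z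
  proof -
    have "z \<in> B" using that BG by simp
    then show ?thesis unfolding B_def adjoin_def by force
  qed
  have "ord x dvd n" using x pow_eq_id unfolding n_def by blast
  \<comment> \<open>The hypothesis on \<open>x\<close> enters here: exponents of \<open>g\<close>
    are determined only modulo \<open>n\<close>.\<close>
  then have x_eq: "x [^] (i::int) = x [^] j" if "int n dvd j - i" for i j
    using that int_pow_eq[OF x(1)] by (meson dvd_trans int_dvd_int_iff)
  have "\<exists>\<alpha>\<in>hom G G. \<forall>i\<in>M \<times> UNIV. (case i of (m, i) \<Rightarrow> m \<otimes> g [^] (i::int)) \<in> carrier G \<longrightarrow>
      \<alpha> (case i of (m, i) \<Rightarrow> m \<otimes> g [^] i) = (case i of (m, i) \<Rightarrow> x [^] i)"
  proof (rule hom_of_transport[OF onto])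
    fix i j :: "'a \<times> int"
    assume "i \<in> M \<times> UNIV" "j \<in> M \<times> UNIV"
    then obtain m k m' l where ij: "i = (m, k)" "j = (m', l)" and m: "m \<in> M" "m' \<in> M" by auto
    then have mc: "m \<in> carrier G" "m' \<in> carrier G" using Mc by auto
    have "g [^] k \<otimes> m' = com (g [^] k) m' \<otimes> (m' \<otimes> g [^] k)"
      by (rule com_mult_swap) (use g mc in auto)
    then have "m \<otimes> (com (g [^] k) m' \<otimes> m') \<otimes> g [^] (k + l) = m \<otimes> g [^] k \<otimes> (m' \<otimes> g [^] l)"
      using g mc by (simp add: int_pow_mult m_assoc) (simp add: m_assoc[symmetric])
    moreover have "m \<otimes> (com (g [^] k) m' \<otimes> m') \<in> M"
      using m mc g comM by (simp add: subgroup.m_closed[OF M])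
    ultimately show "\<exists>k\<in>M \<times> UNIV. (case k of (m, i) \<Rightarrow> m \<otimes> g [^] (i::int)) =
        (case i of (m, i) \<Rightarrow> m \<otimes> g [^] i) \<otimes> (case j of (m, i) \<Rightarrow> m \<otimes> g [^] i) \<and>
        (case k of (m, i) \<Rightarrow> x [^] i) = (case i of (m, i) \<Rightarrow> x [^] i) \<otimes> (case j of (m, i) \<Rightarrow> x [^] i)"
      using x(1) unfolding ij
      by (intro bexI[of _ "(m \<otimes> (com (g [^] k) m' \<otimes> m'), k + l)"]) (auto simp: int_pow_mult)
    assume "(case i of (m, i) \<Rightarrow> m \<otimes> g [^] (i::int)) = (case j of (m, i) \<Rightarrow> m \<otimes> g [^] i)"
    then have eq: "m \<otimes> g [^] k = m' \<otimes> g [^] l" by (simp add: ij)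
    have "g [^] (k - l) = inv m \<otimes> (m \<otimes> g [^] k) \<otimes> inv (g [^] l)"
      using g mc by (simp add: int_pow_diff)
    also have "\<dots> = inv m \<otimes> m'" unfolding eq using g mc by (simp add: m_assoc)
    finally have "g [^] (k - l) \<in> M"
      using m by (simp add: subgroup.m_closed[OF M] subgroup.m_inv_closed[OF M])
    then have "int n dvd k - l" by (rule gM)
    then show "(case i of (m, i) \<Rightarrow> x [^] i) = (case j of (m, i) \<Rightarrow> x [^] i)"
      using x_eq by (simp add: ij dvd_diff_commute)
  qed (use x in auto)
  then obtain \<alpha> where \<alpha>: "\<alpha> \<in> hom G G"
    and val: "\<forall>i\<in>M \<times> UNIV. (case i of (m, i) \<Rightarrow> m \<otimes> g [^] (i::int)) \<in> carrier G \<longrightarrow>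
      \<alpha> (case i of (m, i) \<Rightarrow> m \<otimes> g [^] i) = (case i of (m, i) \<Rightarrow> x [^] i)" by blast
  have mg: "m \<otimes> g \<in> cent x" if m: "m \<in> M" for m
  proof -
    have "\<alpha> (m \<otimes> g) = x" using val[rule_format, of "(m, 1)"] m g x(1) Mc[OF m] by simp
    then show ?thesis
      using commutes_with_endo_image[OF \<alpha>, of "m \<otimes> g"] g Mc[OF m] by (simp add: cent_def)
  qed
  have gx: "g \<in> cent x" using mg[OF subgroup.one_closed[OF M]] g by simp
  moreover have "M \<subseteq> cent x"
    using mg subgroup_mult_right_iff[OF subgroup_cent[OF x(1)] gx] Mc by blast
  ultimately have "adjoin M g \<subseteq> cent x"
    using adjoin_least[OF subgroup_cent[OF x(1)]] by blast
  then have "carrier G \<subseteq> cent x" using BG unfolding B_def by simp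
  then show ?thesis using x by (auto simp: centre_def cent_def)
qed

lemma subgroup_com_left:
  assumes R: "subgroup R G" and b: "b \<in> carrier G"
  shows "subgroup {v \<in> carrier G. com b v \<in> R} G"
proof (rule subgroupI)
  show "{v \<in> carrier G. com b v \<in> R} \<noteq> {}"
    using subgroup.one_closed[OF R] b by (auto intro!: exI[of _ \<one>])
qed (use b in \<open>auto simp: com_mult_right com_inv_right intro: subgroup.m_closed[OF R] subgroup.m_inv_closed[OF R]\<close>)

lemma subgroup_com_all:
  assumes R: "subgroup R G"
  shows "subgroup {u \<in> carrier G. \<forall>v\<in>carrier G. com u v \<in> R} G"
proof (rule subgroupI)
  show "{u \<in> carrier G. \<forall>v\<in>carrier G. com u v \<in> R} \<noteq> {}"
    using subgroup.one_closed[OF R] by (auto intro!: exI[of _ \<one>])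
qed (auto simp: com_mult_left com_inv_left intro: subgroup.m_closed[OF R] subgroup.m_inv_closed[OF R])

lemma com_swap_mem: "\<lbrakk>subgroup R G; a \<in> carrier G; b \<in> carrier G; com a b \<in> R\<rbrakk> \<Longrightarrow> com b a \<in> R"
  unfolding com_swap[of a b] by (rule subgroup.m_inv_closed)

abbreviation span2 :: "'a \<Rightarrow> 'a \<Rightarrow> 'a set"
  where "span2 a b \<equiv> adjoin (adjoin centre a) b"

abbreviation span3 :: "'a \<Rightarrow> 'a \<Rightarrow> 'a \<Rightarrow> 'a set"
  where "span3 a b c \<equiv> adjoin (span2 a b) c"

lemma span_subgroup:
  assumes "a \<in> carrier G" "b \<in> carrier G" "c \<in> carrier G"
  shows "subgroup (adjoin centre a) G" "subgroup (span2 a b) G" "subgroup (span3 a b c) G"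
    "centre \<subseteq> adjoin centre a" "adjoin centre a \<subseteq> span2 a b" "span2 a b \<subseteq> span3 a b c"
    "a \<in> adjoin centre a" "b \<in> span2 a b" "c \<in> span3 a b c"
proof -
  note 1 = adjoin_centre[OF subgroup_centre subset_refl assms(1)]
  note 2 = adjoin_centre[OF 1(1,2) assms(2)]
  have "centre \<subseteq> span2 a b" using 1(2) 2(2) by blast
  note 3 = adjoin_centre[OF 2(1) this assms(3)]
  show "subgroup (adjoin centre a) G" "subgroup (span2 a b) G" "subgroup (span3 a b c) G"
    "centre \<subseteq> adjoin centre a" "adjoin centre a \<subseteq> span2 a b" "span2 a b \<subseteq> span3 a b c"
    "a \<in> adjoin centre a" "b \<in> span2 a b" "c \<in> span3 a b c"
    using 1 2 3 by blast+
qed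

lemma span2_least:
  assumes "subgroup K G" "centre \<subseteq> K" "a \<in> K" "b \<in> K"
  shows "span2 a b \<subseteq> K"
  using assms by (intro adjoin_least)

lemma span3_least:
  assumes "subgroup K G" "centre \<subseteq> K" "a \<in> K" "b \<in> K" "c \<in> K"
  shows "span3 a b c \<subseteq> K"
  using assms by (intro adjoin_least)

text \<open>\<open>com\<close> is bilinear and trivial on the centre, so the commutators of
  generators modulo the centre generate \<open>D\<close>. The subgroup \<open>R\<close> will be a
  range of \<open>com a\<close> or a group of order 2.\<close>

lemma derived_span2:
  assumes a: "a \<in> carrier G" and b: "b \<in> carrier G" and G: "span2 a b = carrier G"
    and R: "subgroup R G" and ab: "com a b \<in> R"
  shows "D \<subseteq> R"
proof (rule derived_least[OF R])
  note one = subgroup.one_closed[OF R]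
  have Z: "z \<in> carrier G \<and> (\<forall>v\<in>carrier G. com z v \<in> R \<and> com v z \<in> R)" if "z \<in> centre" for z
    using that centre_com one centre_carrier by auto
  have "span2 a b \<subseteq> {v \<in> carrier G. com a v \<in> R}"
    by (rule span2_least[OF subgroup_com_left[OF R a]]) (use a b ab one Z in auto)
  moreover have "span2 a b \<subseteq> {v \<in> carrier G. com b v \<in> R}"
    by (rule span2_least[OF subgroup_com_left[OF R b]]) (use a b com_swap_mem[OF R a b ab] one Z in auto)
  ultimately have "span2 a b \<subseteq> {u \<in> carrier G. \<forall>v\<in>carrier G. com u v \<in> R}"
    unfolding G by (subst G[symmetric], intro span2_least[OF subgroup_com_all[OF R]]) (use a b Z in auto)
  then show "com x y \<in> R" if "x \<in> carrier G" "y \<in> carrier G" for x y using that unfolding G by blast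
qed

lemma derived_span3:
  assumes a: "a \<in> carrier G" and b: "b \<in> carrier G" and c: "c \<in> carrier G"
    and G: "span3 a b c = carrier G"
    and R: "subgroup R G" and ab: "com a b \<in> R" and ac: "com a c \<in> R" and bc: "com b c \<in> R"
  shows "D \<subseteq> R"
proof (rule derived_least[OF R])
  note one = subgroup.one_closed[OF R]
  have Z: "z \<in> carrier G \<and> (\<forall>v\<in>carrier G. com z v \<in> R \<and> com v z \<in> R)" if "z \<in> centre" for z
    using that centre_com one centre_carrier by auto
  have 1: "span3 a b c \<subseteq> {v \<in> carrier G. com a v \<in> R}"
    by (rule span3_least[OF subgroup_com_left[OF R a]]) (use a b c ab ac one Z in auto)
  have 2: "span3 a b c \<subseteq> {v \<in> carrier G. com b v \<in> R}"
    by (rule span3_least[OF subgroup_com_left[OF R b]])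
      (use a b c bc com_swap_mem[OF R a b ab] one Z in auto)
  have 3: "span3 a b c \<subseteq> {v \<in> carrier G. com c v \<in> R}"
    by (rule span3_least[OF subgroup_com_left[OF R c]])
      (use a b c com_swap_mem[OF R a c ac] com_swap_mem[OF R b c bc] one Z in auto)
  have "span3 a b c \<subseteq> {u \<in> carrier G. \<forall>v\<in>carrier G. com u v \<in> R}"
    by (rule span3_least[OF subgroup_com_all[OF R]]) (use a b c 1 2 3 Z in \<open>auto simp: G\<close>)
  then show "com x y \<in> R" if "x \<in> carrier G" "y \<in> carrier G" for x y using that unfolding G by blast
qed

lemma span_strict:
  assumes a: "a \<in> carrier G" and b: "b \<in> carrier G" and ab: "com a b \<noteq> \<one>"
  shows "centre \<subset> adjoin centre a" "adjoin centre a \<subset> span2 a b"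
    "p * card centre \<le> card (adjoin centre a)" "p * card (adjoin centre a) \<le> card (span2 a b)"
proof -
  note sp = span_subgroup[OF a b b]
  have "a \<notin> centre" using ab b centre_com by blast
  then show 1: "centre \<subset> adjoin centre a" using sp by blast
  have "adjoin centre a \<subseteq> cent a"
    using a by (intro adjoin_least subgroup_cent centre_subset_cent cent_self)
  moreover have "b \<notin> cent a" using a ab by (simp add: cent_eq)
  ultimately show 2: "adjoin centre a \<subset> span2 a b" using sp by blast
  show "p * card centre \<le> card (adjoin centre a)" "p * card (adjoin centre a) \<le> card (span2 a b)"
    using psubgroup_card[OF subgroup_centre sp(1) 1] psubgroup_card[OF sp(1,2) 2] .
qed

lemma noncentral_com: "\<lbrakk>x \<in> carrier G; x \<notin> centre\<rbrakk> \<Longrightarrow> \<exists>y\<in>carrier G. com x y \<noteq> \<one>"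
  using centre_comI by blast

lemma card_bound:
  assumes H: "subgroup H G" "H \<subset> carrier G" and le: "p * (p * card centre) \<le> card H"
  shows "p * (p * (p * card centre)) \<le> card (carrier G)"
  using psubgroup_card[OF H(1) subgroup_self H(2)] le by (meson mult_le_mono2 order_trans)

end

section \<open>Groups in which the \<open>n\<close>-th power map is a homomorphism,
  \<open>n = p ^ Suc e\<close>\<close>

locale power_hom_group = class2_pE_group +
  fixes e :: nat and g :: 'a
  assumes small: "card (carrier G) \<le> p ^ 6"
    and nonabelian: "\<not> carrier G \<subseteq> centre"
    and exponent: "\<And>x. x \<in> carrier G \<Longrightarrow> x [^] (p ^ Suc e) \<in> D"
    and g: "g \<in> carrier G" "g [^] (p ^ e) \<notin> D"
    and com_pow: "\<And>x y. \<lbrakk>x \<in> carrier G; y \<in> carrier G\<rbrakk> \<Longrightarrow>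
      com x y [^] (p ^ Suc e * (p ^ Suc e - 1) div 2) = \<one>"
begin

text \<open>The power map is a homomorphism by \<open>com_pow\<close>. It goes into \<open>D\<close>
  by the choice of the exponent, and its kernel is central by
  \<open>central_if_small_exponent\<close>.\<close>

lemma card_le_derived: "card (carrier G) \<le> card D * card centre"
proof -
  let ?f = "\<lambda>x. x [^] (p ^ Suc e)"
  have "card (carrier G) = card (?f ` carrier G) * card {x \<in> carrier G. ?f x = \<one>}"
    by (rule card_hom_image[OF subgroup_self]) (simp_all only: nat_pow_mult_class2 com_pow
      m_closed nat_pow_closed r_one)
  also have "\<dots> \<le> card D * card centre"
  proof (intro mult_le_mono card_mono finite_subgroup subgroup_derived subgroup_centre)
    show "?f ` carrier G \<subseteq> D" using exponent by blast
    show "{x \<in> carrier G. ?f x = \<one>} \<subseteq> centre"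
      using central_if_small_exponent[OF g(1) exponent g(2)] by blast
  qed
  finally show ?thesis .
qed

lemma card_derived_pos: "card D > 0"
  using finite_subgroup[OF subgroup_derived] subgroup.one_closed[OF subgroup_derived] card_gt_0_iff
  by blast

text \<open>Otherwise |D| |cent a| = |G| \<le> |D| |Z|, so \<open>cent a\<close> would be no larger
  than the centre although it also contains \<open>a\<close>. This forces a third generator: over
  two generators \<open>a\<close>, \<open>b\<close> the single element \<open>com a b\<close>
  generates \<open>D\<close>.\<close>

lemma com_range_proper:
  assumes a: "a \<in> carrier G" "a \<notin> centre"
  shows "\<not> D \<subseteq> com a ` carrier G"
proof
  assume "D \<subseteq> com a ` carrier G"
  then have "com a ` carrier G = D" using com_range_derived[OF a(1)] by blast
  then have "card D * card (cent a) \<le> card D * card centre"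
    using card_le_derived card_com_range[OF a(1)] by simp
  then have "card (cent a) \<le> card centre" using card_derived_pos by simp
  moreover have "centre \<subset> cent a" using a centre_subset_cent cent_self by blast
  then have "card centre < card (cent a)"
    using finite_subgroup[OF subgroup_cent[OF a(1)]] by (rule psubset_card_mono[rotated])
  ultimately show False by simp
qed

lemma span2_proper:
  assumes a: "a \<in> carrier G" and b: "b \<in> carrier G" and ab: "com a b \<noteq> \<one>"
  shows "span2 a b \<subset> carrier G"
proof -
  have "a \<notin> centre" using ab b centre_com by blast
  have "span2 a b \<noteq> carrier G"
  proof
    assume "span2 a b = carrier G"
    from derived_span2[OF a b this subgroup_com_range[OF a]] show False
      using com_range_proper[OF a \<open>a \<notin> centre\<close>] b by blast
  qed
  then show ?thesis using subgroup.subset[OF span_subgroup(2)[OF a b b]] by blast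
qed

lemma p_pos: "p > 0" "p > 1"
  using p_prime prime_gt_0_nat prime_gt_1_nat by blast+

text \<open>Noncommuting \<open>a\<close>, \<open>b\<close> do not generate \<open>G\<close> over
  \<open>Z\<close>, so p^3 |Z| \<le> |G| \<le> |D| |Z|. With |D| \<le> |Z| and |G| \<le> p^6 this
  forces |D| = |Z| = p^3 and |G| = p^6.\<close>

lemma special_structure:
  shows card_centre: "card centre = p ^ 3"
    and derived_eq_centre: "D = centre"
    and pow_p_centre: "\<And>x. x \<in> carrier G \<Longrightarrow> x [^] p \<in> centre"
    and obtain_span3: "\<exists>a\<in>carrier G. \<exists>b\<in>carrier G. \<exists>c\<in>carrier G. span3 a b c = carrier G"
proof -
  obtain a where a: "a \<in> carrier G" "a \<notin> centre" using nonabelian by blast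
  then obtain b where b: "b \<in> carrier G" "com a b \<noteq> \<one>" using noncentral_com by blast
  have big: "p ^ 3 * card centre \<le> card (carrier G)"
    if "subgroup H G" "H \<subset> carrier G" "p * (p * card centre) \<le> card H" for H
    using card_bound[OF that] by (simp add: eval_nat_numeral algebra_simps)
  have le2: "p * (p * card centre) \<le> card (span2 x y)"
    if "x \<in> carrier G" "y \<in> carrier G" "com x y \<noteq> \<one>" for x y
    using span_strict(3,4)[OF that] by (meson mult_le_mono2 order_trans)
  have big1: "p ^ 3 * card centre \<le> card (carrier G)"
    by (rule big[OF span_subgroup(2)[OF a(1) b(1) b(1)] span2_proper[OF a(1) b] le2[OF a(1) b]])
  have cpos: "card centre > 0"
    using finite_subgroup[OF subgroup_centre] subgroup.one_closed[OF subgroup_centre] card_gt_0_iff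
    by blast
  have "p ^ 3 * card centre \<le> card D * card centre" by (rule order_trans[OF big1 card_le_derived])
  then have D: "p ^ 3 \<le> card D" using cpos by simp
  have DZ: "card D \<le> card centre"
    using derived_centre finite_subgroup[OF subgroup_centre] by (rule card_mono[rotated])
  have "p ^ 3 * card centre \<le> p ^ 3 * p ^ 3" using order_trans[OF big1 small] by (simp flip: power_add)
  then have "card centre \<le> p ^ 3" using p_pos by (subst (asm) mult_le_cancel1) simp
  then show Z: "card centre = p ^ 3" using D DZ by simp
  show DeqZ: "D = centre"
    using card_subset_eq[OF finite_subgroup[OF subgroup_centre] derived_centre] D DZ Z by simp
  have G: "card (carrier G) = p ^ 6"
    by (rule antisym[OF small]) (use big1 in \<open>simp add: Z flip: power_add\<close>)
  \<comment> \<open>A noncentral \<open>x [^] p\<close> would lengthen the chain: \<open>Z\<close>,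
    \<open>Z\<close> with \<open>x [^] p\<close>, \<open>Z\<close> with \<open>x\<close>,
    \<open>span2 x y\<close> and \<open>G\<close> would give |G| \<ge> p^4 |Z| = p^7.\<close>
  show "x [^] p \<in> centre" if x: "x \<in> carrier G" for x
  proof (rule ccontr)
    assume np: "x [^] p \<notin> centre"
    then have "x \<notin> centre" using subgroup_nat_pow_mem[OF subgroup_centre] by blast
    then obtain y where y: "y \<in> carrier G" "com x y \<noteq> \<one>" using noncentral_com x by blast
    have xp: "x [^] p \<in> carrier G" using x by simp
    note A = span_subgroup[OF xp y(1) y(1)] and B = span_subgroup[OF x y(1) y(1)]
    have "x \<notin> adjoin centre (x [^] p)"
    proof
      assume "x \<in> adjoin centre (x [^] p)"
      then obtain z i where z: "z \<in> centre" "x = z \<otimes> (x [^] p) [^] (i::int)" by (auto simp: adjoin_def)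
      have "(x [^] p) [^] i = x [^] (int p * i)" using int_pow_pow[OF x, of "int p" i] by (simp add: int_pow_int)
      then have "x [^] (1 - int p * i) = z"
        using z x centre_carrier[OF z(1)] by (simp add: int_pow_diff) (metis inv_solve_right int_pow_closed)
      then have "x [^] (1 - int p * i) \<in> centre" using z by simp
      moreover have "\<not> int p dvd 1 - int p * i"
      proof
        assume "int p dvd 1 - int p * i"
        then have "int p dvd (1 - int p * i) + int p * i" by (rule dvd_add) simp
        then show False using p_pos by simp
      qed
      ultimately show False using pow_mem_if_not_dvd[OF subgroup_centre x] \<open>x \<notin> centre\<close> by blast
    qed
    moreover have "adjoin centre (x [^] p) \<subseteq> adjoin centre x"
      using adjoin_least[OF B(1,4) subgroup_nat_pow_mem[OF B(1,7)]] .
    ultimately have 1: "adjoin centre (x [^] p) \<subset> adjoin centre x" using B by blast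
    have "centre \<subset> adjoin centre (x [^] p)" using A np by blast
    then have "p * card centre \<le> card (adjoin centre (x [^] p))"
      by (rule psubgroup_card[OF subgroup_centre A(1)])
    moreover have "p * card (adjoin centre (x [^] p)) \<le> card (adjoin centre x)"
      by (rule psubgroup_card[OF A(1) B(1) 1])
    ultimately have "p * (p * card centre) \<le> card (adjoin centre x)"
      by (meson mult_le_mono2 order_trans)
    then have "p * (p * (p * card centre)) \<le> card (span2 x y)"
      using span_strict(4)[OF x y] by (meson mult_le_mono2 order_trans)
    then have "p * (p * (p * (p * card centre))) \<le> card (carrier G)"
      using psubgroup_card[OF B(2) subgroup_self span2_proper[OF x y]] by (meson mult_le_mono2 order_trans)
    also have "\<dots> = p ^ 6" by (rule G)
    finally have "p ^ 7 \<le> p ^ 6" unfolding Z by (simp add: eval_nat_numeral)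
    then show False using p_pos by simp
  qed
  obtain c where c: "c \<in> carrier G" "c \<notin> span2 a b" using span2_proper[OF a(1) b] by blast
  note sp = span_subgroup[OF a(1) b(1) c(1)]
  have "span2 a b \<subset> span3 a b c" using sp c by blast
  then have "p * card (span2 a b) \<le> card (span3 a b c)" by (rule psubgroup_card[OF sp(2,3)])
  then have "p * (p * (p * card centre)) \<le> card (span3 a b c)"
    using le2[OF a(1) b] by (meson mult_le_mono2 order_trans)
  then have "card (carrier G) \<le> card (span3 a b c)" unfolding Z G by (simp add: eval_nat_numeral)
  then have "span3 a b c = carrier G"
    using card_seteq[OF finite_carrier subgroup.subset[OF sp(3)]] by blast
  then show "\<exists>a\<in>carrier G. \<exists>b\<in>carrier G. \<exists>c\<in>carrier G. span3 a b c = carrier G"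
    using a b c by blast
qed

end

section \<open>Integer matrices modulo a prime\<close>

definition vec3 :: "int \<Rightarrow> int \<Rightarrow> int \<Rightarrow> int ^ 3"
  where "vec3 a b c = vector [a, b, c]"

definition cross3i :: "int ^ 3 \<Rightarrow> int ^ 3 \<Rightarrow> int ^ 3"
  where "cross3i x y = vec3 (x$2 * y$3 - x$3 * y$2) (x$3 * y$1 - x$1 * y$3) (x$1 * y$2 - x$2 * y$1)"

text \<open>The action of \<open>T\<close> on the exterior square in the basis e2 x e3, e3 x e1, e1
  x e2, hence the map induced on commutators in the coordinates of \<open>W3\<close>.\<close>

definition cofactor3 :: "int ^ 3 ^ 3 \<Rightarrow> int ^ 3 ^ 3"
  where "cofactor3 T = transpose (vector
    [cross3i (column 2 T) (column 3 T), cross3i (column 3 T) (column 1 T), cross3i (column 1 T) (column 2 T)])"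

definition dvd_vec :: "int \<Rightarrow> int ^ 'n \<Rightarrow> bool"
  where "dvd_vec p v \<longleftrightarrow> (\<forall>i. p dvd v $ i)"

lemma vec3_nth [simp]: "vec3 a b c $ 1 = a" "vec3 a b c $ 2 = b" "vec3 a b c $ 3 = c"
  by (simp_all add: vec3_def)

lemma cofactor3_nth:
  "cofactor3 T $ 1 $ 1 = T$2$2 * T$3$3 - T$3$2 * T$2$3"
  "cofactor3 T $ 2 $ 1 = T$3$2 * T$1$3 - T$1$2 * T$3$3"
  "cofactor3 T $ 3 $ 1 = T$1$2 * T$2$3 - T$2$2 * T$1$3"
  "cofactor3 T $ 1 $ 2 = T$2$3 * T$3$1 - T$3$3 * T$2$1"
  "cofactor3 T $ 2 $ 2 = T$3$3 * T$1$1 - T$1$3 * T$3$1"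
  "cofactor3 T $ 3 $ 2 = T$1$3 * T$2$1 - T$2$3 * T$1$1"
  "cofactor3 T $ 1 $ 3 = T$2$1 * T$3$2 - T$3$1 * T$2$2"
  "cofactor3 T $ 2 $ 3 = T$3$1 * T$1$2 - T$1$1 * T$3$2"
  "cofactor3 T $ 3 $ 3 = T$1$1 * T$2$2 - T$2$1 * T$1$2"
  by (simp_all add: cofactor3_def cross3i_def transpose_def column_def)

lemma cofactor3_mult: "cofactor3 (A ** B) = cofactor3 A ** cofactor3 B"
  by (simp add: vec_eq_iff forall_3 matrix_matrix_mult_def sum_3 cofactor3_nth)
     (simp add: algebra_simps)

lemma cofactor3_transpose: "cofactor3 (transpose A) = transpose (cofactor3 A)"
  by (simp add: vec_eq_iff forall_3 cofactor3_nth transpose_def algebra_simps)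

definition det3 :: "int ^ 3 ^ 3 \<Rightarrow> int"
  where "det3 A = A$1$1 * cofactor3 A $ 1 $ 1 + A$1$2 * cofactor3 A $ 1 $ 2 + A$1$3 * cofactor3 A $ 1 $ 3"

lemma cofactor3_cofactor3: "cofactor3 (cofactor3 A) $ i $ j = det3 A * A $ i $ j"
proof -
  have "\<forall>i j. cofactor3 (cofactor3 A) $ i $ j = det3 A * A $ i $ j"
    unfolding forall_3 by (simp add: cofactor3_nth det3_def) (simp add: algebra_simps)
  then show ?thesis by simp
qed

lemma mult_adjugate3: "(A ** transpose (cofactor3 A)) $ i $ j = (if i = j then det3 A else 0)"
  "(transpose (cofactor3 A) ** A) $ i $ j = (if i = j then det3 A else 0)"
proof -
  have "\<forall>i j. (A ** transpose (cofactor3 A)) $ i $ j = (if i = j then det3 A else 0)"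
    "\<forall>i j. (transpose (cofactor3 A) ** A) $ i $ j = (if i = j then det3 A else 0)"
    unfolding forall_3
    by (simp_all add: cofactor3_nth det3_def matrix_matrix_mult_def sum_3 transpose_def)
      (simp_all add: algebra_simps)
  then show "(A ** transpose (cofactor3 A)) $ i $ j = (if i = j then det3 A else 0)"
  "(transpose (cofactor3 A) ** A) $ i $ j = (if i = j then det3 A else 0)" by simp_all
qed

text \<open>For \<open>p = 2\<close> squaring is only quadratic; \<open>polar\<close> is its deviation from linearity.\<close>

definition polar :: "int ^ 3 \<Rightarrow> int ^ 3"
  where "polar x = vec3 (x$2 * x$3) (x$3 * x$1) (x$1 * x$2)"

definition columns3 :: "int ^ 3 \<Rightarrow> int ^ 3 \<Rightarrow> int ^ 3 \<Rightarrow> int ^ 3 ^ 3"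
  where "columns3 a b c = transpose (vector [a, b, c])"

lemma columns3_nth [simp]:
  "columns3 a b c $ i $ 1 = a $ i" "columns3 a b c $ i $ 2 = b $ i" "columns3 a b c $ i $ 3 = c $ i"
  by (simp_all add: columns3_def transpose_def)

text \<open>An admissible \<open>N\<close> matters only modulo 2; the 25 matrices were found by a search and each of the
  204 admissible cases is fixed by one of them.\<close>

lemma mod2_matrix:
  assumes an: "\<And>x. dvd_vec 2 (N *v x + polar x) \<Longrightarrow> dvd_vec 2 x"
  obtains T x where "\<And>i. dvd_vec 2 (cofactor3 T *v column i N - (N *v column i T + polar (column i T)))"
    "\<not> dvd_vec 2 (cross3i x (T *v x))"
proof (rule ccontr)
  assume "\<not> thesis"
  \<comment> \<open>A matrix moving some basis vector off its line is nonscalar; these three tests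
    are enough for the matrices of the list.\<close>
  then have no: "(\<forall>i. dvd_vec 2 (cofactor3 T *v column i N - (N *v column i T + polar (column i T)))) \<longrightarrow>
      dvd_vec 2 (cross3i (vec3 1 0 0) (T *v vec3 1 0 0)) \<and>
      dvd_vec 2 (cross3i (vec3 0 1 0) (T *v vec3 0 1 0)) \<and>
      dvd_vec 2 (cross3i (vec3 0 0 1) (T *v vec3 0 0 1))" for T
    using that by blast
  note gd = cofactor3_nth polar_def column_def dvd_vec_def forall_3 matrix_vector_mult_def sum_3
    cross3i_def
  note [simp] = cofactor3_nth
  note n = no[of "columns3 (vec3 0 0 1) (vec3 0 1 0) (vec3 1 0 0)", simplified gd, simplified]
    no[of "columns3 (vec3 0 0 1) (vec3 1 1 1) (vec3 1 0 0)", simplified gd, simplified]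
    no[of "columns3 (vec3 0 1 0) (vec3 1 0 0) (vec3 1 1 1)", simplified gd, simplified]
    no[of "columns3 (vec3 1 0 0) (vec3 1 1 1) (vec3 0 0 1)", simplified gd, simplified]
    no[of "columns3 (vec3 1 1 1) (vec3 0 0 1) (vec3 0 1 0)", simplified gd, simplified]
    no[of "columns3 (vec3 0 1 0) (vec3 1 0 0) (vec3 0 0 1)", simplified gd, simplified]
    no[of "columns3 (vec3 0 1 1) (vec3 0 1 0) (vec3 1 1 0)", simplified gd, simplified]
    no[of "columns3 (vec3 1 0 0) (vec3 0 0 1) (vec3 0 1 0)", simplified gd, simplified]
    no[of "columns3 (vec3 0 1 1) (vec3 1 0 1) (vec3 0 0 1)", simplified gd, simplified]
    no[of "columns3 (vec3 1 0 0) (vec3 0 1 0) (vec3 1 1 1)", simplified gd, simplified]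
    no[of "columns3 (vec3 1 0 0) (vec3 0 1 0) (vec3 0 1 1)", simplified gd, simplified]
    no[of "columns3 (vec3 1 0 0) (vec3 0 1 0) (vec3 1 0 1)", simplified gd, simplified]
    no[of "columns3 (vec3 1 0 0) (vec3 0 1 1) (vec3 0 0 1)", simplified gd, simplified]
    no[of "columns3 (vec3 1 0 0) (vec3 1 0 1) (vec3 1 1 0)", simplified gd, simplified]
    no[of "columns3 (vec3 1 0 0) (vec3 1 1 0) (vec3 0 0 1)", simplified gd, simplified]
    no[of "columns3 (vec3 1 0 0) (vec3 1 1 0) (vec3 1 0 1)", simplified gd, simplified]
    no[of "columns3 (vec3 1 0 1) (vec3 0 1 0) (vec3 0 0 1)", simplified gd, simplified]
    no[of "columns3 (vec3 1 0 1) (vec3 0 1 1) (vec3 0 0 1)", simplified gd, simplified]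
    no[of "columns3 (vec3 1 1 0) (vec3 0 1 0) (vec3 0 0 1)", simplified gd, simplified]
    no[of "columns3 (vec3 1 1 0) (vec3 0 1 0) (vec3 0 1 1)", simplified gd, simplified]
    no[of "columns3 (vec3 1 1 1) (vec3 0 1 0) (vec3 0 0 1)", simplified gd, simplified]
    no[of "columns3 (vec3 0 0 1) (vec3 0 1 0) (vec3 1 0 1)", simplified gd, simplified]
    no[of "columns3 (vec3 0 0 1) (vec3 0 1 0) (vec3 1 1 1)", simplified gd, simplified]
    no[of "columns3 (vec3 0 0 1) (vec3 0 1 1) (vec3 1 0 1)", simplified gd, simplified]
    no[of "columns3 (vec3 0 0 1) (vec3 1 0 0) (vec3 0 1 0)", simplified gd, simplified]
  \<comment> \<open>The seven nonzero vectors modulo 2. After simplification both families of facts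
    speak only about the parities of the nine entries of \<open>N\<close>.\<close>
  note a = an[of "vec3 1 0 0", simplified gd, simplified]
    an[of "vec3 0 1 0", simplified gd, simplified]
    an[of "vec3 0 0 1", simplified gd, simplified]
    an[of "vec3 1 1 0", simplified gd, simplified]
    an[of "vec3 1 0 1", simplified gd, simplified]
    an[of "vec3 0 1 1", simplified gd, simplified]
    an[of "vec3 1 1 1", simplified gd, simplified]
  show False using n a by argo
qed

section \<open>Nonscalar solutions for odd primes\<close>

definition smult3 :: "int \<Rightarrow> int ^ 3 ^ 3 \<Rightarrow> int ^ 3 ^ 3"
  where "smult3 c A = (\<chi> i j. c * A $ i $ j)"

text \<open>Modulo \<open>p\<close>, a vanishing determinant makes \<open>N\<close> times its
  adjugate vanish, so injectivity kills all cofactors. Then all 2 x 2 minors vanish, each row yields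
  kernel vectors such as (N_i2, -N_i1, 0), and injectivity kills the entries of \<open>N\<close> as
  well, leaving (1, 0, 0) in the kernel.\<close>

lemma det3_not_dvd:
  assumes p: "prime_elem p" and inj: "\<And>x. dvd_vec p (N *v x) \<Longrightarrow> dvd_vec p x"
  shows "\<not> p dvd det3 N"
proof
  assume d: "p dvd det3 N"
  note gd = dvd_vec_def forall_3 matrix_vector_mult_def sum_3
  have adj: "p dvd cofactor3 N $ i $ j" for i j
  proof -
    let ?A = "transpose (cofactor3 N)"
    have "dvd_vec p (N *v column i ?A)"
    proof -
      have "(N *v column i ?A) $ k = (N ** ?A) $ k $ i" for k
        by (simp add: matrix_vector_mult_def matrix_matrix_mult_def column_def)
      then show ?thesis using d by (simp add: dvd_vec_def mult_adjugate3)
    qed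
    then have "dvd_vec p (column i ?A)" by (rule inj)
    then show ?thesis by (simp add: dvd_vec_def column_def transpose_def)
  qed
  have minors: "p dvd N$i$2 * N$j$1 - N$i$1 * N$j$2" "p dvd N$i$3 * N$j$1 - N$i$1 * N$j$3" for i j
  proof -
    have "\<forall>i j. p dvd N$i$2 * N$j$1 - N$i$1 * N$j$2" "\<forall>i j. p dvd N$i$3 * N$j$1 - N$i$1 * N$j$3"
      unfolding forall_3
      using adj[of 1 3] adj[of 2 3] adj[of 3 3] adj[of 1 2] adj[of 2 2] adj[of 3 2]
      by (simp_all add: cofactor3_nth dvd_diff_commute mult.commute algebra_simps)
    then show "p dvd N$i$2 * N$j$1 - N$i$1 * N$j$2" "p dvd N$i$3 * N$j$1 - N$i$1 * N$j$3" by blast+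
  qed
  have 1: "p dvd N$i$1 \<and> p dvd N$i$2" for i
  proof -
    have "dvd_vec p (N *v vec3 (N$i$2) (- N$i$1) 0)"
      using minors(1)[of i] by (simp add: gd mult.commute)
    from inj[OF this] show ?thesis by (simp add: gd)
  qed
  have 3: "p dvd N$i$3" for i
  proof -
    have "dvd_vec p (N *v vec3 (N$i$3) 0 (- N$i$1))"
      using minors(2)[of i] by (simp add: gd mult.commute)
    from inj[OF this] show ?thesis by (simp add: gd)
  qed
  have "dvd_vec p (N *v vec3 1 0 0)" using 1 3 by (simp add: gd)
  from inj[OF this] have "p dvd 1" by (simp add: gd)
  then show False using p by (simp add: prime_elem_not_unit)
qed

lemma dvd_inverse:
  fixes p a :: int
  assumes "prime_elem p" "\<not> p dvd a"
  obtains b where "p dvd b * a - 1"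
proof -
  have "coprime p a" using assms by (rule prime_elem_imp_coprime)
  then have "gcd p a = 1" by (rule coprime_imp_gcd_eq_1)
  then obtain u v where "u * p + v * a = 1" using bezout_int[of p a] by auto
  then have "v * a - 1 = p * (- u)" by (simp add: algebra_simps)
  then show thesis using that[of v] by simp
qed

lemma smult3_nth [simp]: "smult3 c A $ i $ j = c * A $ i $ j"
  by (simp add: smult3_def)

lemma smult3_mult: "smult3 c A ** B = smult3 c (A ** B)" "A ** smult3 c B = smult3 c (A ** B)"
  by (simp_all add: vec_eq_iff matrix_matrix_mult_def sum_distrib_left algebra_simps)

lemma scalar_matrix_mult:
  fixes M B :: "int ^ 3 ^ 3"
  assumes "\<And>i j. M $ i $ j = (if i = j then d else 0)"
  shows "(M ** B) $ i $ j = d * B $ i $ j" "(B ** M) $ i $ j = d * B $ i $ j"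
  using exhaust_3[of i] exhaust_3[of j] by (auto simp: matrix_matrix_mult_def sum_3 assms)

text \<open>The matrix \<open>T\<close> is the cosquare \<open>N\<^sup>-\<^sup>1 N\<^sup>T\<close>, which preserves the bilinear form \<open>N\<close>. It is trivial
  exactly when \<open>N\<close> is symmetric, and then a reflection up to sign is used instead.\<close>

lemma cosquare_matrix:
  assumes p: "prime_elem p" and d: "\<not> p dvd det3 N" and ns: "\<not> p dvd N $ k $ l - N $ l $ k"
  obtains T x where "\<And>i. dvd_vec p (cofactor3 T *v column i N - N *v column i T)"
    "\<not> dvd_vec p (cross3i x (T *v x))"
proof -
  obtain c where c: "p dvd c * det3 N - 1" using dvd_inverse[OF p d] .
  \<comment> \<open>\<open>A\<close> is the adjugate and \<open>c\<close> inverts the determinant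
    modulo \<open>p\<close>, so that \<open>T\<close> is an integer representative of the
    cosquare.\<close>
  define A where "A = transpose (cofactor3 N)"
  define T where "T = smult3 c (A ** transpose N)"
  have cofT: "cofactor3 T = smult3 (c * c * det3 N) (transpose N ** A)"
  proof -
    have "cofactor3 T = smult3 (c * c) (cofactor3 (A ** transpose N))"
      unfolding T_def smult3_def by (simp add: vec_eq_iff forall_3 cofactor3_nth algebra_simps)
    also have "cofactor3 (A ** transpose N) = smult3 (det3 N) (transpose N ** A)"
      unfolding cofactor3_mult A_def cofactor3_transpose
      by (simp add: vec_eq_iff smult3_def matrix_matrix_mult_def transpose_def cofactor3_cofactor3
          sum_distrib_left mult.assoc)
    finally show ?thesis by (simp add: smult3_def vec_eq_iff mult.assoc)
  qed
  \<comment> \<open>As \<open>c * det3 N\<close> is 1 modulo \<open>p\<close>, both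
    \<open>N ** T\<close> and \<open>cofactor3 T ** N\<close> reduce to the transpose of
    \<open>N\<close>.\<close>
  have NT: "(N ** T) $ i $ j = c * det3 N * N $ j $ i" for i j
  proof -
    have "N ** T = smult3 c ((N ** A) ** transpose N)"
      unfolding T_def by (simp add: smult3_mult matrix_mul_assoc)
    moreover have "((N ** A) ** transpose N) $ i $ j = det3 N * transpose N $ i $ j"
      unfolding A_def by (rule scalar_matrix_mult(1)[OF mult_adjugate3(1)])
    ultimately show ?thesis by (simp add: smult3_def transpose_def)
  qed
  have CN: "(cofactor3 T ** N) $ i $ j = c * det3 N * (c * det3 N) * N $ j $ i" for i j
  proof -
    have "cofactor3 T ** N = smult3 (c * c * det3 N) (transpose N ** (A ** N))"
      unfolding cofT by (simp add: smult3_mult matrix_mul_assoc)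
    moreover have "(transpose N ** (A ** N)) $ i $ j = det3 N * transpose N $ i $ j"
      unfolding A_def by (rule scalar_matrix_mult(2)[OF mult_adjugate3(2)])
    ultimately show ?thesis by (simp add: smult3_def transpose_def)
  qed
  have col: "(B *v column j C) $ i = (B ** C) $ i $ j" for B C :: "int ^ 3 ^ 3" and i j
    by (simp add: matrix_vector_mult_def matrix_matrix_mult_def column_def)
  have crit: "dvd_vec p (cofactor3 T *v column i N - N *v column i T)" for i
  proof -
    have "p dvd (c * det3 N - 1) * (c * det3 N * N $ i $ j)" for j using c by (rule dvd_mult2)
    then show ?thesis by (simp add: dvd_vec_def col CN NT algebra_simps)
  qed
  show thesis
  proof (rule ccontr)
    assume "\<not> thesis"
    then have sc: "dvd_vec p (cross3i x (T *v x))" for x using that crit by blast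
    \<comment> \<open>If every vector is an eigenvector, \<open>T\<close> is a scalar t modulo
      \<open>p\<close>. The two products then read N^T = t N and N^T = t^2 N, which forces t = 1 and
      \<open>N\<close> symmetric, or N = 0; \<open>ns\<close> excludes both.\<close>
    have od: "p dvd T$1$2" "p dvd T$1$3" "p dvd T$2$1" "p dvd T$2$3" "p dvd T$3$1" "p dvd T$3$2"
      using sc[of "vec3 1 0 0"] sc[of "vec3 0 1 0"] sc[of "vec3 0 0 1"]
      by (simp_all add: dvd_vec_def forall_3 cross3i_def matrix_vector_mult_def sum_3)
    have dg: "p dvd T$1$1 - T$2$2" "p dvd T$1$1 - T$3$3"
    proof -
      have h: "p dvd T$2$1 + T$2$2 - (T$1$1 + T$1$2)" "p dvd T$1$1 + T$1$3 - (T$3$1 + T$3$3)"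
        using sc[of "vec3 1 1 0"] sc[of "vec3 1 0 1"]
        by (simp_all add: dvd_vec_def forall_3 cross3i_def matrix_vector_mult_def sum_3)
      show "p dvd T$1$1 - T$2$2"
        using dvd_add[OF dvd_diff[OF h(1) od(3)] od(1)] by (simp add: dvd_diff_commute)
      show "p dvd T$1$1 - T$3$3"
        using dvd_add[OF dvd_diff[OF h(2) od(2)] od(5)] by simp
    qed
    define t where "t = T$1$1"
    obtain C where C: "T = smult3 p C + smult3 t (mat 1)"
    proof -
      have "\<forall>i j. p dvd T$i$j - (if i = j then t else 0)"
        unfolding forall_3 t_def using od dg by (simp add: dvd_diff_commute)
      then have "\<forall>i j. \<exists>c. T$i$j - (if i = j then t else 0) = p * c" by (auto simp: dvd_def)
      then obtain f where "\<forall>i j. T$i$j - (if i = j then t else 0) = p * f i j" by metis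
      then have "T = smult3 p (\<chi> i j. f i j) + smult3 t (mat 1)"
        by (auto simp: vec_eq_iff smult3_def mat_def algebra_simps)
      then show thesis by (rule that)
    qed
    have T: "T $ i $ j = p * C $ i $ j + (if i = j then t else 0)" for i j
      by (simp add: C smult3_def mat_def)
    have NTt: "p dvd (N ** T) $ i $ j - t * N $ i $ j" for i j
    proof -
      have "\<forall>j. (N ** T) $ i $ j - t * N $ i $ j = p * (N ** C) $ i $ j"
        unfolding forall_3 by (simp add: matrix_matrix_mult_def sum_3 T algebra_simps)
      then show ?thesis by simp
    qed
    have cT: "p dvd cofactor3 T $ i $ j - (if i = j then t * t else 0)" for i j
    proof -
      have "\<forall>i j. p dvd cofactor3 T $ i $ j - (if i = j then t * t else 0)"
        unfolding forall_3 by (auto simp: cofactor3_nth T algebra_simps intro!: dvd_add dvd_diff)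
      then show ?thesis by blast
    qed
    have CNt: "p dvd (cofactor3 T ** N) $ i $ j - t * t * N $ i $ j" for i j
    proof -
      have "p dvd (cofactor3 T $ i $ 1 - (if i = 1 then t * t else 0)) * N $ 1 $ j +
          (cofactor3 T $ i $ 2 - (if i = 2 then t * t else 0)) * N $ 2 $ j +
          (cofactor3 T $ i $ 3 - (if i = 3 then t * t else 0)) * N $ 3 $ j"
        by (intro dvd_add dvd_mult2 cT)
      then show ?thesis using exhaust_3[of i]
        by (auto simp: matrix_matrix_mult_def sum_3 algebra_simps)
    qed
    have cc: "p dvd (c * det3 N - 1) * x" for x using c by (rule dvd_mult2)
    have Nt: "p dvd N $ j $ i - t * N $ i $ j" for i j
    proof -
      have "p dvd ((N ** T) $ i $ j - t * N $ i $ j) - (c * det3 N - 1) * N $ j $ i"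
        by (intro dvd_diff NTt cc)
      then show ?thesis unfolding NT by (simp add: algebra_simps)
    qed
    have Ntt: "p dvd N $ j $ i - t * t * N $ i $ j" for i j
    proof -
      have "p dvd ((cofactor3 T ** N) $ i $ j - t * t * N $ i $ j)
          - (c * det3 N - 1) * ((c * det3 N + 1) * N $ j $ i)"
        by (intro dvd_diff CNt cc)
      then show ?thesis unfolding CN by (simp add: algebra_simps)
    qed
    have "p dvd (t - 1) * N $ j $ i" for i j
    proof -
      have "p dvd (t - 1) * (N $ j $ i - t * N $ i $ j) + (t * (N $ j $ i - t * N $ i $ j) -
          t * (N $ j $ i - t * N $ i $ j)) + ((N $ j $ i - t * N $ i $ j) - (N $ j $ i - t * t * N $ i $ j))"
        by (intro dvd_add dvd_diff dvd_mult Nt Ntt)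
      then show ?thesis by (simp add: algebra_simps)
    qed
    then have alt: "p dvd t - 1 \<or> p dvd N $ j $ i" for i j
      using p by (simp add: prime_elem_dvd_mult_iff)
    show False
    proof (cases "p dvd t - 1")
      case True
      then have "p dvd (N $ k $ l - t * N $ l $ k) + (t - 1) * N $ l $ k"
        by (intro dvd_add Nt dvd_mult2)
      then show False using ns by (simp add: algebra_simps)
    next
      case False
      then have "p dvd N $ k $ l" "p dvd N $ l $ k" using alt by blast+
      then show False using ns by simp
    qed
  qed
qed

text \<open>By polarization a nonzero symmetric form in odd characteristic has a vector
  \<open>v\<close> with q(v) nonzero. \<open>T\<close> is the half-turn about \<open>v\<close>: it
  fixes \<open>v\<close> and negates the orthogonal complement, so it is an isometry of determinant
  1 and not a scalar.\<close>

lemma reflection_matrix: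
  assumes p: "prime_elem p" and odd: "\<not> p dvd 2" and nz: "\<not> p dvd det3 N"
    and sym: "\<And>k l. p dvd N $ k $ l - N $ l $ k"
  obtains T x where "\<And>i. dvd_vec p (cofactor3 T *v column i N - N *v column i T)"
    "\<not> dvd_vec p (cross3i x (T *v x))"
proof -
  define q where "q v = v$1 * (N *v v)$1 + v$2 * (N *v v)$2 + v$3 * (N *v v)$3" for v
  note gd = matrix_vector_mult_def sum_3
  have "\<exists>v. \<not> p dvd q v"
  proof (rule ccontr)
    assume "\<nexists>v. \<not> p dvd q v"
    then have q: "p dvd q v" for v by blast
    have diag: "p dvd N$1$1" "p dvd N$2$2" "p dvd N$3$3"
      using q[of "vec3 1 0 0"] q[of "vec3 0 1 0"] q[of "vec3 0 0 1"] by (simp_all add: q_def gd)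
    have "p dvd 2 * N$1$2"
    proof -
      have "p dvd q (vec3 1 1 0) - N$1$1 - N$2$2 + (N$1$2 - N$2$1)"
        by (intro dvd_add dvd_diff q diag sym)
      then show ?thesis by (simp add: q_def gd)
    qed
    moreover have "p dvd 2 * N$1$3"
    proof -
      have "p dvd q (vec3 1 0 1) - N$1$1 - N$3$3 + (N$1$3 - N$3$1)"
        by (intro dvd_add dvd_diff q diag sym)
      then show ?thesis by (simp add: q_def gd)
    qed
    ultimately have "p dvd N$1$2" "p dvd N$1$3" using p odd by (simp_all add: prime_elem_dvd_mult_iff)
    then have "p dvd det3 N" using diag by (simp add: det3_def)
    then show False using nz by simp
  qed
  then obtain v where v: "\<not> p dvd q v" by blast
  obtain c where c: "p dvd c * q v - 1" using dvd_inverse[OF p v] .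
  define s where "s = 2 * c"
  define w where "w = N *v v"
  define T where "T = (\<chi> i j. s * v $ i * w $ j - (if i = j then 1 else 0))"
  \<comment> \<open>\<open>s * q v\<close> is 2 only modulo \<open>p\<close>; \<open>m\<close>
    carries the error through the integer identities.\<close>
  define m where "m = s * q v - 2"
  have qw: "q v = v$1 * w$1 + v$2 * w$2 + v$3 * w$3" by (simp add: q_def w_def)
  have m: "p dvd m"
  proof -
    have "p dvd 2 * (c * q v - 1)" using c by (rule dvd_mult)
    then show ?thesis by (simp add: m_def s_def algebra_simps)
  qed
  have cofT: "cofactor3 T $ i $ j = s * w $ i * v $ j - (if i = j then 1 + m else 0)" for i j
  proof -
    have "\<forall>i j. cofactor3 T $ i $ j = s * w $ i * v $ j - (if i = j then 1 + m else 0)"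
      unfolding forall_3 by (simp add: cofactor3_nth T_def m_def qw) (simp add: algebra_simps)
    then show ?thesis by blast
  qed
  have u: "p dvd (v$1 * N$1$j + v$2 * N$2$j + v$3 * N$3$j) - w$j" for j
  proof -
    have "p dvd v$1 * (N$1$j - N$j$1) + v$2 * (N$2$j - N$j$2) + v$3 * (N$3$j - N$j$3)"
      by (intro dvd_add dvd_mult sym)
    then show ?thesis by (simp add: w_def gd algebra_simps)
  qed
  have crit: "dvd_vec p (cofactor3 T *v column i N - N *v column i T)" for i
    unfolding dvd_vec_def
  proof
    fix k
    have wk: "w$k = N$k$1 * v$1 + N$k$2 * v$2 + N$k$3 * v$3" by (simp add: w_def gd)
    have "(N *v column i T) $ k = s * w$i * w$k - N$k$i"
      using exhaust_3[of i] unfolding wk by (auto simp: gd column_def T_def algebra_simps)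
    moreover have "(cofactor3 T *v column i N) $ k
        = s * w$k * (v$1 * N$1$i + v$2 * N$2$i + v$3 * N$3$i) - (1 + m) * N$k$i"
      using exhaust_3[of k] by (auto simp: gd column_def cofT algebra_simps)
    ultimately have eq: "s * w$k * ((v$1 * N$1$i + v$2 * N$2$i + v$3 * N$3$i) - w$i) - m * N$k$i
      = (cofactor3 T *v column i N - N *v column i T) $ k" by (simp add: algebra_simps)
    have "p dvd s * w$k * ((v$1 * N$1$i + v$2 * N$2$i + v$3 * N$3$i) - w$i) - m * N$k$i"
      by (intro dvd_diff dvd_mult dvd_mult2 u m)
    then show "p dvd (cofactor3 T *v column i N - N *v column i T) $ k" unfolding eq .
  qed
  have s: "\<not> p dvd s"
  proof
    assume "p dvd s"
    then have "p dvd s * q v - m" using m by (intro dvd_diff dvd_mult2)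
    then show False using odd by (simp add: m_def)
  qed
  have "\<exists>y l. \<not> p dvd cross3i y v $ l"
  proof (rule ccontr)
    assume "\<nexists>y l. \<not> p dvd cross3i y v $ l"
    then have *: "p dvd cross3i y v $ l" for y l by blast
    have "p dvd v$1" "p dvd v$2" "p dvd v$3"
      using *[of "vec3 0 0 1" 2] *[of "vec3 0 0 1" 1] *[of "vec3 1 0 0" 2] by (simp_all add: cross3i_def)
    then have "p dvd q v" by (simp add: qw)
    then show False using v by simp
  qed
  then obtain y l where yl: "\<not> p dvd cross3i y v $ l" by blast
  show thesis
  proof (rule ccontr)
    assume "\<not> thesis"
    then have sc: "dvd_vec p (cross3i x (T *v x))" for x using that crit by blast
    \<comment> \<open>\<open>T\<close> is a rank one map minus the identity, and only the rank one
      part survives in the cross product. Applied to \<open>v + y\<close> and \<open>v - y\<close>,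
      with \<open>y\<close> independent of \<open>v\<close>, it makes both orthogonal to
      \<open>w\<close>, and adding gives 2 q(v) = 0 modulo \<open>p\<close>.\<close>
    have cr: "cross3i x (T *v x) $ l = s * (w$1 * x$1 + w$2 * x$2 + w$3 * x$3) * cross3i x v $ l" for x
      using exhaust_3[of l] by (auto simp: cross3i_def gd T_def) (simp_all add: algebra_simps)
    have "p dvd (w$1 * x$1 + w$2 * x$2 + w$3 * x$3) * cross3i x v $ l" for x
    proof -
      have "p dvd s * (w$1 * x$1 + w$2 * x$2 + w$3 * x$3) * cross3i x v $ l"
        using sc[of x] unfolding dvd_vec_def cr[symmetric] by blast
      then show ?thesis using p s by (simp add: prime_elem_dvd_mult_iff)
    qed
    from this[of "v + y"] this[of "v - y"]
    have "p dvd (w$1 * (v + y)$1 + w$2 * (v + y)$2 + w$3 * (v + y)$3) * cross3i (v + y) v $ l"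
      "p dvd (w$1 * (v - y)$1 + w$2 * (v - y)$2 + w$3 * (v - y)$3) * cross3i (v - y) v $ l" .
    moreover have "cross3i (v + y) v $ l = cross3i y v $ l" "cross3i (v - y) v $ l = - cross3i y v $ l"
      using exhaust_3[of l] by (auto simp: cross3i_def algebra_simps)
    ultimately have "p dvd w$1 * (v + y)$1 + w$2 * (v + y)$2 + w$3 * (v + y)$3"
      "p dvd w$1 * (v - y)$1 + w$2 * (v - y)$2 + w$3 * (v - y)$3"
      using yl p by (auto simp: prime_elem_dvd_mult_iff)
    then have "p dvd (w$1 * (v + y)$1 + w$2 * (v + y)$2 + w$3 * (v + y)$3)
        + (w$1 * (v - y)$1 + w$2 * (v - y)$2 + w$3 * (v - y)$3)" by (rule dvd_add)
    then have "p dvd 2 * q v" by (simp add: qw algebra_simps)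
    then show False using v odd p by (simp add: prime_elem_dvd_mult_iff)
  qed
qed

section \<open>Groups with three generators and centre of order \<open>p ^ 3\<close>\<close>

lemma odd_prime_matrix:
  assumes p: "prime_elem p" and "\<not> p dvd 2" and inj: "\<And>x. dvd_vec p (N *v x) \<Longrightarrow> dvd_vec p x"
  obtains T x where "\<And>i. dvd_vec p (cofactor3 T *v column i N - N *v column i T)"
    "\<not> dvd_vec p (cross3i x (T *v x))"
proof (cases "\<forall>k l. p dvd N $ k $ l - N $ l $ k")
  case True
  then show thesis using reflection_matrix[OF p assms(2) det3_not_dvd[OF p inj]] that by blast
next
  case False
  then show thesis using cosquare_matrix[OF p det3_not_dvd[OF p inj]] that by blast
qed

text \<open>The correction term for collecting \<open>E3 v \<otimes> E3 w\<close>, in the coordinates of \<open>W3\<close> below.\<close>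

definition kap :: "int ^ 3 \<Rightarrow> int ^ 3 \<Rightarrow> int ^ 3"
  where "kap v w = vec3 (- (v$3 * w$2)) (v$3 * w$1) (- (v$2 * w$1))"

context class2_group
begin

definition E3 :: "'a \<Rightarrow> 'a \<Rightarrow> 'a \<Rightarrow> int ^ 3 \<Rightarrow> 'a"
  where "E3 a b c v = a [^] (v$1) \<otimes> b [^] (v$2) \<otimes> c [^] (v$3)"

text \<open>The cyclic order of the three commutators makes \<open>com\<close> of two normal forms
  the cross product of their coordinates, as \<open>com_E3\<close> shows.\<close>

definition W3 :: "'a \<Rightarrow> 'a \<Rightarrow> 'a \<Rightarrow> int ^ 3 \<Rightarrow> 'a"
  where "W3 a b c v = com b c [^] (v$1) \<otimes> com c a [^] (v$2) \<otimes> com a b [^] (v$3)"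

lemma centre_pull:
  assumes "z \<in> centre" "x \<in> carrier G" "y \<in> carrier G"
  shows "x \<otimes> (z \<otimes> y) = z \<otimes> (x \<otimes> y)"
  using assms centre_comm[of z x] centre_carrier[of z] by (simp add: m_assoc[symmetric])

lemma comm_group_centre: "comm_group (G\<lparr>carrier := centre\<rparr>)"
  using subgroup_imp_group[OF subgroup_centre]
  by (rule group.group_comm_groupI) (simp add: centre_comm centre_carrier)

lemma com_pow_centre: "\<lbrakk>x \<in> carrier G; y \<in> carrier G\<rbrakk> \<Longrightarrow> com x y [^] (i::int) \<in> centre"
  by (rule subgroup_int_pow_closed[OF subgroup_centre com_centre])

lemma E3_closed [simp]:
  "\<lbrakk>a \<in> carrier G; b \<in> carrier G; c \<in> carrier G\<rbrakk> \<Longrightarrow> E3 a b c v \<in> carrier G"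
  by (simp add: E3_def)

lemma W3_centre:
  "\<lbrakk>a \<in> carrier G; b \<in> carrier G; c \<in> carrier G\<rbrakk> \<Longrightarrow> W3 a b c v \<in> centre"
  unfolding W3_def by (intro subgroup.m_closed[OF subgroup_centre] com_pow_centre)

lemma W3_closed [simp]:
  "\<lbrakk>a \<in> carrier G; b \<in> carrier G; c \<in> carrier G\<rbrakk> \<Longrightarrow> W3 a b c v \<in> carrier G"
  using W3_centre centre_carrier by blast

lemma W3_add:
  assumes "a \<in> carrier G" "b \<in> carrier G" "c \<in> carrier G"
  shows "W3 a b c (v + w) = W3 a b c v \<otimes> W3 a b c w"
proof -
  interpret Z: comm_group "G\<lparr>carrier := centre\<rparr>" by (rule comm_group_centre)
  show ?thesis using assms com_pow_centre Z.m_ac Z.m_closed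
    by (simp add: W3_def int_pow_mult)
qed

lemma W3_zero [simp]: "W3 a b c 0 = \<one>"
  by (simp add: W3_def)

lemma W3_uminus:
  assumes "a \<in> carrier G" "b \<in> carrier G" "c \<in> carrier G"
  shows "W3 a b c (- v) = inv (W3 a b c v)"
proof (rule inv_equality[symmetric])
  show "W3 a b c (- v) \<otimes> W3 a b c v = \<one>" using W3_add[OF assms, of "- v" v] by simp
qed (use assms in auto)

lemma W3_diff:
  assumes "a \<in> carrier G" "b \<in> carrier G" "c \<in> carrier G"
  shows "W3 a b c (v - w) = W3 a b c v \<otimes> inv (W3 a b c w)"
  using W3_add[OF assms, of v "- w"] unfolding W3_uminus[OF assms] by simp

lemma W3_int_pow:
  assumes "a \<in> carrier G" "b \<in> carrier G" "c \<in> carrier G"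
  shows "W3 a b c v [^] (k::int) = W3 a b c (k *s v)"
proof -
  define x y z where "x = com b c [^] (v$1)" and "y = com c a [^] (v$2)" and "z = com a b [^] (v$3)"
  have c: "x \<in> centre" "y \<in> centre" "z \<in> centre"
    using assms com_pow_centre by (auto simp: x_def y_def z_def)
  then have cc: "x \<in> carrier G" "y \<in> carrier G" "z \<in> carrier G" using centre_carrier by auto
  have "(x \<otimes> y \<otimes> z) [^] k = (x \<otimes> y) [^] k \<otimes> z [^] k"
    using cc centre_comm[OF c(3), of "x \<otimes> y"] by (intro int_pow_mult_distrib) auto
  also have "(x \<otimes> y) [^] k = x [^] k \<otimes> y [^] k"
    using cc centre_comm[OF c(1) cc(2)] by (intro int_pow_mult_distrib) auto
  finally have "(x \<otimes> y \<otimes> z) [^] k = x [^] k \<otimes> y [^] k \<otimes> z [^] k" .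
  then show ?thesis using assms
    by (simp add: W3_def x_def y_def z_def int_pow_pow mult.commute)
qed

text \<open>The factor \<open>h\<close> stays arbitrary, so the same collection serves for
  \<open>h\<close> a power of a third generator and for \<open>h\<close> in an abelian
  subgroup.\<close>

lemma triple_mult:
  assumes a: "a \<in> carrier G" and b: "b \<in> carrier G" and h: "h \<in> carrier G" "h' \<in> carrier G"
  shows "a [^] (i::int) \<otimes> b [^] (j::int) \<otimes> h \<otimes> (a [^] (k::int) \<otimes> b [^] (l::int) \<otimes> h') =
    a [^] (i + k) \<otimes> b [^] (j + l) \<otimes> (h \<otimes> h') \<otimes>
      (com h b [^] l \<otimes> com h a [^] k \<otimes> com b a [^] (j * k))"
proof -
  define A1 A2 B1 B2 where "A1 = a [^] i" and "A2 = b [^] j" and "B1 = a [^] k" and "B2 = b [^] l"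
  define Q Y U where "Q = com h a [^] k" and "Y = com h b [^] l" and "U = com b a [^] (j * k)"
  note ABd = A1_def A2_def B1_def B2_def
  have AB: "A1 \<in> carrier G" "A2 \<in> carrier G" "B1 \<in> carrier G" "B2 \<in> carrier G"
    using a b by (auto simp: ABd)
  have Z: "Q \<in> centre" "Y \<in> centre" "U \<in> centre"
    using a b h com_pow_centre by (auto simp: Q_def Y_def U_def)
  then have Zc: "Q \<in> carrier G" "Y \<in> carrier G" "U \<in> carrier G" using centre_carrier by auto
  have s: "h \<otimes> B1 = Q \<otimes> (B1 \<otimes> h)" "h \<otimes> B2 = Y \<otimes> (B2 \<otimes> h)" "A2 \<otimes> B1 = U \<otimes> (B1 \<otimes> A2)"
    unfolding ABd Q_def Y_def U_def
    using a b h(1) int_pow_swap[of h a 1 k] int_pow_swap[of h b 1 l] int_pow_swap[of b a j k]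
    by simp_all
  have "A1 \<otimes> A2 \<otimes> h \<otimes> (B1 \<otimes> B2 \<otimes> h') = A1 \<otimes> (A2 \<otimes> ((h \<otimes> B1) \<otimes> (B2 \<otimes> h')))"
    using AB h by (simp add: m_assoc)
  also have "\<dots> = Q \<otimes> (A1 \<otimes> ((A2 \<otimes> B1) \<otimes> ((h \<otimes> B2) \<otimes> h')))"
    unfolding s(1) using AB Zc h by (simp add: m_assoc centre_pull[OF Z(1)])
  also have "\<dots> = Q \<otimes> (U \<otimes> (A1 \<otimes> ((B1 \<otimes> A2) \<otimes> ((h \<otimes> B2) \<otimes> h'))))"
    unfolding s(3) using AB Zc h by (simp add: m_assoc centre_pull[OF Z(3)])
  also have "\<dots> = Q \<otimes> (U \<otimes> (Y \<otimes> (A1 \<otimes> (B1 \<otimes> (A2 \<otimes> (B2 \<otimes> (h \<otimes> h')))))))"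
    unfolding s(2) using AB Zc h by (simp add: m_assoc centre_pull[OF Z(2)])
  also have "\<dots> = (Q \<otimes> U \<otimes> Y) \<otimes> (A1 \<otimes> B1 \<otimes> (A2 \<otimes> B2) \<otimes> (h \<otimes> h'))"
    using AB Zc h by (simp add: m_assoc)
  also have "\<dots> = (A1 \<otimes> B1 \<otimes> (A2 \<otimes> B2) \<otimes> (h \<otimes> h')) \<otimes> (Q \<otimes> U \<otimes> Y)"
    using AB Z h by (intro centre_comm) (auto intro!: subgroup.m_closed[OF subgroup_centre])
  also have "Q \<otimes> U \<otimes> Y = Y \<otimes> Q \<otimes> U"
    using Zc centre_comm[OF Z(2), of "Q \<otimes> U"] by (simp add: m_assoc)
  also have "A1 \<otimes> B1 = a [^] (i + k)" using a by (simp add: ABd int_pow_mult)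
  also have "A2 \<otimes> B2 = b [^] (j + l)" using b by (simp add: ABd int_pow_mult)
  finally show ?thesis unfolding ABd Q_def Y_def U_def .
qed

lemma E3_mult:
  assumes a: "a \<in> carrier G" and b: "b \<in> carrier G" and c: "c \<in> carrier G"
  shows "E3 a b c v \<otimes> E3 a b c w = E3 a b c (v + w) \<otimes> W3 a b c (kap v w)"
proof -
  have "com (c [^] (v$3)) b [^] (w$2) \<otimes> com (c [^] (v$3)) a [^] (w$1) \<otimes> com b a [^] (v$2 * w$1)
      = W3 a b c (kap v w)"
    using a b c by (simp add: W3_def kap_def com_swap[of b c] com_swap[of a b] com_int_pow_left
        int_pow_pow int_pow_inv int_pow_neg)
  then show ?thesis
    using triple_mult[OF a b, of "c [^] (v$3)" "c [^] (w$3)" "v$1" "v$2" "w$1" "w$2"] c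
    by (simp add: E3_def int_pow_mult)
qed

lemma com_E3:
  assumes "a \<in> carrier G" "b \<in> carrier G" "c \<in> carrier G"
  shows "com (E3 a b c v) (E3 a b c w) = W3 a b c (cross3i v w)"
proof (rule com_eqI)
  \<comment> \<open>The cross product is the antisymmetric part of \<open>kap\<close>: the products
    in the two orders share the factor \<open>E3 a b c (v + w)\<close>.\<close>
  have k: "kap v w = cross3i v w + kap w v"
    by (simp add: vec_eq_iff forall_3 kap_def cross3i_def)
  have "E3 a b c v \<otimes> E3 a b c w = E3 a b c (v + w) \<otimes> (W3 a b c (cross3i v w) \<otimes> W3 a b c (kap w v))"
    using assms by (simp add: E3_mult W3_add k)
  also have "\<dots> = W3 a b c (cross3i v w) \<otimes> (E3 a b c (v + w) \<otimes> W3 a b c (kap w v))"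
    using assms by (intro centre_pull W3_centre) auto
  also have "\<dots> = W3 a b c (cross3i v w) \<otimes> (E3 a b c w \<otimes> E3 a b c v)"
    using assms by (simp add: E3_mult[of a b c w v] add.commute)
  finally show "E3 a b c v \<otimes> E3 a b c w = W3 a b c (cross3i v w) \<otimes> (E3 a b c w \<otimes> E3 a b c v)" .
qed (use assms in auto)

end

text \<open>The family left over both when the power map is a homomorphism and among the 2-groups
  with derived subgroup of order 8. Through \<open>omega\<close> the \<open>p\<close>-th power map
  has no nontrivial zero modulo the centre.\<close>

locale special_group = class2_pE_group +
  fixes a b c :: 'a
  assumes abc: "a \<in> carrier G" "b \<in> carrier G" "c \<in> carrier G"
    and span: "span3 a b c = carrier G"
    and D_eq: "D = centre"
    and card_Z: "card centre = p ^ 3"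
    and pow_p: "\<And>x. x \<in> carrier G \<Longrightarrow> x [^] p \<in> centre"
    and omega: "\<And>x. \<lbrakk>x \<in> carrier G; x [^] p = \<one>\<rbrakk> \<Longrightarrow> x \<in> centre"
begin

abbreviation "E \<equiv> E3 a b c"
abbreviation "W \<equiv> W3 a b c"

lemma prime_elem_p: "prime_elem (int p)"
  using p_prime by simp

lemma com_pow_p: "\<lbrakk>x \<in> carrier G; y \<in> carrier G\<rbrakk> \<Longrightarrow> com x y [^] p = \<one>"
  using com_nat_pow_left[of x y p] centre_com[OF pow_p] by simp

lemma W3_dvd:
  assumes "x \<in> carrier G" "y \<in> carrier G" "z \<in> carrier G" "dvd_vec (int p) v"
  shows "W3 x y z v = \<one>"
proof -
  have *: "com x y [^] i = \<one>" if xy: "x \<in> carrier G" "y \<in> carrier G" "int p dvd i" for x y i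
  proof -
    obtain k where "i = int p * k" using xy(3) by (auto simp: dvd_def)
    then have "com x y [^] i = (com x y [^] p) [^] k"
      using xy int_pow_pow[of "com x y" "int p" k] by (simp add: int_pow_int)
    then show ?thesis using com_pow_p xy by simp
  qed
  show ?thesis using assms by (simp add: W3_def * dvd_vec_def)
qed

lemma centre_range: "centre = range W"
proof
  show "range W \<subseteq> centre" using W3_centre abc by auto
  have "subgroup (range W) G"
  proof (rule subgroupI)
    fix x y assume "x \<in> range W" "y \<in> range W"
    then obtain v w where "x = W v" "y = W w" by blast
    then have "x \<otimes> y = W (v + w)" using W3_add[OF abc] by simp
    then show "x \<otimes> y \<in> range W" by blast
  next
    fix x assume "x \<in> range W"
    then obtain v where "x = W v" by blast
    then have "inv x = W (- v)" using W3_uminus[OF abc] by simp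
    then show "inv x \<in> range W" by blast
  qed (use abc in auto)
  moreover have "com a b \<in> range W" "com a c \<in> range W" "com b c \<in> range W"
  proof -
    show "com a b \<in> range W" using abc by (intro range_eqI[of _ _ "vec3 0 0 1"]) (simp add: W3_def)
    show "com b c \<in> range W" using abc by (intro range_eqI[of _ _ "vec3 1 0 0"]) (simp add: W3_def)
    show "com a c \<in> range W" using abc com_swap[OF abc(3,1)]
      by (intro range_eqI[of _ _ "vec3 0 (-1) 0"]) (simp add: W3_def int_pow_neg)
  qed
  ultimately show "centre \<subseteq> range W"
    using derived_span3[OF abc span] D_eq by blast
qed

text \<open>\<open>W\<close> depends only on residues modulo \<open>p\<close>, and the p^3 residue
  vectors cover a centre of order p^3, so by pigeonhole it is injective on them: the three
  commutators are a basis of \<open>Z\<close> over the field with \<open>p\<close> elements.\<close>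

lemma W_eq_one: 
  assumes "W v = \<one>"
  shows "dvd_vec (int p) v"
proof -
  define B where "B = (\<lambda>(i, j, k). vec3 i j k) ` ({0..<int p} \<times> {0..<int p} \<times> {0..<int p})"
  define r where "r v = vec3 (v$1 mod int p) (v$2 mod int p) (v$3 mod int p)" for v :: "int ^ 3"
  have p0: "int p > 0" using p_prime prime_gt_0_nat by simp
  have W_r: "W (r v) = W v" for v
  proof -
    have "dvd_vec (int p) (v - r v)" by (simp add: dvd_vec_def forall_3 r_def)
    then have "W (v - r v) = \<one>" using W3_dvd abc by blast
    then have "W v = \<one> \<otimes> W (r v)" using W3_add[OF abc, of "v - r v" "r v"] by simp
    then show ?thesis using abc by simp
  qed
  have rB: "r v \<in> B" for v using p0 unfolding B_def r_def by (intro image_eqI[of _ _ "(v$1 mod int p, v$2 mod int p, v$3 mod int p)"]) auto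
  have cB: "card B \<le> p ^ 3"
  proof -
    have "card B \<le> card ({0..<int p} \<times> {0..<int p} \<times> {0..<int p})" unfolding B_def by (rule card_image_le) simp
    then show ?thesis by (simp add: card_cartesian_product eval_nat_numeral)
  qed
  have fB: "finite B" by (simp add: B_def)
  have "W ` B = centre"
    unfolding centre_range
  proof
    show "range W \<subseteq> W ` B"
    proof
      fix x assume "x \<in> range W"
      then obtain v where "x = W (r v)" using W_r by auto
      then show "x \<in> W ` B" using rB by blast
    qed
  qed blast
  then have "card B \<le> card (W ` B)" using cB card_Z by simp
  then have inj: "inj_on W B" using fB card_image_le[OF fB, of W] by (intro eq_card_imp_inj_on) auto
  have "W (r v) = W (r 0)" using assms W_r by simp
  then have "r v = r 0" using inj rB by (auto dest: inj_onD)
  then show ?thesis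
    by (simp add: r_def vec_eq_iff forall_3 dvd_vec_def dvd_eq_mod_eq_0)
qed

lemma W_eq:
  assumes "W v = W w"
  shows "dvd_vec (int p) (v - w)"
proof (rule W_eq_one)
  show "W (v - w) = \<one>" using assms abc by (simp add: W3_diff)
qed

lemma E_central:
  assumes "\<And>u. W (cross3i v u) = \<one>"
  shows "dvd_vec (int p) v"
proof -
  have "dvd_vec (int p) (cross3i v u)" for u using W_eq_one assms by blast
  from this[of "vec3 1 0 0"] this[of "vec3 0 1 0"] show ?thesis
    by (simp add: dvd_vec_def forall_3 cross3i_def)
qed

lemma E_in_centre: 
  assumes "E v \<in> centre"
  shows "dvd_vec (int p) v"
proof (rule E_central)
  show "W (cross3i v u) = \<one>" for u
    using centre_com[OF assms, of "E u"] com_E3[OF abc] abc by simp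
qed

lemma E_W_onto:
  assumes "g \<in> carrier G"
  shows "\<exists>v y. g = E v \<otimes> W y"
proof -
  have "g \<in> span3 a b c" using assms span by simp
  then obtain z i j k where z: "z \<in> centre" "g = z \<otimes> a [^] (i::int) \<otimes> b [^] (j::int) \<otimes> c [^] (k::int)"
    by (auto simp: adjoin_def)
  then have "g = E (vec3 i j k) \<otimes> z"
    using abc centre_carrier[OF z(1)] centre_comm[OF z(1), of "E (vec3 i j k)"] by (simp add: E3_def m_assoc)
  moreover obtain y where "z = W y" using z centre_range by blast
  ultimately show ?thesis by blast
qed

lemma E3_p_multiple:
  fixes N :: "int ^ 3 ^ 3"
  assumes "x \<in> carrier G" "y \<in> carrier G" "z \<in> carrier G"
    and "x [^] p = W3 x y z (column 1 N)" "y [^] p = W3 x y z (column 2 N)" "z [^] p = W3 x y z (column 3 N)"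
  shows "E3 x y z (int p *s u) = W3 x y z (N *v u)"
proof -
  have "t [^] (int p * i) = (t [^] p) [^] i" if "t \<in> carrier G" for t i
    using int_pow_pow[OF that, of "int p" i] by (simp add: int_pow_int)
  then have "E3 x y z (int p *s u) = W3 x y z (u$1 *s column 1 N + u$2 *s column 2 N + u$3 *s column 3 N)"
    using assms by (simp add: E3_def W3_int_pow W3_add)
  also have "u$1 *s column 1 N + u$2 *s column 2 N + u$3 *s column 3 N = N *v u"
    by (simp add: vec_eq_iff column_def matrix_vector_mult_def sum_3 mult.commute)
  finally show ?thesis .
qed

text \<open>The class 2 laws and the relations expressing \<open>a [^] p\<close>, \<open>b [^] p\<close>, \<open>c [^] p\<close> by the columns of
  \<open>N\<close> present \<open>G\<close>, so every triple satisfying the same relations is the image of \<open>(a, b, c)\<close>.\<close>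

lemma hom_of_triple:
  fixes N :: "int ^ 3 ^ 3"
  assumes x: "x \<in> carrier G" "y \<in> carrier G" "z \<in> carrier G"
    and N: "a [^] p = W (column 1 N)" "b [^] p = W (column 2 N)" "c [^] p = W (column 3 N)"
    and N': "x [^] p = W3 x y z (column 1 N)" "y [^] p = W3 x y z (column 2 N)" "z [^] p = W3 x y z (column 3 N)"
  obtains \<alpha> where "\<alpha> \<in> hom G G" "\<And>v. \<alpha> (E v) = E3 x y z v"
proof -
  \<comment> \<open>Here \<open>a\<close>, \<open>b\<close>, \<open>c\<close> are bound locally, so
    that the rule applies to the generators and to their images alike.\<close>
  have shift: "E3 a b c (w + int p *s u) = E3 a b c w \<otimes> W3 a b c (N *v u)"
    if t: "a \<in> carrier G" "b \<in> carrier G" "c \<in> carrier G" and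
      "a [^] p = W3 a b c (column 1 N)" "b [^] p = W3 a b c (column 2 N)" "c [^] p = W3 a b c (column 3 N)"
    for a b c u w
  proof -
    have "W3 a b c (kap w (int p *s u)) = \<one>"
      by (rule W3_dvd[OF t]) (simp add: dvd_vec_def forall_3 kap_def)
    then have "E3 a b c (w + int p *s u) = E3 a b c w \<otimes> E3 a b c (int p *s u)"
      using E3_mult[OF t, of w "int p *s u"] t by simp
    then show ?thesis using E3_p_multiple that by simp
  qed
  let ?\<Phi> = "\<lambda>(v, y). E v \<otimes> W y" and ?\<Psi> = "\<lambda>(v, u). E3 x y z v \<otimes> W3 x y z u"
  have mult: "E3 a b c (v + v') \<otimes> W3 a b c (u + u' + kap v v')
      = E3 a b c v \<otimes> W3 a b c u \<otimes> (E3 a b c v' \<otimes> W3 a b c u')"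
    if t: "a \<in> carrier G" "b \<in> carrier G" "c \<in> carrier G" for a b c v v' u u'
  proof -
    have "E3 a b c v \<otimes> W3 a b c u \<otimes> (E3 a b c v' \<otimes> W3 a b c u')
        = E3 a b c v \<otimes> (W3 a b c u \<otimes> (E3 a b c v' \<otimes> W3 a b c u'))" using t by (simp add: m_assoc)
    also have "\<dots> = E3 a b c v \<otimes> (E3 a b c v' \<otimes> (W3 a b c u \<otimes> W3 a b c u'))"
      using t centre_pull[OF W3_centre[OF t], of "E3 a b c v'" "W3 a b c u'" u] by simp
    also have "\<dots> = (E3 a b c v \<otimes> E3 a b c v') \<otimes> W3 a b c (u + u')" using t by (simp add: m_assoc W3_add)
    also have "\<dots> = E3 a b c (v + v') \<otimes> (W3 a b c (kap v v') \<otimes> W3 a b c (u + u'))"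
      using t by (simp add: E3_mult m_assoc)
    finally show ?thesis using t by (simp add: add.commute flip: W3_add)
  qed
  have "\<exists>\<alpha>\<in>hom G G. \<forall>i\<in>UNIV. ?\<Phi> i \<in> carrier G \<longrightarrow> \<alpha> (?\<Phi> i) = ?\<Psi> i"
  proof (rule hom_of_transport)
    fix g assume "g \<in> carrier G"
    then show "\<exists>i\<in>UNIV. ?\<Phi> i = g" using E_W_onto[of g] by force
  next
    fix i j :: "(int ^ 3) \<times> (int ^ 3)"
    obtain v u v' u' where ij: "i = (v, u)" "j = (v', u')" by (cases i, cases j)
    show "\<exists>k\<in>UNIV. ?\<Phi> k = ?\<Phi> i \<otimes> ?\<Phi> j \<and> ?\<Psi> k = ?\<Psi> i \<otimes> ?\<Psi> j"
      unfolding ij using mult[OF abc] mult[OF x]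
      by (intro bexI[of _ "(v + v', u + u' + kap v v')"]) auto
    show "?\<Psi> i \<in> carrier G" using x by (simp add: ij)
    assume "?\<Phi> i = ?\<Phi> j"
    then have eq: "E v \<otimes> W u = E v' \<otimes> W u'" by (simp add: ij)
    \<comment> \<open>Two descriptions of one element differ by \<open>p\<close> times a vector
      \<open>q\<close> in the exponents, compensated by \<open>N *v q\<close> in the central part;
      the images \<open>x\<close>, \<open>y\<close>, \<open>z\<close> allow the same
      compensation.\<close>
    have "dvd_vec (int p) (v - v')"
    proof (rule E_central)
      fix t
      have "com (E w \<otimes> W s) (E t) = W (cross3i w t)" for w s
        using abc com_mult_left[of "E w" "W s" "E t"] com_E3[OF abc] centre_com[OF W3_centre[OF abc]]
        by simp
      then have "W (cross3i v t) = W (cross3i v' t)" using eq by metis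
      moreover have "cross3i (v - v') t = cross3i v t - cross3i v' t"
        by (simp add: vec_eq_iff forall_3 cross3i_def algebra_simps)
      ultimately show "W (cross3i (v - v') t) = \<one>" using abc by (simp add: W3_diff)
    qed
    then have "\<forall>i. \<exists>k. (v - v') $ i = int p * k" by (simp add: dvd_vec_def dvd_def)
    then obtain f where "\<forall>i. (v - v') $ i = int p * f i" by metis
    then have v: "v = v' + int p *s (\<chi> i. f i)" by (simp add: vec_eq_iff algebra_simps)
    define q where "q = (\<chi> i. f i)"
    have "E v' \<otimes> W (N *v q + u) = E v' \<otimes> W u'"
      using eq shift[OF abc N, of v' q] abc unfolding v q_def[symmetric] by (simp add: W3_add m_assoc)
    then have "W (N *v q + u) = W u'" using abc by simp
    then have "dvd_vec (int p) (N *v q + u - u')" by (rule W_eq)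
    then have "W3 x y z (N *v q + u - u') = \<one>" by (rule W3_dvd[OF x])
    then have "W3 x y z (N *v q + u) = W3 x y z u'"
      using x by (simp add: W3_diff) (metis W3_closed inv_closed inv_equality inv_inv l_inv r_cancel)
    then have "E3 x y z v' \<otimes> W3 x y z (N *v q) \<otimes> W3 x y z u = E3 x y z v' \<otimes> W3 x y z u'"
      using x by (simp add: W3_add m_assoc)
    then show "?\<Psi> i = ?\<Psi> j"
      using shift[OF x N', of v' q] unfolding ij v q_def[symmetric] by simp
  qed
  then obtain \<alpha> where \<alpha>: "\<alpha> \<in> hom G G" "\<forall>i\<in>UNIV. ?\<Phi> i \<in> carrier G \<longrightarrow> \<alpha> (?\<Phi> i) = ?\<Psi> i" by blast
  have "\<alpha> (E v) = E3 x y z v" for v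
    using \<alpha>(2)[rule_format, of "(v, 0)"] abc x by simp
  then show thesis using that \<alpha> by blast
qed

text \<open>Commutators of the columns of \<open>T\<close> transform by \<open>cofactor3 T\<close>,
  so the assumption is exactly the relation required by \<open>hom_of_triple\<close>. The resulting
  endomorphism acts as \<open>T\<close> modulo the centre, and since \<open>E v\<close> commutes
  with its image, the cross product vanishes.\<close>

lemma cross3i_dvd_if_matrix:
  fixes N :: "int ^ 3 ^ 3"
  assumes N: "a [^] p = W (column 1 N)" "b [^] p = W (column 2 N)" "c [^] p = W (column 3 N)"
    and T: "\<And>i. E (column i T) [^] p = W (cofactor3 T *v column i N)"
  shows "dvd_vec (int p) (cross3i v (T *v v))"
proof -
  let ?x = "E (column 1 T)" and ?y = "E (column 2 T)" and ?z = "E (column 3 T)"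
  have xyz: "?x \<in> carrier G" "?y \<in> carrier G" "?z \<in> carrier G" using abc by auto
  have W': "W3 ?x ?y ?z u = W (cofactor3 T *v u)" for u
  proof -
    have "W3 ?x ?y ?z u = W (u$1 *s cross3i (column 2 T) (column 3 T) + u$2 *s cross3i (column 3 T) (column 1 T)
        + u$3 *s cross3i (column 1 T) (column 2 T))"
      unfolding W3_def[of ?x] com_E3[OF abc] using abc by (simp add: W3_int_pow W3_add)
    also have "u$1 *s cross3i (column 2 T) (column 3 T) + u$2 *s cross3i (column 3 T) (column 1 T)
        + u$3 *s cross3i (column 1 T) (column 2 T) = cofactor3 T *v u"
      by (simp add: vec_eq_iff forall_3 matrix_vector_mult_def sum_3 cofactor3_nth cross3i_def column_def)
    finally show ?thesis .
  qed
  obtain \<alpha> where \<alpha>: "\<alpha> \<in> hom G G" "\<And>v. \<alpha> (E v) = E3 ?x ?y ?z v"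
    using hom_of_triple[OF xyz N] T unfolding W' by blast
  have "com (E v) (E3 ?x ?y ?z v) = \<one>"
    using commutes_with_endo_image[OF \<alpha>(1), of "E v"] abc xyz \<alpha>(2) by (simp add: com_eq_one_iff)
  moreover have "com (E v) (E3 ?x ?y ?z v) = W (cross3i v (T *v v))"
  proof -
    have "com (E v) (E3 ?x ?y ?z v) = com (E v) ?x [^] (v$1) \<otimes> com (E v) ?y [^] (v$2) \<otimes> com (E v) ?z [^] (v$3)"
      unfolding E3_def[of ?x] using abc by (simp add: com_mult_right com_int_pow_right)
    also have "\<dots> = W (v$1 *s cross3i v (column 1 T) + v$2 *s cross3i v (column 2 T) + v$3 *s cross3i v (column 3 T))"
      unfolding com_E3[OF abc] using abc by (simp add: W3_int_pow W3_add)
    also have "v$1 *s cross3i v (column 1 T) + v$2 *s cross3i v (column 2 T) + v$3 *s cross3i v (column 3 T)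
        = cross3i v (T *v v)"
      by (simp add: vec_eq_iff forall_3 matrix_vector_mult_def sum_3 cross3i_def column_def)
         (simp add: algebra_simps)
    finally show ?thesis .
  qed
  ultimately show ?thesis using W_eq_one by simp
qed

text \<open>In coordinates the \<open>p\<close>-th power map is \<open>N *v v\<close>, or
  \<open>N *v v + polar v\<close> for \<open>p = 2\<close>. By \<open>omega\<close> it vanishes
  modulo \<open>p\<close> only for \<open>v\<close> divisible by \<open>p\<close>, which is the
  hypothesis of the matrix lemmas.\<close>

lemma no_special_group: False
proof -
  have ex: "\<exists>n. x [^] p = W n" if "x \<in> carrier G" for x using pow_p[OF that] centre_range by blast
  obtain n1 n2 n3 where n: "a [^] p = W n1" "b [^] p = W n2" "c [^] p = W n3"
    using ex[OF abc(1)] ex[OF abc(2)] ex[OF abc(3)] by auto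
  define N where "N = columns3 n1 n2 n3"
  have "column 1 N = n1" "column 2 N = n2" "column 3 N = n3"
    by (simp_all add: N_def column_def vec_eq_iff)
  then have N: "a [^] p = W (column 1 N)" "b [^] p = W (column 2 N)" "c [^] p = W (column 3 N)"
    using n by simp_all
  have powW: "a [^] (int p * v$1) \<otimes> b [^] (int p * v$2) \<otimes> c [^] (int p * v$3) = W (N *v v)" for v
    using E3_p_multiple[OF abc N, of v] by (simp add: E3_def)
  show False
  proof (cases "p = 2")
    case True
    have sq: "E v [^] p = W (N *v v + polar v)" for v
    proof -
      have "E v [^] p = E v \<otimes> E v" using abc unfolding True by (simp add: numeral_2_eq_2)
      also have "\<dots> = E (v + v) \<otimes> W (kap v v)" by (rule E3_mult[OF abc])
      also have "E (v + v) = W (N *v v)"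
        using powW[of v] unfolding True E3_def by simp
      also have "W (kap v v) = W (polar v)"
      proof -
        \<comment> \<open>The two differ by signs only, which are invisible modulo 2.\<close>
        have "dvd_vec (int p) (kap v v - polar v)"
          unfolding True by (simp add: dvd_vec_def forall_3 kap_def polar_def mult.commute)
        then have "W (kap v v - polar v) = \<one>" by (rule W3_dvd[OF abc])
        moreover have "W (kap v v) = W (kap v v - polar v) \<otimes> W (polar v)"
          using W3_add[OF abc, of "kap v v - polar v" "polar v"] by simp
        ultimately show ?thesis using abc by simp
      qed
      finally show ?thesis using abc by (simp add: W3_add)
    qed
    have "dvd_vec 2 v" if "dvd_vec 2 (N *v v + polar v)" for v
    proof -
      have "E v [^] p = \<one>" unfolding sq using W3_dvd[OF abc] that True by simp
      then show ?thesis using E_in_centre omega abc True by simp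
    qed
    then obtain T x where T: "\<And>i. dvd_vec 2 (cofactor3 T *v column i N - (N *v column i T + polar (column i T)))"
      "\<not> dvd_vec 2 (cross3i x (T *v x))" using mod2_matrix[of N] by blast
    have "E (column i T) [^] p = W (cofactor3 T *v column i N)" for i
    proof -
      have "W (cofactor3 T *v column i N - (N *v column i T + polar (column i T))) = \<one>"
        using W3_dvd[OF abc] T(1) True by simp
      moreover have "W (cofactor3 T *v column i N) = W (cofactor3 T *v column i N - (N *v column i T + polar (column i T)))
          \<otimes> W (N *v column i T + polar (column i T))"
        by (subst W3_add[OF abc, symmetric]) simp
      ultimately show ?thesis unfolding sq using abc by simp
    qed
    from cross3i_dvd_if_matrix[OF N this, of x] show False using T(2) True by simp
  next
    case False
    then have "odd p" using p_prime primes_dvd_imp_eq two_is_prime_nat by metis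
    have ndvd: "\<not> int p dvd 2"
    proof
      assume "int p dvd 2"
      then have "p dvd 2" by presburger
      then show False using False p_prime primes_dvd_imp_eq two_is_prime_nat by metis
    qed
    have tri: "com x y [^] (p * (p - 1) div 2) = \<one>" if "x \<in> carrier G" "y \<in> carrier G" for x y
    proof -
      obtain m where "p = 2 * m + 1" using \<open>odd p\<close> by (elim oddE)
      then have "p * (p - 1) div 2 = p * m" by simp
      then show ?thesis using com_pow_p[OF that] that by (simp flip: nat_pow_pow)
    qed
    have pw: "E v [^] p = W (N *v v)" for v
    proof -
      have "(t [^] i) [^] p = t [^] (int p * i)" if "t \<in> carrier G" for t and i :: int
        using int_pow_pow[OF that, of i "int p"] by (simp add: int_pow_int mult.commute)
      then have "E v [^] p = a [^] (int p * v$1) \<otimes> b [^] (int p * v$2) \<otimes> c [^] (int p * v$3)"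
        using abc by (simp add: E3_def nat_pow_mult_class2 tri[unfolded One_nat_def])
      then show ?thesis using powW by simp
    qed
    have "dvd_vec (int p) v" if "dvd_vec (int p) (N *v v)" for v
    proof -
      have "E v [^] p = \<one>" unfolding pw using W3_dvd[OF abc] that by simp
      then show ?thesis using E_in_centre omega abc by simp
    qed
    then obtain T x where T: "\<And>i. dvd_vec (int p) (cofactor3 T *v column i N - N *v column i T)"
      "\<not> dvd_vec (int p) (cross3i x (T *v x))"
      using odd_prime_matrix[OF prime_elem_p ndvd, of N] by blast
    have "E (column i T) [^] p = W (cofactor3 T *v column i N)" for i
    proof -
      have "W (cofactor3 T *v column i N - N *v column i T) = \<one>"
        using W3_dvd[OF abc] T(1) by simp
      moreover have "W (cofactor3 T *v column i N) = W (cofactor3 T *v column i N - N *v column i T)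
          \<otimes> W (N *v column i T)"
        by (subst W3_add[OF abc, symmetric]) simp
      ultimately show ?thesis unfolding pw using abc by simp
    qed
    from cross3i_dvd_if_matrix[OF N this, of x] show False using T(2) by simp
  qed
qed

end

section \<open>The case \<open>p = 2\<close>\<close>

text \<open>The case \<open>n = 2\<close>: \<open>G / D\<close> has exponent 2 and involutions are
  central.\<close>

locale two_group = class2_pE_group +
  assumes p_two: "p = 2"
    and square: "\<And>x. x \<in> carrier G \<Longrightarrow> x \<otimes> x \<in> D"
    and involution: "\<And>x. \<lbrakk>x \<in> carrier G; x \<otimes> x = \<one>\<rbrakk> \<Longrightarrow> x \<in> centre"
begin

lemma derived_carrier: "d \<in> D \<Longrightarrow> d \<in> carrier G"
  using derived_centre centre_carrier by blast

lemma square_centre: "x \<in> carrier G \<Longrightarrow> x \<otimes> x \<in> centre"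
  using square derived_centre by blast

text \<open>The square of \<open>com x y\<close> is \<open>com (x \<otimes> x) y\<close>, trivial
  because squares are central. So \<open>D\<close> is elementary abelian and signs of commutators
  disappear.\<close>

lemma derived_square:
  assumes "d \<in> D"
  shows "d \<otimes> d = \<one>"
proof -
  let ?R = "{z \<in> centre. z \<otimes> z = \<one>}"
  have "subgroup ?R G"
  proof (rule subgroupI)
    fix x y assume xy: "x \<in> ?R" "y \<in> ?R"
    then have "x \<in> carrier G" "y \<in> carrier G" using centre_carrier by auto
    then have "x \<otimes> y \<otimes> (x \<otimes> y) = (x \<otimes> x) \<otimes> (y \<otimes> y)"
      using xy centre_pull[of x y y] by (simp add: m_assoc)
    then show "x \<otimes> y \<in> ?R" using xy by (simp add: subgroup.m_closed[OF subgroup_centre])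
  next
    fix x assume x: "x \<in> ?R"
    then have "inv x \<otimes> inv x = \<one>" using centre_carrier by (simp flip: inv_mult_group)
    then show "inv x \<in> ?R" using x by (simp add: subgroup.m_inv_closed[OF subgroup_centre])
  qed (use centre_carrier subgroup.one_closed[OF subgroup_centre] in auto)
  moreover have "com x y \<in> ?R" if "x \<in> carrier G" "y \<in> carrier G" for x y
    using that com_mult_left[of x x y] centre_com[OF square_centre] com_centre by simp
  ultimately show ?thesis using derived_least assms by blast
qed

lemma com_square: "\<lbrakk>x \<in> carrier G; y \<in> carrier G\<rbrakk> \<Longrightarrow> com x y \<otimes> com x y = \<one>"
  using derived_square com_derived by blast

lemma com_sym: "\<lbrakk>x \<in> carrier G; y \<in> carrier G\<rbrakk> \<Longrightarrow> com y x = com x y"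
  using com_square[of x y] com_swap[of x y] by (simp add: inv_equality)

lemma square_mult:
  assumes "x \<in> carrier G" "y \<in> carrier G"
  shows "x \<otimes> y \<otimes> (x \<otimes> y) = x \<otimes> x \<otimes> (y \<otimes> y) \<otimes> com x y"
  using assms nat_pow_mult_class2[of x y 2] com_sym[of x y] by (simp add: numeral_2_eq_2)

lemma central_mult_eq_one:
  assumes "x \<in> carrier G" "x \<otimes> x = \<one>" "y \<in> carrier G" "x \<otimes> y = \<one>"
  shows "y = x"
  using assms by (metis l_cancel)

lemma square_com: \<comment> \<open>otherwise multiplying the elements outside \<open>cent v\<close> by \<open>v\<close> is an automorphism\<close>
  assumes v: "v \<in> carrier G" "v \<notin> centre"
  shows "\<exists>g\<in>carrier G. com g v \<noteq> \<one> \<and> com g v \<noteq> v \<otimes> v"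
proof (rule ccontr)
  assume "\<not> ?thesis"
  then have cv: "com g v = \<one> \<or> com g v = v \<otimes> v" if "g \<in> carrier G" for g using that by blast
  have vv: "v \<otimes> v \<in> carrier G" "(v \<otimes> v) \<otimes> (v \<otimes> v) = \<one>"
    using v derived_square[OF square[OF v(1)]] by auto
  define \<alpha> where "\<alpha> x = (if com x v = \<one> then x else x \<otimes> v)" for x
  have "\<alpha> \<in> hom G G"
  proof (rule homI)
    fix x y assume xy: "x \<in> carrier G" "y \<in> carrier G"
    have m: "com (x \<otimes> y) v = com x v \<otimes> com y v" using xy v by (simp add: com_mult_left)
    have yv: "y \<otimes> v = com y v \<otimes> (v \<otimes> y)" by (rule com_mult_swap) (use xy v in auto)
    show "\<alpha> (x \<otimes> y) = \<alpha> x \<otimes> \<alpha> y"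
    proof (cases "com y v = \<one>")
      case True
      then have "y \<otimes> v = v \<otimes> y" using yv v xy by simp
      then show ?thesis using True m xy v by (simp add: \<alpha>_def m_assoc)
    next
      case y: False
      then have cy: "com y v = v \<otimes> v" using cv xy by blast
      show ?thesis
      proof (cases "com x v = \<one>")
        case True
        then show ?thesis using y m xy v by (simp add: \<alpha>_def m_assoc)
      next
        case False
        then have "com x v = v \<otimes> v" using cv xy by blast
        then have "\<alpha> (x \<otimes> y) = x \<otimes> y" using m cy vv by (simp add: \<alpha>_def)
        moreover have "x \<otimes> v \<otimes> (y \<otimes> v) = x \<otimes> y"
        proof -
          \<comment> \<open>\<open>v\<close> has order 4, so the factor \<open>v \<otimes> v\<close>
            of \<open>com y v\<close> cancels the two copies of \<open>v\<close>.\<close>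
          have "v \<otimes> (y \<otimes> v) = v \<otimes> ((v \<otimes> v) \<otimes> (v \<otimes> y))" using yv cy by simp
          also have "\<dots> = (v \<otimes> v) \<otimes> (v \<otimes> v) \<otimes> y" using v xy by (simp add: m_assoc)
          finally show ?thesis using vv xy v by (simp add: m_assoc)
        qed
        ultimately show ?thesis using y False by (simp add: \<alpha>_def)
      qed
    qed
  qed (use v in \<open>auto simp: \<alpha>_def\<close>)
  moreover obtain g where g: "g \<in> carrier G" "com v g \<noteq> \<one>" using noncentral_com v by blast
  ultimately have "g \<otimes> \<alpha> g = \<alpha> g \<otimes> g" using commutes_with_endo_image by blast
  moreover have "\<alpha> g = g \<otimes> v" using g v com_sym by (simp add: \<alpha>_def)
  ultimately have "com g (g \<otimes> v) = \<one>" using g v by (simp add: com_eq_one_iff)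
  then show False using g v com_sym by (simp add: com_mult_right)
qed

lemma square_neq_one: "\<lbrakk>x \<in> carrier G; x \<notin> centre\<rbrakk> \<Longrightarrow> x \<otimes> x \<noteq> \<one>"
  using involution by blast

lemma pow_cases:
  assumes "t \<in> carrier G"
  obtains s where "s \<in> centre" "t [^] (i::int) = s \<or> t [^] i = s \<otimes> t"
proof -
  have tt: "t [^] (2 * k) \<in> centre" for k :: int
  proof -
    have "t [^] (2::int) = t \<otimes> t" using assms int_pow_mult[of t 1 1] by simp
    then have "t [^] (2 * k) = (t \<otimes> t) [^] k" using assms by (simp flip: int_pow_pow)
    then show ?thesis using square_centre[OF assms] subgroup_int_pow_closed[OF subgroup_centre] by simp
  qed
  show thesis
  proof (cases "even i")
    case True
    then show thesis using tt that by (metis evenE)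
  next
    case False
    then obtain k where "i = 2 * k + 1" by (elim oddE)
    then have "t [^] i = t [^] (2 * k) \<otimes> t" using assms by (simp add: int_pow_mult)
    then show thesis using tt that by blast
  qed
qed

lemma adjoin_cases:
  assumes H: "subgroup H G" "centre \<subseteq> H" and t: "t \<in> carrier G" and g: "g \<in> adjoin H t"
  shows "g \<in> H \<or> (\<exists>h\<in>H. g = h \<otimes> t)"
proof -
  obtain h i where hi: "h \<in> H" "g = h \<otimes> t [^] (i::int)" using g by (auto simp: adjoin_def)
  have hc: "h \<in> carrier G" using hi H subgroup.mem_carrier by metis
  obtain s where s: "s \<in> centre" "t [^] i = s \<or> t [^] i = s \<otimes> t" using pow_cases[OF t] .
  then have "h \<otimes> s \<in> H" using hi H by (auto intro: subgroup.m_closed)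
  moreover have "g = h \<otimes> s \<or> g = h \<otimes> s \<otimes> t"
    using s hi hc t centre_carrier[OF s(1)] by (auto simp: m_assoc)
  ultimately show ?thesis by blast
qed

text \<open>Squares are central and so lie in \<open>H\<close>: one new element exactly doubles the
  order, where \<open>psubgroup_card\<close> gives only a bound.\<close>

lemma card_adjoin:
  assumes H: "subgroup H G" "centre \<subseteq> H" and t: "t \<in> carrier G" "t \<notin> H"
  shows "card (adjoin H t) = 2 * card H"
proof (rule antisym)
  note A = adjoin_centre[OF H t(1)]
  have "adjoin H t \<subseteq> H \<union> (\<lambda>h. h \<otimes> t) ` H" using adjoin_cases[OF H t(1)] by blast
  then have "card (adjoin H t) \<le> card (H \<union> (\<lambda>h. h \<otimes> t) ` H)"
    using finite_subgroup[OF H(1)] by (intro card_mono) auto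
  also have "\<dots> \<le> card H + card ((\<lambda>h. h \<otimes> t) ` H)" by (rule card_Un_le)
  also have "\<dots> \<le> 2 * card H" using card_image_le[OF finite_subgroup[OF H(1)], of "\<lambda>h. h \<otimes> t"] by simp
  finally show "card (adjoin H t) \<le> 2 * card H" .
  have "H \<subset> adjoin H t" using A t by blast
  then show "2 * card H \<le> card (adjoin H t)" using psubgroup_card[OF H(1) A(1)] p_two by simp
qed

lemma no_abelian_maximal: \<comment> \<open>\<open>\<lambda>x. x \<otimes> x \<otimes> com x c\<close> maps \<open>A\<close> onto \<open>D\<close>, so some \<open>x \<otimes> c\<close> is an involution\<close>
  assumes A: "subgroup A G" "centre \<subseteq> A" and ab: "\<And>x y. \<lbrakk>x \<in> A; y \<in> A\<rbrakk> \<Longrightarrow> com x y = \<one>"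
    and c: "c \<in> carrier G" "c \<notin> A" and G: "adjoin A c = carrier G"
    and le: "card D * card centre \<le> card A"
  shows False
proof -
  have Ac: "x \<in> carrier G" if "x \<in> A" for x using that A subgroup.mem_carrier by metis
  define \<psi> where "\<psi> x = x \<otimes> x \<otimes> com x c" for x
  have \<psi>D: "\<psi> x \<in> D" if "x \<in> A" for x
    unfolding \<psi>_def using that Ac c square com_derived subgroup.m_closed[OF subgroup_derived] by simp
  have "card A = card (\<psi> ` A) * card {x \<in> A. \<psi> x = \<one>}"
  proof (rule card_hom_image[OF A(1)])
    fix x y assume xy: "x \<in> A" "y \<in> A"
    then have xyc: "x \<in> carrier G" "y \<in> carrier G" using Ac by auto
    have "\<psi> (x \<otimes> y) = x \<otimes> x \<otimes> (y \<otimes> y) \<otimes> (com x c \<otimes> com y c)"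
      unfolding \<psi>_def using square_mult[OF xyc] ab[OF xy] xyc c by (simp add: com_mult_left)
    also have "\<dots> = x \<otimes> x \<otimes> ((y \<otimes> y) \<otimes> (com x c \<otimes> com y c))" using xyc c by (simp add: m_assoc)
    also have "(y \<otimes> y) \<otimes> (com x c \<otimes> com y c) = com x c \<otimes> ((y \<otimes> y) \<otimes> com y c)"
      using xyc c by (intro com_left_comm) auto
    finally show "\<psi> (x \<otimes> y) = \<psi> x \<otimes> \<psi> y" unfolding \<psi>_def using xyc c by (simp add: m_assoc)
  qed (use \<psi>D derived_carrier in blast)
  also have "\<dots> \<le> card (\<psi> ` A) * card centre"
  proof (intro mult_le_mono2 card_mono finite_subgroup subgroup_centre subsetI)
    fix x assume "x \<in> {x \<in> A. \<psi> x = \<one>}"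
    then have x: "x \<in> A" "x \<otimes> x \<otimes> com x c = \<one>" by (auto simp: \<psi>_def)
    have xc: "x \<in> carrier G" using Ac x by blast
    \<comment> \<open>For \<open>x\<close> in the kernel \<open>com x c = x \<otimes> x\<close>; as
      \<open>A\<close> is abelian, \<open>com g x\<close> takes no values but \<open>\<one>\<close>
      and \<open>x \<otimes> x\<close>, which \<open>square_com\<close> excludes for noncentral
      \<open>x\<close>.\<close>
    have cx: "com x c = x \<otimes> x"
      by (rule central_mult_eq_one[OF _ derived_square[OF square[OF xc]] _ x(2)]) (use xc c in auto)
    show "x \<in> centre"
    proof (rule ccontr)
      assume "x \<notin> centre"
      then obtain g where g: "g \<in> carrier G" "com g x \<noteq> \<one>" "com g x \<noteq> x \<otimes> x"
        using square_com xc by blast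
      then have "g \<in> adjoin A c" using G by simp
      then consider "g \<in> A" | h where "h \<in> A" "g = h \<otimes> c" using adjoin_cases[OF A c(1)] by blast
      then show False
      proof cases
        case 1
        then show False using g ab x by blast
      next
        case 2
        then have "com g x = com c x" using ab x xc c Ac by (simp add: com_mult_left)
        then show False using g cx com_sym[OF xc c(1)] by simp
      qed
    qed
  qed
  finally have "card A \<le> card (\<psi> ` A) * card centre" .
  then have "card D * card centre \<le> card (\<psi> ` A) * card centre" by (rule order_trans[OF le])
  moreover have "card centre > 0"
    using finite_subgroup[OF subgroup_centre] subgroup.one_closed[OF subgroup_centre] card_gt_0_iff
    by blast
  ultimately have "card D \<le> card (\<psi> ` A)" by simp
  then have "\<psi> ` A = D"
    using \<psi>D by (intro card_seteq finite_subgroup subgroup_derived) auto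
  then obtain x where x: "x \<in> A" "c \<otimes> c = \<psi> x" using square[OF c(1)] by auto
  then have xc: "x \<in> carrier G" using Ac by blast
  have "x \<otimes> c \<otimes> (x \<otimes> c) = x \<otimes> x \<otimes> (c \<otimes> c) \<otimes> com x c" by (rule square_mult[OF xc c(1)])
  also have "x \<otimes> x \<otimes> (c \<otimes> c) = (c \<otimes> c) \<otimes> (x \<otimes> x)"
    using xc centre_comm[OF square_centre[OF c(1)], of "x \<otimes> x"] by simp
  also have "(c \<otimes> c) \<otimes> (x \<otimes> x) \<otimes> com x c = (c \<otimes> c) \<otimes> (x \<otimes> x \<otimes> com x c)"
    using xc c by (simp add: m_assoc)
  also have "\<dots> = \<one>" using x derived_square[OF square[OF c(1)]] by (simp add: \<psi>_def)
  finally have "x \<otimes> c \<in> centre" using involution xc c by simp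
  then have "x \<otimes> c \<in> A" using A by blast
  then show False using subgroup_mult_left_iff[OF A(1) x(1) c(1)] c by simp
qed

lemma pair_subgroup:
  assumes "w \<in> carrier G" "w \<otimes> w = \<one>"
  shows "subgroup {\<one>, w} G"
  by (rule subgroupI) (use assms inv_equality[of w w] in auto)

text \<open>For noncentral \<open>v\<close>, both \<open>v \<otimes> v\<close> and any nontrivial
  \<open>com g v\<close> would have to be \<open>w\<close>, against
  \<open>square_com\<close>.\<close>

lemma derived_not_pair: "\<lbrakk>\<not> carrier G \<subseteq> centre; w \<in> carrier G\<rbrakk> \<Longrightarrow> \<not> D \<subseteq> {\<one>, w}"
proof
  assume "\<not> carrier G \<subseteq> centre" and D: "D \<subseteq> {\<one>, w}"
  then obtain v where v: "v \<in> carrier G" "v \<notin> centre" by blast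
  then have "v \<otimes> v = w" using square square_neq_one D by blast
  moreover obtain g where "g \<in> carrier G" "com g v \<noteq> \<one>" "com g v \<noteq> v \<otimes> v" using square_com v by blast
  ultimately show False using com_derived[of g v] v D by blast
qed

lemma square_eq_pow: "x \<in> carrier G \<Longrightarrow> x [^] p = x \<otimes> x"
  by (simp add: p_two numeral_2_eq_2)

lemma span_abelian:
  assumes u: "u \<in> carrier G" and v: "v \<in> carrier G" and uv: "com u v = \<one>"
    and x: "x \<in> span2 u v" and y: "y \<in> span2 u v"
  shows "com x y = \<one>"
proof -
  have vu: "com v u = \<one>" using com_sym[OF u v] uv by simp
  have "u \<in> cent u" "v \<in> cent u" "u \<in> cent v" "v \<in> cent v" using u v uv vu by (simp_all add: cent_eq)
  then have "span2 u v \<subseteq> cent u" "span2 u v \<subseteq> cent v"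
    using u v by (simp_all add: span2_least subgroup_cent centre_subset_cent)
  then have xu: "x \<in> cent u" "x \<in> cent v" using x by auto
  have xc: "x \<in> carrier G" using xu cent_carrier by blast
  have "span2 u v \<subseteq> cent x"
    using xc cent_sym[OF u xu(1)] cent_sym[OF v xu(2)]
    by (simp add: span2_least subgroup_cent centre_subset_cent)
  then show ?thesis using y xc by (auto simp: cent_eq)
qed

text \<open>If \<open>G\<close> is generated by three elements over its centre and \<open>D\<close> has order 4, the three
  commutators of the generators are dependent, which produces a commuting pair.\<close>

lemma rank_three_order_four:
  assumes a: "a \<in> carrier G" and b: "b \<in> carrier G" and ab: "com a b \<noteq> \<one>"
    and c: "c \<in> carrier G" "c \<notin> span2 a b" and G: "span3 a b c = carrier G" and D4: "card D = 4"
  shows False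
proof -
  note sp = span_subgroup[OF a b c(1)]
  have ba: "com b a \<noteq> \<one>" using com_sym[OF a b] ab by simp
  have nc: "a \<notin> centre" "b \<notin> centre" using ab ba centre_com a b by blast+
  have card1: "card (adjoin centre u) = 2 * card centre" if "u \<in> carrier G" "u \<notin> centre" for u
    using that by (intro card_adjoin subgroup_centre) auto
  have card2: "card (span2 u v) = 4 * card centre"
    if u: "u \<in> carrier G" "u \<notin> centre" and v: "v \<in> carrier G" "v \<notin> adjoin centre u" for u v
    using card_adjoin[OF span_subgroup(1,4)[OF u(1) v(1) v(1)] v] card1[OF u] by simp
  have b_out: "b \<notin> adjoin centre a" using span_strict(2)[OF a b ab] span2_least[OF sp(1,4,7)] by blast
  have cG: "card (carrier G) = 8 * card centre"
  proof -
    have "centre \<subseteq> span2 a b" using sp by blast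
    from card_adjoin[OF sp(2) this c] show ?thesis using card2[OF a nc(1) b b_out] G by simp
  qed
  \<comment> \<open>A commuting pair independent modulo the centre spans an abelian subgroup of
    index 2 and order 4 |Z| = |D| |Z|, as excluded by \<open>no_abelian_maximal\<close>.\<close>
  have *: False if u: "u \<in> carrier G" "u \<notin> centre" and v: "v \<in> carrier G" "v \<notin> adjoin centre u"
    and uv: "com u v = \<one>" for u v
  proof -
    note sq = span_subgroup[OF u(1) v(1) v(1)]
    have Z: "centre \<subseteq> span2 u v" using sq by blast
    have "span2 u v \<noteq> carrier G" using card2[OF u v] cG finite_subgroup[OF subgroup_centre]
        subgroup.one_closed[OF subgroup_centre] by (auto simp: card_eq_0_iff)
    then obtain t where t: "t \<in> carrier G" "t \<notin> span2 u v" using subgroup.subset[OF sq(2)] by blast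
    have "card (adjoin (span2 u v) t) = card (carrier G)"
      using card_adjoin[OF sq(2) Z t] card2[OF u v] cG by simp
    then have "adjoin (span2 u v) t = carrier G"
      using card_subset_eq[OF finite_carrier subgroup.subset[OF adjoin_centre(1)[OF sq(2) Z t(1)]]] by simp
    then show False
      using no_abelian_maximal[OF sq(2) Z span_abelian[OF u(1) v(1) uv] t] card2[OF u v] D4 by simp
  qed
  have out: "x \<notin> adjoin centre u" if "u \<in> span2 a b" "x \<notin> span2 a b" for u x
  proof -
    have "adjoin centre u \<subseteq> span2 a b" using that sp by (intro adjoin_least) auto
    then show ?thesis using that by blast
  qed
  have mem: "a \<in> span2 a b" "b \<in> span2 a b" using sp by auto
  note m2 = subgroup_mult_right_iff[OF sp(2)] subgroup_mult_left_iff[OF sp(2)]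
  \<comment> \<open>No element independent of \<open>a\<close> commutes with it, so
    \<open>cent a\<close> has order 2 |Z| and \<open>com a\<close> takes four values.\<close>
  have "D \<subseteq> com a ` carrier G"
  proof -
    have "cent a = adjoin centre a"
    proof (rule ccontr)
      assume "cent a \<noteq> adjoin centre a"
      moreover have "adjoin centre a \<subseteq> cent a"
        using a by (intro adjoin_least subgroup_cent centre_subset_cent cent_self)
      ultimately obtain v where "v \<in> cent a" "v \<notin> adjoin centre a" by blast
      then show False using *[OF a nc(1), of v] a by (simp add: cent_eq)
    qed
    then have "8 * card centre = card (com a ` carrier G) * (2 * card centre)"
      using card_com_range[OF a] cG card1[OF a nc(1)] by simp
    moreover have "card centre > 0"
      using finite_subgroup[OF subgroup_centre] subgroup.one_closed[OF subgroup_centre] card_gt_0_iff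
      by blast
    ultimately have "card (com a ` carrier G) = 4" by simp
    then have "com a ` carrier G = D"
      using card_subset_eq[OF finite_subgroup[OF subgroup_derived] com_range_derived[OF a]] D4 by simp
    then show ?thesis by simp
  qed
  then obtain g where g: "g \<in> carrier G" "com b c = com a g" using com_derived[OF b c(1)] by blast
  have "com a g = \<one> \<or> com a g = com a b \<or> com a g = com a c \<or> com a g = com a b \<otimes> com a c"
  proof -
    have h1: "com a h = \<one> \<or> com a h = com a b" if "h \<in> span2 a b" for h
    proof -
      have h0: "com a k = \<one>" "k \<in> carrier G" if "k \<in> adjoin centre a" for k
      proof -
        have "adjoin centre a \<subseteq> cent a"
          using a by (intro adjoin_least subgroup_cent centre_subset_cent cent_self)
        then show "com a k = \<one>" "k \<in> carrier G" using that a by (auto simp: cent_eq)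
      qed
      show ?thesis using adjoin_cases[OF sp(1,4) b that] h0 a b by (auto simp: com_mult_right)
    qed
    have hc: "h \<in> carrier G" if "h \<in> span2 a b" for h using that sp(2) subgroup.mem_carrier by metis
    have "centre \<subseteq> span2 a b" using sp by blast
    from adjoin_cases[OF sp(2) this c(1), of g] show ?thesis
      using g G h1 hc a b c by (auto simp: com_mult_right) metis+
  qed
  \<comment> \<open>In each case bilinearity supplies an independent commuting pair:
    \<open>b\<close>, \<open>c\<close>; then \<open>b\<close>, \<open>c \<otimes> a\<close>; then
    \<open>b \<otimes> a\<close>, \<open>c\<close>; finally \<open>a \<otimes> b\<close>,
    \<open>b \<otimes> c\<close>.\<close>
  then consider "com b c = \<one>" | "com b c = com a b" | "com b c = com a c" | "com b c = com a b \<otimes> com a c"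
    using g by auto
  then show False
  proof cases
    case 1
    then show False using *[OF b nc(2) c(1) out[OF mem(2) c(2)]] by simp
  next
    case 2
    have "c \<otimes> a \<notin> span2 a b" using m2 mem a c by simp
    moreover have "com b (c \<otimes> a) = \<one>"
      using a b c 2 com_sym[OF a b] com_square[OF a b] by (simp add: com_mult_right)
    ultimately show False using *[OF b nc(2), of "c \<otimes> a"] out[OF mem(2)] a c by simp
  next
    case 3
    have "com (b \<otimes> a) c = \<one>" using a b c 3 com_square[OF a c(1)] by (simp add: com_mult_left)
    moreover have "b \<otimes> a \<in> span2 a b" using m2 mem a b by simp
    moreover have "b \<otimes> a \<notin> centre"
    proof
      assume "b \<otimes> a \<in> centre"
      then have "com (b \<otimes> a) a = \<one>" using centre_com a by blast
      then show False using a b ba by (simp add: com_mult_left)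
    qed
    ultimately show False using *[of "b \<otimes> a" c] out[of "b \<otimes> a" c] a b c by simp
  next
    case 4
    have "com (a \<otimes> b) (b \<otimes> c) = com a b \<otimes> com a c \<otimes> com b c"
      using a b c by (simp add: com_mult_left com_mult_right m_assoc)
    also have "\<dots> = \<one>" using 4 com_square[OF b c(1)] by simp
    finally have "com (a \<otimes> b) (b \<otimes> c) = \<one>" .
    moreover have "a \<otimes> b \<in> span2 a b" "b \<otimes> c \<notin> span2 a b" using m2 mem a b c by simp_all
    moreover have "a \<otimes> b \<notin> centre"
    proof
      assume "a \<otimes> b \<in> centre"
      then have "com (a \<otimes> b) b = \<one>" using centre_com b by blast
      then show False using a b ab by (simp add: com_mult_left)
    qed
    ultimately show False using *[of "a \<otimes> b" "b \<otimes> c"] out[of "a \<otimes> b" "b \<otimes> c"] a b c by simp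
  qed
qed

end

section \<open>Order 64 with \<open>D\<close> equal to the centre and of order 4\<close>

locale two_group_64 = two_group +
  assumes D_eq: "D = centre" and card_D: "card D = 4" and card_G: "card (carrier G) = 64"
begin

lemma card_Z: "card centre = 4" using D_eq card_D by simp

lemma centre_square: "z \<in> centre \<Longrightarrow> z \<otimes> z = \<one>"
  using derived_square D_eq by simp

lemma nonabelian: "\<not> carrier G \<subseteq> centre"
  using card_mono[OF finite_subgroup[OF subgroup_centre], of "carrier G"] card_Z card_G by auto

text \<open>\<open>{\<one>, w}\<close> has index 2 in \<open>D\<close>.\<close>

lemma mult_mem_pair:
  assumes w: "w \<in> D" "w \<noteq> \<one>" and x: "x \<in> D" "x \<notin> {\<one>, w}" and y: "y \<in> D" "y \<notin> {\<one>, w}"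
  shows "x \<otimes> y \<in> {\<one>, w}"
proof -
  have c: "w \<in> carrier G" "x \<in> carrier G" "y \<in> carrier G" using w x y derived_carrier by auto
  have xw: "x \<otimes> w \<in> D" "x \<otimes> w \<noteq> x" "x \<otimes> w \<noteq> w" "x \<otimes> w \<noteq> \<one>"
    using w x c subgroup.m_closed[OF subgroup_derived] central_mult_eq_one[OF c(2) derived_square[OF x(1)] c(1)]
    by auto
  then have "card {\<one>, w, x, x \<otimes> w} = 4" using w x by auto
  moreover have "{\<one>, w, x, x \<otimes> w} \<subseteq> D" using w x xw subgroup.one_closed[OF subgroup_derived] by auto
  ultimately have "D = {\<one>, w, x, x \<otimes> w}"
    using card_subset_eq[OF finite_subgroup[OF subgroup_derived]] card_D by metis
  then have "y = x \<or> y = x \<otimes> w" using y by auto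
  moreover have "x \<otimes> x = \<one>" using derived_square x by blast
  ultimately show ?thesis using c by (auto simp: m_assoc[symmetric])
qed

text \<open>Modulo \<open>{\<one>, w}\<close> the commutator is an alternating form on
  \<open>G / Z\<close>, of dimension 4 over two elements, and \<open>v\<close> lies in its radical.
  The form is nonzero, so the radical has dimension 2, spanned by \<open>v\<close> and some
  \<open>v'\<close>. Noncentral radical elements have squares outside \<open>{\<one>, w}\<close> by
  \<open>square_com\<close>, but the square of \<open>v \<otimes> v'\<close> falls inside.\<close>

lemma no_small_class:
  assumes v: "v \<in> carrier G" "v \<notin> centre" and w: "w \<in> D" and vw: "\<And>g. g \<in> carrier G \<Longrightarrow> com v g \<in> {\<one>, w}"
  shows False
proof -
  have wc: "w \<in> carrier G" using w derived_carrier by blast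
  have w1: "w \<noteq> \<one>" using noncentral_com[OF v] vw by auto
  let ?R = "{\<one>, w}"
  have R: "subgroup ?R G" by (rule pair_subgroup[OF wc derived_square[OF w]])
  have "\<exists>t1\<in>carrier G. \<exists>t2\<in>carrier G. com t1 t2 \<notin> ?R"
  proof (rule ccontr)
    assume "\<not> ?thesis"
    then have "D \<subseteq> ?R" by (intro derived_least[OF R]) blast
    then show False using derived_not_pair[OF nonabelian wc] by blast
  qed
  then obtain t1 t2 where t: "t1 \<in> carrier G" "t2 \<in> carrier G" "com t1 t2 \<notin> ?R" by blast
  have t21: "com t2 t1 \<notin> ?R" using com_sym[OF t(1,2)] t by simp
  have Z1: "com z g \<in> ?R" "com g z \<in> ?R" if "z \<in> centre" "g \<in> carrier G" for z g
    using centre_com[OF that] by auto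
  \<comment> \<open>\<open>P\<close> is the orthogonal complement of the hyperbolic pair
    \<open>t1\<close>, \<open>t2\<close>; two steps of index 2 give its order 16.\<close>
  define K where "K = {g \<in> carrier G. com t1 g \<in> ?R}"
  define P where "P = K \<inter> {g \<in> carrier G. com t2 g \<in> ?R}"
  have K: "subgroup K G" unfolding K_def by (rule subgroup_com_left[OF R t(1)])
  have P: "subgroup P G" unfolding P_def by (intro subgroups_Inter_pair K subgroup_com_left[OF R t(2)])
  have ZP: "centre \<subseteq> P" using Z1 t centre_carrier by (auto simp: P_def K_def)
  have ZK: "centre \<subseteq> K" using ZP by (auto simp: P_def)
  have t2K: "t2 \<notin> K" using t by (simp add: K_def)
  have t1P: "t1 \<notin> P" using t21 by (simp add: P_def)
  have t1K: "t1 \<in> K" using t by (simp add: K_def)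
  note AK = adjoin_centre[OF K ZK t(2)] and AP = adjoin_centre[OF P ZP t(1)]
  have GK: "adjoin K t2 = carrier G"
  proof
    show "adjoin K t2 \<subseteq> carrier G" using subgroup.subset[OF AK(1)] .
    show "carrier G \<subseteq> adjoin K t2"
    proof
      fix g assume g: "g \<in> carrier G"
      show "g \<in> adjoin K t2"
      proof (cases "g \<in> K")
        case False
        then have "com t1 g \<notin> ?R" using g by (simp add: K_def)
        then have "com t1 (g \<otimes> t2) \<in> ?R"
          using mult_mem_pair[OF w w1 com_derived[OF t(1) g] _ com_derived[OF t(1,2)]] t g
          by (simp add: com_mult_right)
        then have "g \<otimes> t2 \<in> adjoin K t2" using AK g t by (auto simp: K_def)
        then show ?thesis using subgroup_mult_right_iff[OF AK(1,3) g] by simp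
      qed (use AK in blast)
    qed
  qed
  have KP: "adjoin P t1 = K"
  proof
    show "adjoin P t1 \<subseteq> K" using t1K by (intro adjoin_least[OF K]) (auto simp: P_def)
    show "K \<subseteq> adjoin P t1"
    proof
      fix g assume gK: "g \<in> K"
      then have g: "g \<in> carrier G" by (simp add: K_def)
      show "g \<in> adjoin P t1"
      proof (cases "g \<in> P")
        case False
        then have "com t2 g \<notin> ?R" using g gK by (simp add: P_def)
        then have "com t2 (g \<otimes> t1) \<in> ?R"
          using mult_mem_pair[OF w w1 com_derived[OF t(2) g] _ com_derived[OF t(2,1)]] t t21 g
          by (simp add: com_mult_right)
        then have "g \<otimes> t1 \<in> P"
          using subgroup.m_closed[OF K gK t1K] g t by (simp add: P_def)
        then have "g \<otimes> t1 \<in> adjoin P t1" using AP by blast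
        then show ?thesis using subgroup_mult_right_iff[OF AP(1,3) g] by simp
      qed (use AP in blast)
    qed
  qed
  have cardP: "card P = 16"
    using card_adjoin[OF K ZK t(2) t2K] card_adjoin[OF P ZP t(1) t1P] GK KP card_G by simp
  have vP: "v \<in> P" 
  proof -
    have "com t v \<in> ?R" if "t \<in> carrier G" for t using vw[OF that] com_sym[OF v(1) that] by simp
    then show ?thesis using v t by (simp add: P_def K_def)
  qed
  have c8: "card (adjoin centre v) = 8"
    using card_adjoin[OF subgroup_centre subset_refl v] card_Z by simp
  have sv: "subgroup (adjoin centre v) G" "centre \<subseteq> adjoin centre v" "v \<in> adjoin centre v"
    using adjoin_centre[OF subgroup_centre subset_refl v(1)] by blast+
  have "\<not> P \<subseteq> adjoin centre v" using card_mono[OF finite_subgroup[OF sv(1)], of P] c8 cardP by auto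
  then obtain v' where v': "v' \<in> P" "v' \<notin> adjoin centre v" by blast
  have v'c: "v' \<in> carrier G" using v' by (simp add: P_def K_def)
  have sp: "span2 v v' = P"
  proof (rule card_subset_eq[OF finite_subgroup[OF P]])
    show "span2 v v' \<subseteq> P" by (rule span2_least[OF P ZP vP v'(1)])
    show "card (span2 v v') = card P" using card_adjoin[OF sv(1,2) v'c v'(2)] c8 cardP by simp
  qed
  \<comment> \<open>\<open>G\<close> is generated by \<open>P\<close>, \<open>t1\<close> and
    \<open>t2\<close>, and \<open>v'\<close> is orthogonal to \<open>v\<close>, to itself, to
    \<open>t1\<close> and to \<open>t2\<close>.\<close>
  have v'R: "com v' g \<in> ?R" if "g \<in> carrier G" for g
  proof -
    let ?V = "{g \<in> carrier G. com v' g \<in> ?R}"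
    have V: "subgroup ?V G" by (rule subgroup_com_left[OF R v'c])
    have "span2 v v' \<subseteq> ?V"
      using Z1 v v'c vw[OF v'c] com_sym[OF v(1) v'c] centre_carrier by (intro span2_least[OF V]) auto
    moreover have "t1 \<in> ?V" "t2 \<in> ?V"
      using v'(1) t com_sym[OF t(1) v'c] com_sym[OF t(2) v'c] by (auto simp: P_def K_def)
    ultimately have "adjoin (adjoin P t1) t2 \<subseteq> ?V" unfolding sp by (intro adjoin_least[OF V])
    then show ?thesis using that unfolding KP GK by blast
  qed
  have sq: "x \<otimes> x \<notin> ?R" if x: "x \<in> carrier G" "x \<notin> centre" and xR: "\<And>g. g \<in> carrier G \<Longrightarrow> com x g \<in> ?R" for x
  proof -
    obtain g where g: "g \<in> carrier G" "com g x \<noteq> \<one>" "com g x \<noteq> x \<otimes> x" using square_com x by blast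
    then have "com g x = w" using xR[OF g(1)] com_sym[OF x(1) g(1)] by auto
    then show ?thesis using g square_neq_one x by auto
  qed
  have v'n: "v' \<notin> centre" using v' sv by blast
  have vv'n: "v \<otimes> v' \<notin> centre"
    using v'(2) subgroup_mult_left_iff[OF sv(1,3) v'c] sv(2) by blast
  have "com (v \<otimes> v') g \<in> ?R" if "g \<in> carrier G" for g
    using subgroup.m_closed[OF R vw[OF that] v'R[OF that]] v v'c that by (simp add: com_mult_left)
  then have 1: "v \<otimes> v' \<otimes> (v \<otimes> v') \<notin> ?R" using sq[OF _ vv'n] v v'c by simp
  have "v \<otimes> v \<otimes> (v' \<otimes> v') \<in> ?R"
    using mult_mem_pair[OF w w1 square[OF v(1)] sq[OF v vw] square[OF v'c] sq[OF v'c v'n v'R]] .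
  from subgroup.m_closed[OF R this vw[OF v'c]] show False
    using 1 square_mult[OF v(1) v'c] by simp
qed

text \<open>A proper subgroup of \<open>D\<close> has order at most 2, the situation of
  \<open>no_small_class\<close>. So noncentral classes have size 4 and noncentral centralizers order
  16.\<close>

lemma com_range_full:
  assumes v: "v \<in> carrier G" "v \<notin> centre"
  shows "com v ` carrier G = D"
proof (rule ccontr)
  assume "com v ` carrier G \<noteq> D"
  then have lt: "com v ` carrier G \<subset> D" using com_range_derived[OF v(1)] by blast
  then have "2 * card (com v ` carrier G) \<le> 4"
    using psubgroup_card[OF subgroup_com_range[OF v(1)] subgroup_derived] card_D p_two by simp
  then have le: "card (com v ` carrier G) \<le> 2" by simp
  obtain g where g: "g \<in> carrier G" "com v g \<noteq> \<one>" using noncentral_com v by blast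
  have "{\<one>, com v g} = com v ` carrier G"
  proof (rule card_seteq)
    show "finite (com v ` carrier G)" using finite_carrier by simp
    show "{\<one>, com v g} \<subseteq> com v ` carrier G"
      using g subgroup.one_closed[OF subgroup_com_range[OF v(1)]] by auto
    show "card (com v ` carrier G) \<le> card {\<one>, com v g}" using le g by simp
  qed
  then show False using no_small_class[OF v com_derived[OF v(1) g(1)]] by blast
qed

lemma card_cent:
  assumes v: "v \<in> carrier G" "v \<notin> centre"
  shows "card (cent v) = 16"
  using card_com_range[OF v(1)] com_range_full[OF v] card_G card_D by simp

text \<open>Commuting independent \<open>a\<close>, \<open>b\<close> span an abelian
  \<open>A\<close> of order 16, the centralizer of each of its noncentral elements. Surjectivity of
  \<open>com a\<close> and \<open>com b\<close> onto \<open>D\<close> provides \<open>c\<close> with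
  \<open>com a c = a \<otimes> a\<close> and \<open>e\<close> with
  \<open>com b e = b \<otimes> b\<close>; these generate \<open>G\<close> over \<open>A\<close>.
  Fixing \<open>A\<close> and sending \<open>c\<close> to \<open>c \<otimes> a\<close> and
  \<open>e\<close> to \<open>e \<otimes> b\<close> is then an endomorphism, but \<open>c\<close>
  does not commute with \<open>c \<otimes> a\<close>.\<close>

lemma no_two_group_64: False
proof -
  obtain a where a: "a \<in> carrier G" "a \<notin> centre" using nonabelian by blast
  have Za: "subgroup (adjoin centre a) G" "centre \<subseteq> adjoin centre a" "a \<in> adjoin centre a"
    using adjoin_centre[OF subgroup_centre subset_refl a(1)] by blast+
  have c8: "card (adjoin centre a) = 8"
    using card_adjoin[OF subgroup_centre subset_refl a] card_Z by simp
  have "\<not> cent a \<subseteq> adjoin centre a"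
    using card_mono[OF finite_subgroup[OF Za(1)], of "cent a"] c8 card_cent[OF a] by auto
  then obtain b where b: "b \<in> cent a" "b \<notin> adjoin centre a" by blast
  have bc: "b \<in> carrier G" and ab: "com a b = \<one>" using b a by (auto simp: cent_eq)
  define A where "A = span2 a b"
  note sp = span_subgroup[OF a(1) bc bc]
  have A: "subgroup A G" "centre \<subseteq> A" "a \<in> A" "b \<in> A" using sp by (auto simp: A_def)
  have Ac: "x \<in> carrier G" if "x \<in> A" for x using that A subgroup.mem_carrier by metis
  have Aab: "com x y = \<one>" if "x \<in> A" "y \<in> A" for x y
    using that span_abelian[OF a(1) bc ab] by (simp add: A_def)
  have card_A: "card A = 16" using card_adjoin[OF Za(1,2) bc b(2)] c8 by (simp add: A_def)
  have centA: "cent x = A" if x: "x \<in> A" "x \<notin> centre" for x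
  proof -
    have "A \<subseteq> cent x" using Aab[OF x(1)] Ac x by (auto simp: cent_eq)
    then show ?thesis
      using card_subset_eq[OF finite_subgroup[OF subgroup_cent[OF Ac[OF x(1)]]], of A] card_A
        card_cent[OF Ac[OF x(1)] x(2)] by simp
  qed
  have bn: "b \<notin> centre" using b Za by blast
  have abn: "a \<otimes> b \<notin> centre" "a \<otimes> b \<in> A"
    using b(2) subgroup_mult_left_iff[OF Za(1,3) bc] Za(2) subgroup.m_closed[OF A(1,3,4)] by blast+
  \<comment> \<open>Such a \<open>c\<close> gives \<open>x \<otimes> x = com x c\<close> on all of
    \<open>A\<close>. For \<open>d\<close> outside \<open>adjoin A c\<close> the map
    \<open>com x (c \<otimes> d)\<close> of \<open>x\<close> sends \<open>A\<close> onto
    \<open>D\<close>, and the \<open>x\<close> hitting \<open>d \<otimes> d\<close> makes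
    \<open>x \<otimes> d\<close> an involution, hence an element of \<open>A\<close>.\<close>
  have common: False if c: "c \<in> carrier G" "com a c = a \<otimes> a" "com b c = b \<otimes> b" for c
  proof -
    have cA: "c \<notin> A" using Aab[OF A(3), of c] c square_neq_one[OF a] by auto
    note Q = adjoin_centre[OF A(1,2) c(1)]
    have "card (adjoin A c) = 32" using card_adjoin[OF A(1,2) c(1) cA] card_A by simp
    then have "adjoin A c \<noteq> carrier G" using card_G by auto
    then obtain d where d: "d \<in> carrier G" "d \<notin> adjoin A c" using subgroup.subset[OF Q(1)] by blast
    have cd: "c \<otimes> d \<in> carrier G" "c \<otimes> d \<notin> A"
      using c d Q subgroup_mult_left_iff[OF Q(1) Q(3) d(1)] by auto
    have sqc: "x \<otimes> x = com x c" if "x \<in> A" for x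
    proof -
      let ?S = "{x \<in> A. x \<otimes> x = com x c}"
      have "subgroup ?S G"
      proof (rule subgroupI)
        fix x y assume xy: "x \<in> ?S" "y \<in> ?S"
        then have "x \<otimes> y \<otimes> (x \<otimes> y) = com (x \<otimes> y) c"
          using square_mult[of x y] Aab[of x y] Ac c by (simp add: com_mult_left)
        then show "x \<otimes> y \<in> ?S" using xy subgroup.m_closed[OF A(1)] by simp
      next
        fix x assume x: "x \<in> ?S"
        then have "inv x \<otimes> inv x = com (inv x) c"
          using Ac c by (simp add: com_inv_left flip: inv_mult_group)
        then show "inv x \<in> ?S" using x subgroup.m_inv_closed[OF A(1)] by simp
      qed (use Ac subgroup.one_closed[OF A(1)] c in auto)
      moreover have "centre \<subseteq> ?S" using A(2) centre_square centre_com c by auto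
      moreover have "a \<in> ?S" "b \<in> ?S" using A c by auto
      ultimately have "A \<subseteq> ?S" unfolding A_def by (intro span2_least) (auto simp: A_def)
      then show ?thesis using that by blast
    qed
    define \<psi> where "\<psi> x = com x (c \<otimes> d)" for x
    have "card A = card (\<psi> ` A) * card {x \<in> A. \<psi> x = \<one>}"
      using Ac cd by (intro card_hom_image[OF A(1)]) (auto simp: \<psi>_def com_mult_left)
    also have "{x \<in> A. \<psi> x = \<one>} = centre"
    proof
      show "centre \<subseteq> {x \<in> A. \<psi> x = \<one>}" using A(2) centre_com cd by (auto simp: \<psi>_def)
      show "{x \<in> A. \<psi> x = \<one>} \<subseteq> centre"
      proof
        fix x assume x: "x \<in> {x \<in> A. \<psi> x = \<one>}"
        then have "c \<otimes> d \<in> cent x" using Ac cd by (simp add: \<psi>_def cent_eq)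
        then show "x \<in> centre" using centA[of x] x cd by blast
      qed
    qed
    finally have "card (\<psi> ` A) = card D" using card_A card_Z card_D by simp
    moreover have "\<psi> ` A \<subseteq> D" using com_derived Ac cd by (auto simp: \<psi>_def)
    ultimately have "\<psi> ` A = D" using card_subset_eq[OF finite_subgroup[OF subgroup_derived]] by blast
    then obtain x where x: "x \<in> A" "d \<otimes> d = com x (c \<otimes> d)" using square[OF d(1)] by (auto simp: \<psi>_def)
    then have xc: "x \<in> carrier G" using Ac by blast
    have "d \<otimes> d = x \<otimes> x \<otimes> com x d" using x(2) sqc[OF x(1)] xc c d by (simp add: com_mult_right)
    then have "x \<otimes> d \<otimes> (x \<otimes> d) = (x \<otimes> x) \<otimes> (x \<otimes> x) \<otimes> (com x d \<otimes> com x d)"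
      using square_mult[OF xc d(1)] xc d by (simp add: m_assoc)
    then have "x \<otimes> d \<otimes> (x \<otimes> d) = \<one>"
      using com_square[OF xc d(1)] derived_square[OF square[OF xc]] by simp
    then have "x \<otimes> d \<in> A" using involution A xc d by auto
    then show False using subgroup_mult_left_iff[OF A(1) x(1) d(1)] d Q by blast
  qed
  obtain c where c: "c \<in> carrier G" "com a c = a \<otimes> a"
    using square[OF a(1)] com_range_full[OF a] by (metis imageE)
  obtain e where e: "e \<in> carrier G" "com b e = b \<otimes> b"
    using square[OF bc] com_range_full[OF bc bn] by (metis imageE)
  have cA: "c \<notin> A" using Aab[OF A(3), of c] c square_neq_one[OF a] by auto
  have eA: "e \<notin> A" using Aab[OF A(4), of e] e square_neq_one[OF bc bn] by auto
  note Q = adjoin_centre[OF A(1,2) c(1)]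
  have ZQ: "centre \<subseteq> adjoin A c" using A Q by blast
  have eQ: "e \<notin> adjoin A c"
  proof
    assume "e \<in> adjoin A c"
    then obtain h where h: "h \<in> A" "e = h \<otimes> c" using adjoin_cases[OF A(1,2) c(1)] eA by blast
    then have "com b c = b \<otimes> b" using e Aab[OF A(4) h(1)] bc c Ac by (simp add: com_mult_right)
    then show False using common c by blast
  qed
  note S = adjoin_centre[OF Q(1) ZQ e(1)]
  have G: "adjoin (adjoin A c) e = carrier G"
    using card_subset_eq[OF finite_carrier subgroup.subset[OF S(1)]] card_adjoin[OF Q(1) ZQ e(1) eQ]
      card_adjoin[OF A(1,2) c(1) cA] card_A card_G by simp
  have ab_sq: "a \<otimes> b \<otimes> (a \<otimes> b) = a \<otimes> a \<otimes> (b \<otimes> b)" using square_mult[OF a(1) bc] ab a bc by simp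
  \<comment> \<open>Some \<open>g\<close> has \<open>com (a \<otimes> b) g\<close> equal to the
    square of \<open>a \<otimes> b\<close>. If \<open>g\<close> involves at most one of
    \<open>c\<close>, \<open>e\<close> modulo \<open>A\<close>, that square is trivial or
    \<open>common\<close> applies; if it involves both, the equation reduces to this one.\<close>
  have ae: "com a e = com b c"
  proof -
    have abc: "a \<otimes> b \<in> carrier G" using a bc by simp
    obtain g where g: "g \<in> carrier G" "com (a \<otimes> b) g = a \<otimes> a \<otimes> (b \<otimes> b)"
      using square[OF abc] com_range_full[OF abc abn(1)] ab_sq by (metis imageE)
    have ne: "a \<otimes> a \<otimes> (b \<otimes> b) \<noteq> \<one>" using square_neq_one[OF abc abn(1)] ab_sq by simp
    have h0: "com (a \<otimes> b) h = \<one>" if "h \<in> A" for h using Aab[OF abn(2) that] .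
    have cc: "com a c = a \<otimes> a" "com b e = b \<otimes> b" using c e by auto
    have cl: "a \<otimes> a \<in> carrier G" "b \<otimes> b \<in> carrier G" "com b c \<in> carrier G" "com a e \<in> carrier G"
      using a bc c e by auto
    have Qc: "com (a \<otimes> b) k = \<one> \<or> com (a \<otimes> b) k = a \<otimes> a \<otimes> com b c" if k: "k \<in> adjoin A c" for k
    proof -
      consider "k \<in> A" | h where "h \<in> A" "k = h \<otimes> c" using adjoin_cases[OF A(1,2) c(1) k] by blast
      then show ?thesis
      proof cases
        case 2
        then show ?thesis using h0[of h] abc Ac c a bc cc by (simp add: com_mult_right com_mult_left[of a b c])
      qed (use h0 in simp)
    qed
    have abe: "com (a \<otimes> b) e = com a e \<otimes> (b \<otimes> b)" using a bc e cc by (simp add: com_mult_left)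
    have "g \<in> adjoin (adjoin A c) e" using g G by simp
    then consider "g \<in> adjoin A c" | k where "k \<in> adjoin A c" "g = k \<otimes> e"
      using adjoin_cases[OF Q(1) ZQ e(1)] by blast
    then show ?thesis
    proof cases
      case 1
      then have "a \<otimes> a \<otimes> com b c = a \<otimes> a \<otimes> (b \<otimes> b)" using Qc[OF 1] g ne by auto
      then have "com b c = b \<otimes> b" by (rule l_cancel[OF _ cl(3,2,1)])
      then show ?thesis using common c by blast
    next
      case 2
      have kc: "k \<in> carrier G" using 2 Q(1) subgroup.mem_carrier by metis
      have eq: "com (a \<otimes> b) k \<otimes> (com a e \<otimes> (b \<otimes> b)) = a \<otimes> a \<otimes> (b \<otimes> b)"
        using g 2 abc kc e abe by (simp add: com_mult_right)
      from Qc[OF 2(1)] show ?thesis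
      proof
        assume "com (a \<otimes> b) k = \<one>"
        then have "com a e \<otimes> (b \<otimes> b) = a \<otimes> a \<otimes> (b \<otimes> b)" using eq cl by simp
        then have "com a e = a \<otimes> a" by (rule r_cancel[OF _ cl(4,1,2)])
        then show ?thesis using common e by blast
      next
        assume "com (a \<otimes> b) k = a \<otimes> a \<otimes> com b c"
        then have "a \<otimes> a \<otimes> (com b c \<otimes> com a e \<otimes> (b \<otimes> b)) = a \<otimes> a \<otimes> (\<one> \<otimes> (b \<otimes> b))"
          using eq cl by (simp add: m_assoc)
        then have "com b c \<otimes> com a e \<otimes> (b \<otimes> b) = \<one> \<otimes> (b \<otimes> b)"
          by (rule l_cancel[OF _ _ _ cl(1)]) (use cl in auto)
        then have "com b c \<otimes> com a e = \<one>"
          by (rule r_cancel[OF _ _ _ cl(2)]) (use cl in auto)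
        then show ?thesis
          using central_mult_eq_one[OF cl(3) com_square[OF bc c(1)] cl(4)] by blast
      qed
    qed
  qed
  have inv_sq: "x \<otimes> y \<otimes> (x \<otimes> y) = x \<otimes> x" if "x \<in> carrier G" "y \<in> carrier G" "com y x = y \<otimes> y" for x y
    using that square_mult[of x y] com_sym[of y x] derived_square[OF square[of y]] by (simp add: m_assoc)
  \<comment> \<open>The choice of \<open>c\<close> and \<open>e\<close> preserves their squares,
    \<open>A\<close> being abelian preserves commutators with \<open>A\<close>, and
    \<open>ae\<close> preserves \<open>com e c\<close>; so all relations over \<open>A\<close>
    survive.\<close>
  define c' e' where "c' = c \<otimes> a" and "e' = e \<otimes> b"
  have c': "c' \<in> carrier G" "c' \<otimes> c' = c \<otimes> c" using inv_sq[OF c(1) a(1)] c a by (auto simp: c'_def)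
  have e': "e' \<in> carrier G" "e' \<otimes> e' = e \<otimes> e" using inv_sq[OF e(1) bc] e bc by (auto simp: e'_def)
  let ?\<Phi> = "\<lambda>(i, j, h). c [^] (i::int) \<otimes> e [^] (j::int) \<otimes> h"
  let ?\<Psi> = "\<lambda>(i, j, h). c' [^] (i::int) \<otimes> e' [^] (j::int) \<otimes> h"
  let ?I = "(UNIV :: int set) \<times> (UNIV :: int set) \<times> A"
  have com_c': "com h c' = com h c" if "h \<in> A" for h
    using Aab[OF that A(3)] Ac[OF that] c a by (simp add: c'_def com_mult_right)
  have com_e': "com h e' = com h e" if "h \<in> A" for h
    using Aab[OF that A(4)] Ac[OF that] e bc by (simp add: e'_def com_mult_right)
  have com_ec': "com e' c' = com e c"
  proof -
    have "com e' c' = com e c \<otimes> com b c \<otimes> (com e a \<otimes> com b a)"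
      using c e a bc by (simp add: c'_def e'_def com_mult_left com_mult_right)
    also have "\<dots> = com e c \<otimes> (com b c \<otimes> com b c)"
      using Aab[OF A(4,3)] com_sym[OF a(1) e(1)] ae c e bc by (simp add: m_assoc)
    finally show ?thesis using com_square[OF bc c(1)] c e by simp
  qed
  define \<kappa> where "\<kappa> j h k l = com h e [^] (l::int) \<otimes> com h c [^] (k::int) \<otimes> com e c [^] (j * k)" for j k l :: int and h
  have \<kappa>A: "\<kappa> j h k l \<in> centre" if "h \<in> A" for j k l :: int and h
    unfolding \<kappa>_def using Ac[OF that] c e
    by (intro subgroup.m_closed[OF subgroup_centre] com_pow_centre) auto
  have double: "x [^] (2 * s) = (x \<otimes> x) [^] s" if "x \<in> carrier G" for x and s :: int
  proof -
    have "x [^] (2::int) = x \<otimes> x" using that int_pow_mult[of x 1 1] by simp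
    then show ?thesis using that by (simp flip: int_pow_pow)
  qed
  have even_if_mem: "even i" if "subgroup H G" "x \<in> carrier G" "x \<notin> H" "x [^] (i::int) \<in> H" for H x i
    using pow_mem_if_not_dvd[OF that(1,2,4)] that(3) p_two by auto
  have "\<exists>\<alpha>\<in>hom G G. \<forall>i\<in>?I. ?\<Phi> i \<in> carrier G \<longrightarrow> \<alpha> (?\<Phi> i) = ?\<Psi> i"
  proof (rule hom_of_transport)
    fix g assume "g \<in> carrier G"
    then have "g \<in> adjoin (adjoin A c) e" using G by simp
    then obtain h i j where h: "h \<in> A" "g = h \<otimes> c [^] (i::int) \<otimes> e [^] (j::int)"
      by (auto simp: adjoin_def)
    have hc: "h \<in> carrier G" using h Ac by blast
    have x: "c [^] i \<otimes> e [^] j \<in> carrier G" using c e by simp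
    have "com h (c [^] i \<otimes> e [^] j) \<otimes> h \<in> A"
      using com_centre[OF hc x] A h(1) by (auto intro: subgroup.m_closed[OF A(1)])
    moreover have "g = c [^] i \<otimes> e [^] j \<otimes> (com h (c [^] i \<otimes> e [^] j) \<otimes> h)"
    proof -
      have "g = h \<otimes> (c [^] i \<otimes> e [^] j)" using h hc c e by (simp add: m_assoc)
      also have "\<dots> = com h (c [^] i \<otimes> e [^] j) \<otimes> ((c [^] i \<otimes> e [^] j) \<otimes> h)"
        by (rule com_mult_swap[OF hc x])
      also have "\<dots> = c [^] i \<otimes> e [^] j \<otimes> (com h (c [^] i \<otimes> e [^] j) \<otimes> h)"
        by (rule com_left_comm[OF hc x x hc, symmetric])
      finally show ?thesis .
    qed
    ultimately show "\<exists>i\<in>?I. ?\<Phi> i = g" by (intro bexI[of _ "(i, j, com h (c [^] i \<otimes> e [^] j) \<otimes> h)"]) auto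
  next
    fix x y assume xy: "x \<in> ?I" "y \<in> ?I"
    then obtain i j h k l h' where ij: "x = (i, j, h)" "y = (k, l, h')" and h: "h \<in> A" "h' \<in> A" by auto
    have hc: "h \<in> carrier G" "h' \<in> carrier G" using h Ac by auto
    have kc: "\<kappa> j h k l \<in> carrier G" using \<kappa>A[OF h(1)] centre_carrier by blast
    show "?\<Psi> x \<in> carrier G" using ij hc c' e' by simp
    show "\<exists>z\<in>?I. ?\<Phi> z = ?\<Phi> x \<otimes> ?\<Phi> y \<and> ?\<Psi> z = ?\<Psi> x \<otimes> ?\<Psi> y"
    proof (intro bexI[of _ "(i + k, j + l, h \<otimes> h' \<otimes> \<kappa> j h k l)"] conjI)
      show "(i + k, j + l, h \<otimes> h' \<otimes> \<kappa> j h k l) \<in> ?I"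
        using \<kappa>A[OF h(1)] h A by (auto intro!: subgroup.m_closed[OF A(1)])
      show "?\<Phi> (i + k, j + l, h \<otimes> h' \<otimes> \<kappa> j h k l) = ?\<Phi> x \<otimes> ?\<Phi> y"
        unfolding ij prod.case triple_mult[OF c(1) e(1) hc] \<kappa>_def[symmetric]
        using hc kc c e by (simp add: m_assoc)
      show "?\<Psi> (i + k, j + l, h \<otimes> h' \<otimes> \<kappa> j h k l) = ?\<Psi> x \<otimes> ?\<Psi> y"
        unfolding ij prod.case triple_mult[OF c'(1) e'(1) hc] com_c'[OF h(1)] com_e'[OF h(1)] com_ec'
          \<kappa>_def[symmetric]
        using hc kc c' e' by (simp add: m_assoc)
    qed
    assume "?\<Phi> x = ?\<Phi> y"
    then have eq: "c [^] i \<otimes> e [^] j \<otimes> h = c [^] k \<otimes> e [^] l \<otimes> h'" by (simp add: ij)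
    define q where "q = e [^] j \<otimes> (h \<otimes> inv h') \<otimes> inv (e [^] j)"
    have qA: "q \<in> A" unfolding q_def
      by (rule commutators_normal[OF A(1)])
        (use com_centre A e h in \<open>auto intro!: subgroup.m_closed[OF A(1)] subgroup.m_inv_closed[OF A(1)]\<close>)
    have qc: "q \<in> carrier G" using qA Ac by blast
    have eq2: "c [^] (i - k) = e [^] (l - j) \<otimes> inv q"
    proof -
      have "c [^] (i - k) = inv (c [^] k) \<otimes> c [^] i"
        using c int_pow_mult[of c "- k" i] by (simp add: int_pow_neg)
      also have "\<dots> = inv (c [^] k) \<otimes> (c [^] i \<otimes> e [^] j \<otimes> h) \<otimes> inv h \<otimes> inv (e [^] j)"
        using c e hc by (simp add: m_assoc)
      also have "\<dots> = e [^] l \<otimes> (h' \<otimes> (inv h \<otimes> inv (e [^] j)))"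
        unfolding eq using c e hc by (simp add: m_assoc)
      also have "\<dots> = e [^] (l - j) \<otimes> inv q"
        unfolding q_def using e hc by (simp add: int_pow_diff inv_mult_group m_assoc)
      finally show ?thesis .
    qed
    have "e [^] (l - j) \<in> adjoin A c"
    proof -
      have "c [^] (i - k) \<in> adjoin A c" by (rule subgroup_int_pow_closed[OF Q(1,3)])
      then show ?thesis unfolding eq2
        using subgroup_mult_right_iff[OF Q(1), of "inv q" "e [^] (l - j)"] qA Q(2) e
          subgroup.m_inv_closed[OF A(1) qA] by auto
    qed
    \<comment> \<open>Exponents of \<open>c\<close> and \<open>e\<close> are determined only modulo
      2, and their even parts are powers of \<open>c \<otimes> c\<close> and
      \<open>e \<otimes> e\<close>, which are also the squares of \<open>c'\<close> and
      \<open>e'\<close>.\<close>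
    then have "even (l - j)" using even_if_mem[OF Q(1) e(1) eQ] by blast
    then obtain t where t: "l - j = 2 * t" by (elim evenE)
    have et: "e [^] (l - j) \<in> centre" unfolding t double[OF e(1)]
      by (rule subgroup_int_pow_closed[OF subgroup_centre square_centre[OF e(1)]])
    have "c [^] (i - k) \<in> A" unfolding eq2
      using et A qA subgroup.m_closed[OF A(1)] subgroup.m_inv_closed[OF A(1)] by blast
    then have "even (i - k)" using even_if_mem[OF A(1) c(1) cA] by blast
    then obtain s where s: "i - k = 2 * s" by (elim evenE)
    have ik: "i = k + 2 * s" "l = j + 2 * t" using s t by simp_all
    define C E where "C = (c \<otimes> c) [^] s" and "E = (e \<otimes> e) [^] t"
    have CE: "C \<in> centre" "E \<in> centre" unfolding C_def E_def
      using subgroup_int_pow_closed[OF subgroup_centre] square_centre c e by auto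
    have CEc: "C \<in> carrier G" "E \<in> carrier G" using CE centre_carrier by auto
    have shift: "x [^] (k + 2 * s) \<otimes> y [^] j \<otimes> h = x [^] k \<otimes> y [^] j \<otimes> (C \<otimes> h)"
      "x [^] k \<otimes> y [^] (j + 2 * t) \<otimes> h' = x [^] k \<otimes> y [^] j \<otimes> (E \<otimes> h')"
      if "x \<in> carrier G" "y \<in> carrier G" "x \<otimes> x = c \<otimes> c" "y \<otimes> y = e \<otimes> e" for x y
      using that hc CEc centre_pull[OF CE(1), of "y [^] j" h]
      by (simp_all add: int_pow_mult double C_def[symmetric] E_def[symmetric] m_assoc)
    have "C \<otimes> h = E \<otimes> h'"
    proof -
      have "c [^] k \<otimes> e [^] j \<otimes> (C \<otimes> h) = c [^] k \<otimes> e [^] j \<otimes> (E \<otimes> h')"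
        using eq shift[OF c(1) e(1) refl refl] unfolding ik by simp
      then show ?thesis by (rule l_cancel) (use c e CEc hc in auto)
    qed
    then show "?\<Psi> x = ?\<Psi> y"
      unfolding ij prod.case ik shift[OF c'(1) e'(1) c'(2) e'(2)] by simp
  qed
  then obtain \<alpha> where \<alpha>: "\<alpha> \<in> hom G G" "\<forall>i\<in>?I. ?\<Phi> i \<in> carrier G \<longrightarrow> \<alpha> (?\<Phi> i) = ?\<Psi> i" by blast
  have "\<alpha> c = c'"
    using \<alpha>(2)[rule_format, of "(1, 0, \<one>)"] subgroup.one_closed[OF A(1)] c c' by simp
  then have "com c (c \<otimes> a) = \<one>"
    using commutes_with_endo_image[OF \<alpha>(1) c(1)] c a by (simp add: com_eq_one_iff c'_def)
  then have "com c a = \<one>" using c a by (simp add: com_mult_right)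
  then show False using com_sym[OF a(1) c(1)] c square_neq_one[OF a] by simp
qed

end

context two_group
begin

text \<open>Two generators over the centre would confine \<open>D\<close> to
  \<open>{\<one>, com a b}\<close>, against \<open>derived_not_pair\<close>; so 8 |Z| \<le> |G|
  \<le> 64 and 4 \<le> |D| \<le> |Z| \<le> 8. This leaves |D| = 4 with three generators, |D| = |Z| =
  4 with |G| = 64, and |D| = |Z| = 8, a special group.\<close>

lemma abelian_if_small:
  assumes small: "card (carrier G) \<le> 64"
  shows "carrier G \<subseteq> centre"
proof (rule ccontr)
  assume nonab: "\<not> carrier G \<subseteq> centre"
  then obtain a where a: "a \<in> carrier G" "a \<notin> centre" by blast
  then obtain b where b: "b \<in> carrier G" and ab: "com a b \<noteq> \<one>" using noncentral_com by blast
  have wD: "com a b \<in> D" using com_derived a b by blast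
  have wc: "com a b \<in> carrier G" using a b by simp
  have pair: "subgroup {\<one>, com a b} G" using pair_subgroup[OF wc derived_square[OF wD]] .
  have notpair: "\<not> D \<subseteq> {\<one>, com a b}" by (rule derived_not_pair[OF nonab wc])
  have "span2 a b \<noteq> carrier G"
    using derived_span2[OF a(1) b _ pair] notpair by auto
  then obtain c where c: "c \<in> carrier G" "c \<notin> span2 a b"
    using subgroup.subset[OF span_subgroup(2)[OF a(1) b b]] by blast
  note sp = span_subgroup[OF a(1) b c(1)]
  define z where "z = card centre"
  have Z2: "centre \<subseteq> span2 a b" using sp by blast
  have "b \<notin> adjoin centre a" using span_strict(2)[OF a(1) b ab] span2_least[OF sp(1,4,7)] by blast
  then have c3: "card (span3 a b c) = 8 * z"
    using card_adjoin[OF sp(2) Z2 c] card_adjoin[OF sp(1,4) b] card_adjoin[OF subgroup_centre subset_refl a]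
    by (simp add: z_def)
  have "{\<one>, com a b} \<subset> D" using wD notpair subgroup.one_closed[OF subgroup_derived] by auto
  then have "2 * card {\<one>, com a b} \<le> card D"
    using psubgroup_card[OF pair subgroup_derived] p_two by simp
  then have D4: "4 \<le> card D" using ab by simp
  have DZ: "card D \<le> z" unfolding z_def
    by (rule card_mono[OF finite_subgroup[OF subgroup_centre] derived_centre])
  have le8: "8 * z \<le> card (carrier G)"
    using card_mono[OF finite_carrier subgroup.subset[OF sp(3)]] c3 by simp
  have power: "card H = 4 \<or> card H = 8" if "subgroup H G" "4 \<le> card H" "card H \<le> 8" for H
  proof -
    obtain k where k: "card (carrier G) = 2 ^ k" using order_prime_power p_two by blast
    have "card H dvd 2 ^ k"
      using card_subgroup_dvd[OF that(1) subgroup_self subgroup.subset[OF that(1)]] k by simp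
    then obtain j where j: "card H = 2 ^ j" using divides_primepow_nat[OF two_is_prime_nat] by blast
    have "j < 4"
    proof (rule ccontr)
      assume "\<not> j < 4"
      then have "(2::nat) ^ 4 \<le> 2 ^ j" by (intro power_increasing) auto
      then show False using that j by simp
    qed
    then consider "j = 0" | "j = 1" | "j = 2" | "j = 3" by linarith
    then show ?thesis using that j by cases auto
  qed
  have z8: "z \<le> 8" using le8 small by simp
  show False
  proof (cases "card D = 4")
    case True
    show False
    proof (cases "span3 a b c = carrier G")
      case G: True
      show False by (rule rank_three_order_four[OF a(1) b ab c G True])
    next
      case False
      then have "span3 a b c \<subset> carrier G" using subgroup.subset[OF sp(3)] by blast
      then have "2 * (8 * z) \<le> card (carrier G)"
        using psubgroup_card[OF sp(3) subgroup_self] p_two c3 by simp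
      then have z4: "z = 4" "card (carrier G) = 64" using small DZ True by auto
      then have "D = centre"
        using card_subset_eq[OF finite_subgroup[OF subgroup_centre] derived_centre] True by (simp add: z_def)
      then interpret two_group_64 G p using True z4 by unfold_locales
      show False by (rule no_two_group_64)
    qed
  next
    case False
    then have D8: "card D = 8" using power[OF subgroup_derived D4] DZ z8 by simp
    then have zz: "z = 8" "card (carrier G) = 64" using DZ z8 le8 small by auto
    then have Deq: "D = centre"
      using card_subset_eq[OF finite_subgroup[OF subgroup_centre] derived_centre] D8 by (simp add: z_def)
    have G: "span3 a b c = carrier G"
      using card_subset_eq[OF finite_carrier subgroup.subset[OF sp(3)]] c3 zz by simp
    interpret special_group G p a b c
    proof unfold_locales
      show "card centre = p ^ 3" using zz p_two by (simp add: z_def)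
    qed (use a b c G Deq square_eq_pow square_centre involution in auto)
    show False by (rule no_special_group)
  qed
qed

end

section \<open>Even exponents above 2, and the conclusion for class 2\<close>

context class2_pE_group
begin

lemma pow_card_subgroup:
  assumes H: "subgroup H G" and x: "x \<in> H"
  shows "x [^] card H = \<one>"
proof -
  interpret H: group "G\<lparr>carrier := H\<rparr>" using H by (rule subgroup_imp_group)
  have "x [^]\<^bsub>G\<lparr>carrier := H\<rparr>\<^esub> order (G\<lparr>carrier := H\<rparr>) = \<one>"
    using H.pow_order_eq_1[of x] x by simp
  then show ?thesis by (simp add: order_def nat_pow_consistent[of x "card H" H])
qed

text \<open>A commutator of order at least 4 makes centralizers drop twice per generator, which
  forces |D| = |Z| = 4, \<open>D\<close> cyclic and \<open>n = 4\<close>. Then \<open>a\<close>,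
  \<open>b\<close> and \<open>a \<otimes> b\<close> all have the involution of \<open>D\<close> as
  eighth power, although taking eighth powers is multiplicative.\<close>

lemma no_large_exponent:
  assumes p2: "p = 2" and small: "card (carrier G) \<le> 64"
    and g: "g \<in> carrier G" and ex: "\<And>x. x \<in> carrier G \<Longrightarrow> x [^] (p ^ Suc e) \<in> D"
    and ge: "g [^] (p ^ e) \<notin> D" and "e \<noteq> 0"
    and a: "a \<in> carrier G" and b: "b \<in> carrier G" and d: "com a b [^] ((2::nat) ^ e) \<noteq> \<one>"
  shows False
proof -
  define m where "m = (2::nat) ^ e"
  have dc: "com a b \<in> carrier G" "com b a \<in> carrier G" using a b by auto
  have comn: "com x y [^] (2 * m) = \<one>" if "x \<in> carrier G" "y \<in> carrier G" for x y
  proof -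
    have "x [^] (2 * m) \<in> centre" using ex[OF that(1)] derived_centre by (auto simp: m_def p2)
    then have "com (x [^] (2 * m)) y = \<one>" using centre_com that by blast
    then show ?thesis using com_nat_pow_left that by simp
  qed
  obtain m' where m': "m = 2 * m'" using \<open>e \<noteq> 0\<close> by (cases e) (auto simp: m_def)
  have dd: "com x y [^] (2::nat) \<noteq> \<one>" "com x y [^] m \<noteq> \<one>" if "(x, y) = (a, b) \<or> (x, y) = (b, a)" for x y
  proof -
    have sw: "com b a [^] (k::nat) = inv (com a b [^] k)" for k
      using com_swap[OF a b] dc by (simp add: nat_pow_inv)
    have "com a b [^] m \<noteq> \<one>" using d by (simp add: m_def)
    then show 1: "com x y [^] m \<noteq> \<one>"
      using that sw dc by (auto simp: inv_eq_1_iff)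
    have xc: "com x y \<in> carrier G" using that dc by auto
    show "com x y [^] (2::nat) \<noteq> \<one>"
    proof
      assume "com x y [^] (2::nat) = \<one>"
      then have "com x y [^] m = \<one>" unfolding m' using xc by (simp flip: nat_pow_pow)
      then show False using 1 by simp
    qed
  qed
  define R where "R = {z \<in> centre. z [^] (2::nat) = \<one>}"
  have R: "subgroup R G"
  proof (rule subgroupI)
    show "R \<subseteq> carrier G" "R \<noteq> {}"
      using centre_carrier subgroup.one_closed[OF subgroup_centre] by (auto simp: R_def intro!: exI[of _ \<one>])
  next
    fix x assume "x \<in> R"
    then show "inv x \<in> R" using centre_carrier
      by (simp add: R_def nat_pow_inv subgroup.m_inv_closed[OF subgroup_centre])
  next
    fix x y assume "x \<in> R" "y \<in> R"
    then show "x \<otimes> y \<in> R" using centre_carrier centre_comm[of x y]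
      by (simp add: R_def pow_mult_distrib subgroup.m_closed[OF subgroup_centre])
  qed
  have ZR: "com z x \<in> R \<and> com x z \<in> R" if "z \<in> centre" "x \<in> carrier G" for z x
    using centre_com[OF that] subgroup.one_closed[OF R] by simp
  have comR: "com x y [^] m \<in> R" if "x \<in> carrier G" "y \<in> carrier G" for x y
    using comn[OF that] subgroup_nat_pow_mem[OF subgroup_centre com_centre[OF that]] that
    by (simp add: R_def nat_pow_pow mult.commute)
  have notR: "com a b \<notin> R" "com b a \<notin> R" using dd by (auto simp: R_def)
  \<comment> \<open>Centralizers of \<open>a\<close>, then of \<open>b\<close>, first modulo
    \<open>R\<close> and then exactly. The steps are strict because of \<open>b\<close>,
    \<open>b [^] m\<close>, \<open>a\<close>, \<open>a [^] m\<close>, as commutators with an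
    \<open>m\<close>-th power lie in \<open>R\<close>.\<close>
  define K1 where "K1 = {v \<in> carrier G. com a v \<in> R}"
  define K2 where "K2 = cent a"
  define K3 where "K3 = K2 \<inter> {v \<in> carrier G. com b v \<in> R}"
  define K4 where "K4 = K2 \<inter> cent b"
  have K: "subgroup K1 G" "subgroup K2 G" "subgroup K3 G" "subgroup K4 G"
    unfolding K1_def K2_def K3_def K4_def
    using a b by (auto intro!: subgroups_Inter_pair subgroup_com_left[OF R] subgroup_cent)
  have one: "\<one> \<in> R" by (rule subgroup.one_closed[OF R])
  have s1: "K1 \<subset> carrier G" using b notR by (auto simp: K1_def)
  have s2: "K2 \<subset> K1"
  proof -
    have "b [^] m \<in> K1" "b [^] m \<notin> K2"
      using comR[OF a b] dd(2)[of a b] a b by (auto simp: K1_def K2_def cent_eq com_nat_pow_right)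
    moreover have "K2 \<subseteq> K1" using a one by (auto simp: K1_def K2_def cent_eq)
    ultimately show ?thesis by blast
  qed
  have s3: "K3 \<subset> K2" using a cent_self[OF a] notR by (auto simp: K3_def K2_def)
  have s4: "K4 \<subset> K3"
  proof -
    have "com a (a [^] m) = \<one>" using a by (simp add: com_nat_pow_right)
    then have "a [^] m \<in> K3" "a [^] m \<notin> K4"
      using comR[OF b a] dd(2)[of b a] a b by (auto simp: K2_def K3_def K4_def cent_eq com_nat_pow_right)
    moreover have "K4 \<subseteq> K3" using b one by (auto simp: K3_def K4_def cent_eq)
    ultimately show ?thesis by blast
  qed
  have "centre \<subseteq> K4" using centre_cent a b by (auto simp: K4_def K2_def)
  then have "card centre \<le> card K4" using finite_subgroup[OF K(4)] by (rule card_mono[rotated])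
  then have Z16: "16 * card centre \<le> card (carrier G)"
    using psubgroup_card[OF K(1) subgroup_self s1] psubgroup_card[OF K(2,1) s2]
      psubgroup_card[OF K(3,2) s3] psubgroup_card[OF K(4,3) s4] p2 by simp
  have RD: "subgroup (R \<inter> D) G" by (intro subgroups_Inter_pair R subgroup_derived)
  have dD: "com a b \<in> D" by (rule com_derived[OF a b])
  have "com a b [^] m \<in> R \<inter> D" using comR[OF a b] subgroup_nat_pow_mem[OF subgroup_derived dD] by blast
  then have "{\<one>} \<subset> R \<inter> D" using dd(2)[of a b] subgroup.one_closed[OF RD] by auto
  then have r1: "p * card {\<one>} \<le> card (R \<inter> D)" by (rule psubgroup_card[OF triv_subgroup RD])
  have "R \<inter> D \<subset> D" using dD notR by blast
  then have r2: "p * card (R \<inter> D) \<le> card D" by (rule psubgroup_card[OF RD subgroup_derived])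
  have r3: "card D \<le> card centre"
    by (rule card_mono[OF finite_subgroup[OF subgroup_centre] derived_centre])
  have r: "2 \<le> card (R \<inter> D)" "2 * card (R \<inter> D) \<le> card D" using r1 r2 unfolding p2 by simp_all
  \<comment> \<open>16 |Z| \<le> 64 bounds \<open>D\<close> by 4 from above, the chain
    \<open>{\<one>}\<close>, \<open>R \<inter> D\<close>, \<open>D\<close> from below.\<close>
  have D4: "card D = 4" and R2: "card (R \<inter> D) = 2" using Z16 small r r3 by linarith+
  have pow4: "x [^] (4::nat) = \<one>" if "x \<in> D" for x
    using pow_card_subgroup[OF subgroup_derived that] D4 by simp
  have "e = 1"
  proof (rule ccontr)
    assume "e \<noteq> 1"
    then have "e = (e - 2) + 2" using \<open>e \<noteq> 0\<close> by simp
    then have "m = 2 ^ ((e - 2) + 2)" by (simp add: m_def)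
    then have "m = 4 * 2 ^ (e - 2)" by simp
    then have "com a b [^] m = \<one>" using pow4[OF dD] dc by (simp flip: nat_pow_pow)
    then show False using dd(2)[of a b] by simp
  qed
  then have n4: "p ^ Suc e = 4" using p2 by simp
  let ?d = "com a b [^] (2::nat)"
  have dR: "?d \<in> R \<inter> D" "?d \<noteq> \<one>" "?d \<in> carrier G"
    using subgroup_nat_pow_mem[OF subgroup_derived dD] derived_centre pow4[OF dD] dd(1)[of a b] dc
    by (auto simp: R_def nat_pow_pow)
  then have RDeq: "{\<one>, ?d} = R \<inter> D"
    using subgroup.one_closed[OF RD] R2 by (intro card_subset_eq finite_subgroup RD) auto
  \<comment> \<open>\<open>x [^] 4\<close> lies in the cyclic group \<open>D\<close> of order 4, so
    \<open>x [^] 8\<close> is \<open>\<one>\<close> or the involution \<open>?d\<close>. It is not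
    \<open>\<one>\<close>, since otherwise the fourth power of \<open>x [^] 2\<close> would be
    trivial and \<open>x [^] 2\<close> central.\<close>
  have eight: "x [^] (8::nat) = ?d" if x: "x \<in> carrier G" and y: "y \<in> carrier G" "com x y [^] (2::nat) \<noteq> \<one>" for x y
  proof -
    have x4: "x [^] (4::nat) \<in> D" using ex[OF x] n4 by simp
    have "(x [^] (4::nat)) [^] (2::nat) \<in> R \<inter> D"
    proof -
      have m: "(x [^] (4::nat)) [^] (2::nat) \<in> D" by (rule subgroup_nat_pow_mem[OF subgroup_derived x4])
      have "((x [^] (4::nat)) [^] (2::nat)) [^] (2::nat) = (x [^] (4::nat)) [^] (4::nat)"
        using x by (simp add: nat_pow_pow)
      then show ?thesis using m derived_centre pow4[OF x4] unfolding R_def by auto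
    qed
    then have "x [^] (8::nat) \<in> {\<one>, ?d}" using RDeq x by (simp add: nat_pow_pow)
    moreover have "x [^] (8::nat) \<noteq> \<one>"
    proof
      assume "x [^] (8::nat) = \<one>"
      then have "(x [^] (2::nat)) [^] (p ^ Suc e) = \<one>" unfolding n4 using x by (simp add: nat_pow_pow)
      then have "x [^] (2::nat) \<in> centre" using central_if_small_exponent[OF g ex ge] x by simp
      then have "com (x [^] (2::nat)) y = \<one>" using centre_com y by blast
      then show False using y x by (simp add: com_nat_pow_left)
    qed
    ultimately show ?thesis by simp
  qed
  have "com (a \<otimes> b) b = com a b" using a b by (simp add: com_mult_left)
  then have "?d = (a \<otimes> b) [^] (8::nat)" using eight[of "a \<otimes> b" b] dd(1)[of a b] a b by simp
  \<comment> \<open>28 is 8 * 7 / 2; being divisible by 4, it removes the commutator, so that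
    \<open>?d\<close> equals its own square.\<close>
  also have "\<dots> = a [^] (8::nat) \<otimes> b [^] (8::nat) \<otimes> com b a [^] (28::nat)"
    using nat_pow_mult_class2[OF a b, of 8] by simp
  also have "com b a [^] (28::nat) = (com b a [^] (4::nat)) [^] (7::nat)" using dc by (simp add: nat_pow_pow)
  also have "\<dots> = \<one>" using pow4[OF com_derived[OF b a]] by simp
  also have "a [^] (8::nat) \<otimes> b [^] (8::nat) \<otimes> \<one> = ?d \<otimes> ?d"
    using eight[OF a b] eight[OF b a] dd(1) dR by simp
  finally have "?d \<otimes> \<one> = ?d \<otimes> ?d" using dR by simp
  then have "\<one> = ?d" by (rule l_cancel) (use dR in auto)
  then show False using dR by simp
qed

theorem abelian_if_order_le:
  assumes small: "card (carrier G) \<le> p ^ 6"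
  shows "carrier G \<subseteq> centre"
proof (rule ccontr)
  assume nonab: "\<not> carrier G \<subseteq> centre"
  then obtain e g where g: "g \<in> carrier G"
    and ex: "\<And>x. x \<in> carrier G \<Longrightarrow> x [^] (p ^ Suc e) \<in> D" and ge: "g [^] (p ^ e) \<notin> D"
    using derived_exponent by blast
  have central: "x \<in> centre" if "x \<in> carrier G" "x [^] (p ^ Suc e) = \<one>" for x
    using central_if_small_exponent[OF g _ ge that] ex by blast
  define n where "n = p ^ Suc e"
  have comn: "com x y [^] n = \<one>" if "x \<in> carrier G" "y \<in> carrier G" for x y
  proof -
    have "x [^] n \<in> centre" using ex[OF that(1)] derived_centre unfolding n_def by blast
    then have "com (x [^] n) y = \<one>" using centre_com that by blast
    then show ?thesis using com_nat_pow_left that by simp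
  qed
  show False
  proof (cases "\<forall>x\<in>carrier G. \<forall>y\<in>carrier G. com x y [^] (n * (n - 1) div 2) = \<one>")
    case True
    interpret power_hom_group G p e g
      by unfold_locales (use small nonab ex g ge True in \<open>auto simp: n_def\<close>)
    obtain a b c where abc: "a \<in> carrier G" "b \<in> carrier G" "c \<in> carrier G" "span3 a b c = carrier G"
      using obtain_span3 by blast
    have omega: "x \<in> centre" if "x \<in> carrier G" "x [^] p = \<one>" for x
      using central[OF that(1)] that by (simp flip: nat_pow_pow)
    interpret special_group G p a b c
      by unfold_locales (use abc card_centre derived_eq_centre pow_p_centre omega in auto)
    show False by (rule no_special_group)
  next
    case False
    then obtain a b where ab: "a \<in> carrier G" "b \<in> carrier G" "com a b [^] (n * (n - 1) div 2) \<noteq> \<one>"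
      by blast
    \<comment> \<open>For odd \<open>n\<close> the exponent is a multiple of \<open>n\<close>, and
      \<open>n\<close>-th powers of commutators are trivial because \<open>n\<close>-th powers are
      central.\<close>
    have p2: "p = 2"
    proof (rule ccontr)
      assume "p \<noteq> 2"
      then have "odd p" using p_prime primes_dvd_imp_eq two_is_prime_nat by metis
      then have "odd n" by (simp add: n_def)
      then obtain k where "n = 2 * k + 1" by (elim oddE)
      then have "n * (n - 1) div 2 = n * k" by simp
      then show False using ab comn[OF ab(1,2)] by (simp flip: nat_pow_pow)
    qed
    then have small': "card (carrier G) \<le> 64" using small by simp
    have "n * (n - 1) div 2 = 2 ^ e * (n - 1)" by (simp add: n_def p2)
    then have d: "com a b [^] ((2::nat) ^ e) \<noteq> \<one>" using ab by (auto simp flip: nat_pow_pow)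
    show False
    proof (cases "e = 0")
      case True
      interpret two_group G p
        by unfold_locales (use p2 ex central True in \<open>auto simp: numeral_2_eq_2\<close>)
      show False using abelian_if_small[OF small'] nonab by blast
    next
      case False
      show False by (rule no_large_exponent[OF p2 small' g ex ge False ab(1,2) d])
    qed
  qed
qed

end

theorem theorem1p4:
  fixes G :: "('a, 'b) monoid_scheme" and p :: nat
  assumes "Factorial_Ring.prime p"
    and "pE_group G p"
    and "finite (carrier G)"
    and "Coset.order G \<le> p ^ 6"
  shows "comm_group G"
proof -
  interpret finite_pE_group G p
    using assms(2,3) by (simp add: finite_pE_group_def finite_pE_group_axioms_def)
  have small: "card (carrier G) \<le> p ^ 6" using assms(4) by (simp add: order_def)
  have "com x y \<in> centre" if xy: "x \<in> carrier G" "y \<in> carrier G" for x y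
    using com_central_if_small[OF small xy] xy by (auto simp: centre_def cent_def)
  then interpret class2_pE_group G p by unfold_locales
  show ?thesis
    using abelian_if_order_le[OF small] by (intro group_comm_groupI) (auto simp: centre_def)
qed

end
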